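(* Let $\lambda<0$, $\eta(x)=\frac{\lambda}{2}|x|^2$ on $\mathbb{R}^n$, and let $\{\Omega_l\}_{l=1}^\infty$ be the family of bounded domains $$\Omega_l=\left\{x\in\mathbb{R}^n:\ \frac{2n}{|\lambda|}<|x|^2<r_l^2\right\},$$ where each $r_l>\sqrt{2n/|\lambda|}$ is a rational number. For each $l$, let $0<\sigma_1\le\sigma_2\le\cdots\to\infty$ be the eigenvalues (repeated according to multiplicity) of the drifted Laplacian $\Delta_\eta$ on real-valued functions on $\Omega_l$ with Dirichlet boundary condition, i.e. of $\Delta_\eta u=-\sigma u$ in $\Omega_l$, $u=0$ on $\partial\Omega_l$. Then, for every $l$, $$\sum_{i=1}^n(\sigma_{i+1}-\sigma_1)\le4(\sigma_1+\lambda n).$$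
   Context: The drifted Laplacian with drifting function $\eta$ is $\Delta_\eta u=\Delta u-\langle\nabla\eta,\nabla u\rangle$, which is formally self-adjoint with respect to the measure $e^{-\eta}dx$. The triple $(\mathbb{R}^n,\delta_{ij},\frac{\lambda}{2}|x|^2)$ with $\lambda<0$ is called the Gaussian expanding soliton; the metric is the Euclidean one. *)

theory Defs
  imports "HOL-Analysis.Analysis"
begin

definition partial_deriv :: "'a::euclidean_space \<Rightarrow> ('a \<Rightarrow> real) \<Rightarrow> 'a \<Rightarrow> real" where
  "partial_deriv b f x = frechet_derivative f (at x) b"

definition grad :: "('a::euclidean_space \<Rightarrow> real) \<Rightarrow> 'a \<Rightarrow> 'a" where
  "grad f x = (\<Sum>b\<in>Basis. partial_deriv b f x *\<^sub>R b)"

definition laplacian :: "('a::euclidean_space \<Rightarrow> real) \<Rightarrow> 'a \<Rightarrow> real" where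
  "laplacian f x = (\<Sum>b\<in>Basis. partial_deriv b (partial_deriv b f) x)"

definition drifted_laplacian ::
    "('a::euclidean_space \<Rightarrow> real) \<Rightarrow> ('a \<Rightarrow> real) \<Rightarrow> 'a \<Rightarrow> real" where
  "drifted_laplacian \<eta> u x = laplacian u x - grad \<eta> x \<bullet> grad u x"

primrec C_k :: "nat \<Rightarrow> ('a::euclidean_space \<Rightarrow> real) \<Rightarrow> bool" where
  "C_k 0 f \<longleftrightarrow> continuous_on UNIV f"
| "C_k (Suc k) f \<longleftrightarrow>
     (\<forall>x. f differentiable (at x)) \<and> (\<forall>b\<in>Basis. C_k k (partial_deriv b f))"

definition test_function :: "'a::euclidean_space set \<Rightarrow> ('a \<Rightarrow> real) \<Rightarrow> bool" where
  "test_function \<Omega> \<phi> \<longleftrightarrow>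
     (\<forall>k. C_k k \<phi>) \<and> compact (closure {x. \<phi> x \<noteq> 0}) \<and> closure {x. \<phi> x \<noteq> 0} \<subseteq> \<Omega>"

text \<open>The measure \<open>e\<^sup>-\<^sup>\<eta> dx\<close> on \<open>\<Omega>\<close>. Functions are defined on the whole space, but all notions
  below only see their restrictions to \<open>\<Omega>\<close>, up to null sets.\<close>

definition drift_measure ::
    "('a::euclidean_space \<Rightarrow> real) \<Rightarrow> 'a set \<Rightarrow> 'a measure" where
  "drift_measure \<eta> \<Omega> = density (lebesgue_on \<Omega>) (\<lambda>x. ennreal (exp (- \<eta> x)))"

definition square_integrable :: "'a measure \<Rightarrow> ('a \<Rightarrow> 'b::euclidean_space) \<Rightarrow> bool" where
  "square_integrable M f \<longleftrightarrow> f \<in> borel_measurable M \<and> integrable M (\<lambda>x. (norm (f x))\<^sup>2)"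

text \<open>The Sobolev space \<open>H\<^sup>1\<^sub>0(\<Omega>, e\<^sup>-\<^sup>\<eta> dx)\<close>: the closure of the test functions in the
  \<open>H\<^sup>1\<close> norm. The limit \<open>G\<close> of the gradients is the weak gradient of \<open>u\<close>.
  Membership expresses the boundary condition \<open>u = 0\<close> on \<open>\<partial>\<Omega>\<close> in the sense of traces.\<close>

definition H10 :: "('a::euclidean_space \<Rightarrow> real) \<Rightarrow> 'a set \<Rightarrow> ('a \<Rightarrow> real) set" where
  "H10 \<eta> \<Omega> = {u. square_integrable (drift_measure \<eta> \<Omega>) u \<and>
     (\<exists>(G :: 'a \<Rightarrow> 'a) (\<phi> :: nat \<Rightarrow> 'a \<Rightarrow> real).
        square_integrable (drift_measure \<eta> \<Omega>) G \<and> (\<forall>k. test_function \<Omega> (\<phi> k)) \<and>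
        (\<lambda>k. \<integral>x. (u x - \<phi> k x)\<^sup>2 \<partial>drift_measure \<eta> \<Omega>) \<longlonglongrightarrow> 0 \<and>
        (\<lambda>k. \<integral>x. (norm (G x - grad (\<phi> k) x))\<^sup>2 \<partial>drift_measure \<eta> \<Omega>) \<longlonglongrightarrow> 0)}"

text \<open>The equation \<open>\<Delta>\<^sub>\<eta> u = f\<close> in \<open>\<Omega>\<close> in the sense of distributions. The operator moves to
  the test function because \<open>\<Delta>\<^sub>\<eta>\<close> is formally self-adjoint with respect to \<open>e\<^sup>-\<^sup>\<eta> dx\<close>.\<close>

definition weak_drifted_laplacian_eq ::
    "('a::euclidean_space \<Rightarrow> real) \<Rightarrow> 'a set \<Rightarrow> ('a \<Rightarrow> real) \<Rightarrow> ('a \<Rightarrow> real) \<Rightarrow> bool" where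
  "weak_drifted_laplacian_eq \<eta> \<Omega> u f \<longleftrightarrow>
     (\<forall>\<phi>. test_function \<Omega> \<phi> \<longrightarrow>
        (\<integral>x. u x * drifted_laplacian \<eta> \<phi> x \<partial>drift_measure \<eta> \<Omega>) =
        (\<integral>x. f x * \<phi> x \<partial>drift_measure \<eta> \<Omega>))"

definition dirichlet_eigenspace ::
    "('a::euclidean_space \<Rightarrow> real) \<Rightarrow> 'a set \<Rightarrow> real \<Rightarrow> ('a \<Rightarrow> real) set" where
  "dirichlet_eigenspace \<eta> \<Omega> s =
     {u \<in> H10 \<eta> \<Omega>. weak_drifted_laplacian_eq \<eta> \<Omega> u (\<lambda>x. - s * u x)}"

text \<open>The eigenspace, taken modulo equality almost everywhere, has dimension \<open>m\<close>; in particular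
  \<open>m = 0\<close> says that \<open>s\<close> is not an eigenvalue.\<close>

definition has_multiplicity ::
    "('a::euclidean_space \<Rightarrow> real) \<Rightarrow> 'a set \<Rightarrow> real \<Rightarrow> nat \<Rightarrow> bool" where
  "has_multiplicity \<eta> \<Omega> s m \<longleftrightarrow>
     (\<exists>u :: nat \<Rightarrow> 'a \<Rightarrow> real.
        (\<forall>i<m. u i \<in> dirichlet_eigenspace \<eta> \<Omega> s) \<and>
        (\<forall>c. (AE x in drift_measure \<eta> \<Omega>. (\<Sum>i<m. c i * u i x) = 0) \<longrightarrow> (\<forall>i<m. c i = 0)) \<and>
        (\<forall>v\<in>dirichlet_eigenspace \<eta> \<Omega> s.
           \<exists>c. AE x in drift_measure \<eta> \<Omega>. v x = (\<Sum>i<m. c i * u i x)))"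

text \<open>\<open>0 < \<sigma> 1 \<le> \<sigma> 2 \<le> \<dots> \<rightarrow> \<infinity>\<close> lists all Dirichlet eigenvalues of \<open>\<Delta>\<^sub>\<eta>\<close> on \<open>\<Omega>\<close>, each as often as
  its multiplicity. Indices start at 1; \<open>\<sigma> 0\<close> is unused. The index sets below are finite
  because \<open>\<sigma>\<close> tends to infinity.\<close>

definition dirichlet_eigenvalues ::
    "('a::euclidean_space \<Rightarrow> real) \<Rightarrow> 'a set \<Rightarrow> (nat \<Rightarrow> real) \<Rightarrow> bool" where
  "dirichlet_eigenvalues \<eta> \<Omega> \<sigma> \<longleftrightarrow>
     0 < \<sigma> 1 \<and> mono_on {1..} \<sigma> \<and> filterlim \<sigma> at_top sequentially \<and>
     (\<forall>s. has_multiplicity \<eta> \<Omega> s (card {i. 1 \<le> i \<and> \<sigma> i = s}))"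

end

(* Let u be a normalised eigenfunction for the lowest Rayleigh quotient mu_0, and let U_0 = u,
   U_1, U_2, ... be successive minimisers of the Rayleigh quotient on the orthogonal complements of
   the earlier ones, with values mu_0 <= mu_1 <= ...; they exist by compactness of H^1_0 in L^2, and
   they are eigenfunctions, so counting multiplicities gives sigma_(j+1) <= mu_j and
   mu_0 <= sigma_1.
   By triangularisation there is an orthonormal basis e_1, ..., e_n and there are numbers a_j such
   that w_j = (x . e_j - a_j) u is orthogonal to U_0, ..., U_(j-1); this yields
   (mu_j - mu_0) int w_j^2 <= 1. Integration by parts gives int w_j (Y . e_j) = -1 for
   Y = 2 grad u - u grad eta, hence mu_j - mu_0 <= int (Y . e_j)^2 by Cauchy-Schwarz.
   Summing over j bounds the sum by int |Y|^2 = 4 mu_0 + 2 lam n - lam^2 int |x|^2 u^2, and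
   |x|^2 > 2n/|lam| on the domain. *)

theory Submission
  imports Defs "HOL-Complex_Analysis.Great_Picard"
begin

section \<open>The real L^2 space of a measure: Cauchy-Schwarz, limits, completeness\<close>

section \<open>Square-integrable functions\<close>

text \<open>The list sigma is given only through multiplicities, and a variational characterisation
  of its entries would require completeness of the eigenfunctions. The independently built
  minimisers avoid this. One-sided comparisons suffice: replacing sigma_(i+1) by mu_i and sigma_1 by
  mu_0 can only increase the left side, and the final bound is increasing in mu_0. That each
  orthogonal complement contains a nonzero competitor comes from sigma tending to infinity.

  Eigenfunctions are known only in H^1_0, and no regularity is proved. A function therefore travels
  together with a gradient as one L^2 object; identities are checked on test functions and pass to
  L^2 limits.

  The field Y is a commutator: Delta_eta (x . e) = - (grad eta) . e, so formally Y . e is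
  [Delta_eta, x . e] applied to u. A shift of x . e by a constant does not change it, which leaves
  a_j free for the orthogonality to U_0.

  The radius is chosen so that lam^2 int |x|^2 u^2 is at least 2n|lam| = - 2 lam n; this turns the
  term 2 lam n of int |Y|^2 into the 4 lam n of the claim.\<close>

definition l2_inner :: "'a measure \<Rightarrow> ('a \<Rightarrow> 'b::euclidean_space) \<Rightarrow> ('a \<Rightarrow> 'b) \<Rightarrow> real" where
  "l2_inner M f g = (\<integral>x. f x \<bullet> g x \<partial>M)"

text \<open>A seminorm only, since functions equal almost everywhere are not identified. Values in
  an arbitrary Euclidean space let one theory serve functions, gradients and pairs of both.\<close>

definition l2_norm :: "'a measure \<Rightarrow> ('a \<Rightarrow> 'b::euclidean_space) \<Rightarrow> real" where
  "l2_norm M f = sqrt (l2_inner M f f)"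

definition l2_tendsto ::
    "'a measure \<Rightarrow> (nat \<Rightarrow> 'a \<Rightarrow> 'b::euclidean_space) \<Rightarrow> ('a \<Rightarrow> 'b) \<Rightarrow> bool" where
  "l2_tendsto M F f \<longleftrightarrow> (\<lambda>k. l2_norm M (\<lambda>x. F k x - f x)) \<longlonglongrightarrow> 0"

lemma square_integrable_measurable: "square_integrable M f \<Longrightarrow> f \<in> borel_measurable M"
  by (simp add: square_integrable_def)

lemma square_integrable_dominated:
  assumes "square_integrable M f" "g \<in> borel_measurable M"
    and le: "\<And>x. x \<in> space M \<Longrightarrow> norm (g x) \<le> C * norm (f x)"
  shows "square_integrable M g"
  unfolding square_integrable_def
proof
  show "integrable M (\<lambda>x. (norm (g x))\<^sup>2)"
  proof (rule Bochner_Integration.integrable_bound)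
    show "integrable M (\<lambda>x. C\<^sup>2 * (norm (f x))\<^sup>2)"
      using assms by (simp add: square_integrable_def)
    show "AE x in M. norm ((norm (g x))\<^sup>2) \<le> norm (C\<^sup>2 * (norm (f x))\<^sup>2)"
    proof (rule AE_I2)
      fix x assume "x \<in> space M"
      then have "(norm (g x))\<^sup>2 \<le> (C * norm (f x))\<^sup>2"
        by (intro power_mono le) auto
      then show "norm ((norm (g x))\<^sup>2) \<le> norm (C\<^sup>2 * (norm (f x))\<^sup>2)"
        by (simp add: power_mult_distrib)
    qed
  qed (use assms in measurable)
qed (fact assms(2))

lemma square_integrable_add:
  assumes "square_integrable M f" "square_integrable M g"
  shows "square_integrable M (\<lambda>x. f x + g x)"
proof -
  have [measurable]: "f \<in> borel_measurable M" "g \<in> borel_measurable M"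
    using assms by (auto simp: square_integrable_def)
  have "integrable M (\<lambda>x. (norm (f x + g x))\<^sup>2)"
  proof (rule Bochner_Integration.integrable_bound)
    show "integrable M (\<lambda>x. 2 * (norm (f x))\<^sup>2 + 2 * (norm (g x))\<^sup>2)"
      using assms by (simp add: square_integrable_def)
    have "(norm (f x + g x))\<^sup>2 \<le> 2 * (norm (f x))\<^sup>2 + 2 * (norm (g x))\<^sup>2" for x
    proof -
      have "(norm (f x + g x))\<^sup>2 \<le> (norm (f x) + norm (g x))\<^sup>2"
        by (intro power_mono norm_triangle_ineq) auto
      moreover have "0 \<le> (norm (f x) - norm (g x))\<^sup>2" by simp
      ultimately show ?thesis by (simp add: power2_eq_square algebra_simps)
    qed
    then show "AE x in M. norm ((norm (f x + g x))\<^sup>2) \<le> norm (2 * (norm (f x))\<^sup>2 + 2 * (norm (g x))\<^sup>2)"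
      by simp
  qed measurable
  then show ?thesis by (simp add: square_integrable_def)
qed

lemma square_integrable_scaleR:
  assumes "square_integrable M f"
  shows "square_integrable M (\<lambda>x. c *\<^sub>R f x)"
  using square_integrable_measurable[OF assms]
  by (intro square_integrable_dominated[OF assms, of _ "\<bar>c\<bar>"]) auto

lemma square_integrable_diff:
  assumes "square_integrable M f" "square_integrable M g"
  shows "square_integrable M (\<lambda>x. f x - g x)"
  using square_integrable_add[OF assms(1) square_integrable_scaleR[OF assms(2), of "-1"]] by simp

lemma square_integrable_zero: "square_integrable M (\<lambda>x. 0)"
  by (simp add: square_integrable_def)

lemma square_integrable_sum:
  assumes "\<And>i. i \<in> I \<Longrightarrow> square_integrable M (f i)"
  shows "square_integrable M (\<lambda>x. \<Sum>i\<in>I. f i x)"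
  using assms
  by (induction I rule: infinite_finite_induct)
     (auto intro: square_integrable_add square_integrable_zero)

lemma square_integrable_Pair:
  assumes "square_integrable M f" "square_integrable M g"
  shows "square_integrable M (\<lambda>x. (f x, g x))"
  using assms unfolding square_integrable_def by (auto simp: norm_Pair)

lemma square_integrable_fst:
  assumes "square_integrable M f" shows "square_integrable M (\<lambda>x. fst (f x))"
proof (rule square_integrable_dominated[OF assms, of _ 1])
  show "(\<lambda>x. fst (f x)) \<in> borel_measurable M"
    using borel_measurable_continuous_on[OF _ square_integrable_measurable[OF assms], of fst]
    by (simp add: continuous_on_fst)
qed (simp add: norm_fst_le[of "fst p" "snd p" for p, simplified])

lemma square_integrable_snd:
  assumes "square_integrable M f" shows "square_integrable M (\<lambda>x. snd (f x))"
proof (rule square_integrable_dominated[OF assms, of _ 1])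
  show "(\<lambda>x. snd (f x)) \<in> borel_measurable M"
    using borel_measurable_continuous_on[OF _ square_integrable_measurable[OF assms], of snd]
    by (simp add: continuous_on_snd)
qed (simp add: norm_snd_le[of "snd p" "fst p" for p, simplified])

lemma integrable_inner_square_integrable:
  assumes "square_integrable M f" "square_integrable M g"
  shows "integrable M (\<lambda>x. f x \<bullet> g x)"
proof (rule Bochner_Integration.integrable_bound)
  show "integrable M (\<lambda>x. (norm (f x))\<^sup>2 + (norm (g x))\<^sup>2)"
    using assms by (simp add: square_integrable_def)
  show "(\<lambda>x. f x \<bullet> g x) \<in> borel_measurable M"
    using assms by (auto simp: square_integrable_def)
  have "\<bar>f x \<bullet> g x\<bar> \<le> (norm (f x))\<^sup>2 + (norm (g x))\<^sup>2" for x
  proof -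
    have "0 \<le> (norm (f x) - norm (g x))\<^sup>2" by simp
    then have "2 * (norm (f x) * norm (g x)) \<le> (norm (f x))\<^sup>2 + (norm (g x))\<^sup>2"
      by (simp add: power2_eq_square algebra_simps)
    moreover have "\<bar>f x \<bullet> g x\<bar> \<le> norm (f x) * norm (g x)" by (rule Cauchy_Schwarz_ineq2)
    moreover have "0 \<le> norm (f x) * norm (g x)" by simp
    ultimately show ?thesis by linarith
  qed
  then show "AE x in M. norm (f x \<bullet> g x) \<le> norm ((norm (f x))\<^sup>2 + (norm (g x))\<^sup>2)"
    by (intro AE_I2) (simp add: order.trans[OF _ abs_ge_self])
qed

lemma l2_inner_commute: "l2_inner M f g = l2_inner M g f"
  by (simp add: l2_inner_def inner_commute)

lemma l2_inner_add_left:
  assumes "square_integrable M f" "square_integrable M g" "square_integrable M h"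
  shows "l2_inner M (\<lambda>x. f x + g x) h = l2_inner M f h + l2_inner M g h"
  using assms by (simp add: l2_inner_def inner_add_left integrable_inner_square_integrable)

lemma l2_inner_scaleR_left: "l2_inner M (\<lambda>x. c *\<^sub>R f x) h = c * l2_inner M f h"
  by (simp add: l2_inner_def)

lemma l2_inner_diff_left:
  assumes "square_integrable M f" "square_integrable M g" "square_integrable M h"
  shows "l2_inner M (\<lambda>x. f x - g x) h = l2_inner M f h - l2_inner M g h"
  using assms by (simp add: l2_inner_def inner_diff_left integrable_inner_square_integrable)

lemma l2_inner_self: "l2_inner M f f = (\<integral>x. (norm (f x))\<^sup>2 \<partial>M)"
  by (simp add: l2_inner_def power2_norm_eq_inner)

lemma l2_inner_nonneg: "0 \<le> l2_inner M f f"
  by (simp add: l2_inner_self)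

lemma l2_norm_nonneg: "0 \<le> l2_norm M f"
  by (simp add: l2_norm_def l2_inner_nonneg)

lemma l2_norm_power2: "(l2_norm M f)\<^sup>2 = l2_inner M f f"
  by (simp add: l2_norm_def l2_inner_nonneg)

lemma l2_inner_self_eq_0:
  assumes "square_integrable M f"
  shows "l2_inner M f f = 0 \<longleftrightarrow> (AE x in M. f x = 0)"
  using assms unfolding l2_inner_self square_integrable_def
  by (subst integral_nonneg_eq_0_iff_AE) auto

text \<open>The quadratic form (s, t) -> |s f - t g|^2 is nonnegative; suitable values of s and t
  give the bound. The case of vanishing \<open>g\<close> is separate because the seminorm may vanish
  on nonzero functions.\<close>

lemma l2_Cauchy_Schwarz_square:
  assumes f: "square_integrable M f" and g: "square_integrable M g"
  shows "(l2_inner M f g)\<^sup>2 \<le> l2_inner M f f * l2_inner M g g"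
proof -
  let ?a = "l2_inner M f f" and ?b = "l2_inner M f g" and ?c = "l2_inner M g g"
  have quad: "0 \<le> s * s * ?a - 2 * s * t * ?b + t * t * ?c" for s t
  proof -
    have sq: "square_integrable M (\<lambda>x. s *\<^sub>R f x)" "square_integrable M (\<lambda>x. t *\<^sub>R g x)"
      using f g by (auto intro: square_integrable_scaleR)
    let ?h = "\<lambda>x. s *\<^sub>R f x - t *\<^sub>R g x"
    have sqh: "square_integrable M ?h" by (intro square_integrable_diff sq)
    have "l2_inner M ?h ?h = s * l2_inner M f ?h - t * l2_inner M g ?h"
      by (simp add: l2_inner_diff_left[OF sq sqh] l2_inner_scaleR_left)
    also have "l2_inner M f ?h = s * ?a - t * ?b"
      by (simp add: l2_inner_commute[of M f ?h] l2_inner_diff_left[OF sq f] l2_inner_scaleR_left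
            l2_inner_commute[of M g f])
    also have "l2_inner M g ?h = s * ?b - t * ?c"
      by (simp add: l2_inner_commute[of M g ?h] l2_inner_diff_left[OF sq g] l2_inner_scaleR_left)
    finally show ?thesis using l2_inner_nonneg[of M ?h] by (simp add: algebra_simps)
  qed
  show ?thesis
  proof (cases "?c = 0")
    case True
    have "?b = 0"
    proof (rule ccontr)
      assume "?b \<noteq> 0"
      \<comment> \<open>With \<open>?c = 0\<close> the form is linear in t; this t makes it equal to
        - ?a - 2, which is negative.\<close>
      have "0 \<le> ?a - 2 * ((?a + 1) / ?b) * ?b"
        using quad[of 1 "(?a + 1) / ?b"] True by simp
      then show False using \<open>?b \<noteq> 0\<close> l2_inner_nonneg[of M f] by simp
    qed
    then show ?thesis using True by simp
  next
    case False
    then have "0 < ?c" using l2_inner_nonneg[of M g] by simp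
    \<comment> \<open>The minimising ratio t / s = \<open>?b / ?c\<close>, cleared of its
      denominator.\<close>
    have "0 \<le> ?c * (?a * ?c - ?b\<^sup>2)"
      using quad[of ?c ?b] by (simp add: power2_eq_square algebra_simps)
    then show ?thesis using \<open>0 < ?c\<close> by (simp add: zero_le_mult_iff)
  qed
qed

lemma l2_Cauchy_Schwarz:
  assumes "square_integrable M f" "square_integrable M g"
  shows "\<bar>l2_inner M f g\<bar> \<le> l2_norm M f * l2_norm M g"
proof (rule power2_le_imp_le)
  show "\<bar>l2_inner M f g\<bar>\<^sup>2 \<le> (l2_norm M f * l2_norm M g)\<^sup>2"
    using l2_Cauchy_Schwarz_square[OF assms] by (simp add: power_mult_distrib l2_norm_power2)
qed (simp add: l2_norm_nonneg)

lemma l2_norm_triangle: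
  assumes "square_integrable M f" "square_integrable M g"
  shows "l2_norm M (\<lambda>x. f x + g x) \<le> l2_norm M f + l2_norm M g"
proof (rule power2_le_imp_le)
  let ?h = "\<lambda>x. f x + g x"
  have h: "square_integrable M ?h" using assms by (rule square_integrable_add)
  have "l2_inner M ?h ?h = l2_inner M f f + 2 * l2_inner M f g + l2_inner M g g"
    using assms h
    by (simp add: l2_inner_add_left l2_inner_commute[of M f ?h] l2_inner_commute[of M g ?h]
          l2_inner_commute[of M g f])
  then show "(l2_norm M ?h)\<^sup>2 \<le> (l2_norm M f + l2_norm M g)\<^sup>2"
    using l2_Cauchy_Schwarz[OF assms]
    by (simp add: l2_norm_power2 power2_sum)
qed (simp add: l2_norm_nonneg)

lemma l2_norm_uminus: "l2_norm M (\<lambda>x. - f x) = l2_norm M f"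
  by (simp add: l2_norm_def l2_inner_def)

lemma l2_norm_minus_commute: "l2_norm M (\<lambda>x. f x - g x) = l2_norm M (\<lambda>x. g x - f x)"
  using l2_norm_uminus[of M "\<lambda>x. f x - g x"] by simp

lemma l2_norm_diff_triangle:
  assumes "square_integrable M f" "square_integrable M g" "square_integrable M h"
  shows "l2_norm M (\<lambda>x. f x - h x) \<le> l2_norm M (\<lambda>x. f x - g x) + l2_norm M (\<lambda>x. g x - h x)"
  using l2_norm_triangle[of M "\<lambda>x. f x - g x" "\<lambda>x. g x - h x"] assms
  by (simp add: square_integrable_diff)

lemma l2_norm_dominated:
  assumes f: "square_integrable M f" and g: "g \<in> borel_measurable M"
    and le: "\<And>x. x \<in> space M \<Longrightarrow> norm (g x) \<le> C * norm (f x)" and "0 \<le> C"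
  shows "l2_norm M g \<le> C * l2_norm M f"
proof (rule power2_le_imp_le)
  have g': "square_integrable M g" using square_integrable_dominated[OF f g le] .
  have "l2_inner M g g \<le> (\<integral>x. C\<^sup>2 * (norm (f x))\<^sup>2 \<partial>M)"
    unfolding l2_inner_self
  proof (rule integral_mono)
    show "(norm (g x))\<^sup>2 \<le> C\<^sup>2 * (norm (f x))\<^sup>2" if "x \<in> space M" for x
      using power_mono[OF le[OF that], of 2] by (simp add: power_mult_distrib)
  qed (use f g' in \<open>auto simp: square_integrable_def\<close>)
  then show "(l2_norm M g)\<^sup>2 \<le> (C * l2_norm M f)\<^sup>2"
    by (simp add: l2_norm_power2 power_mult_distrib l2_inner_self)
qed (simp add: l2_norm_nonneg \<open>0 \<le> C\<close>)

text \<open>The general tool for continuity in L^2: it covers projections of pairs, products with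
  bounded functions and inner products with a fixed vector, each of which is Lipschitz
  pointwise.\<close>

lemma l2_tendsto_dominated:
  assumes lim: "l2_tendsto M F f"
    and sq: "\<And>k. square_integrable M (F k)" "square_integrable M f"
    and G: "\<And>k. G k \<in> borel_measurable M" "g \<in> borel_measurable M"
    and le: "\<And>k x. x \<in> space M \<Longrightarrow> norm (G k x - g x) \<le> C * norm (F k x - f x)"
  shows "l2_tendsto M G g"
  unfolding l2_tendsto_def
proof (rule real_tendsto_sandwich[where f="\<lambda>_. 0" and h="\<lambda>k. \<bar>C\<bar> * l2_norm M (\<lambda>x. F k x - f x)"])
  show "\<forall>\<^sub>F k in sequentially. l2_norm M (\<lambda>x. G k x - g x) \<le> \<bar>C\<bar> * l2_norm M (\<lambda>x. F k x - f x)"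
  proof (intro always_eventually allI l2_norm_dominated)
    fix k x assume "x \<in> space M"
    then show "norm (G k x - g x) \<le> \<bar>C\<bar> * norm (F k x - f x)"
      using le[of x k] mult_right_mono[OF abs_ge_self[of C], of "norm (F k x - f x)"] by simp
  qed (use sq G in \<open>auto intro: square_integrable_diff\<close>)
  show "(\<lambda>k. \<bar>C\<bar> * l2_norm M (\<lambda>x. F k x - f x)) \<longlonglongrightarrow> 0"
    using tendsto_mult_left[OF lim[unfolded l2_tendsto_def], of "\<bar>C\<bar>"] by simp
qed (simp_all add: l2_norm_nonneg)

lemma l2_tendsto_const: "l2_tendsto M (\<lambda>_. f) f"
  by (simp add: l2_tendsto_def l2_norm_def l2_inner_def)

lemma l2_tendsto_add:
  assumes "l2_tendsto M F f" "l2_tendsto M G g"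
    and "\<And>k. square_integrable M (F k)" "square_integrable M f"
    and "\<And>k. square_integrable M (G k)" "square_integrable M g"
  shows "l2_tendsto M (\<lambda>k x. F k x + G k x) (\<lambda>x. f x + g x)"
  unfolding l2_tendsto_def
proof (rule real_tendsto_sandwich[where f="\<lambda>_. 0"
      and h="\<lambda>k. l2_norm M (\<lambda>x. F k x - f x) + l2_norm M (\<lambda>x. G k x - g x)"])
  show "\<forall>\<^sub>F k in sequentially. l2_norm M (\<lambda>x. F k x + G k x - (f x + g x))
      \<le> l2_norm M (\<lambda>x. F k x - f x) + l2_norm M (\<lambda>x. G k x - g x)"
  proof (intro always_eventually allI)
    fix k
    show "l2_norm M (\<lambda>x. F k x + G k x - (f x + g x))
      \<le> l2_norm M (\<lambda>x. F k x - f x) + l2_norm M (\<lambda>x. G k x - g x)"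
      using l2_norm_triangle[OF square_integrable_diff[OF assms(3,4), of k]
          square_integrable_diff[OF assms(5,6), of k]] by (simp add: algebra_simps)
  qed
  show "(\<lambda>k. l2_norm M (\<lambda>x. F k x - f x) + l2_norm M (\<lambda>x. G k x - g x)) \<longlonglongrightarrow> 0"
    using tendsto_add[OF assms(1,2)[unfolded l2_tendsto_def]] by simp
qed (simp_all add: l2_norm_nonneg)

text \<open>Bilinear expansion around the limits leaves three error terms, each of them small by
  Cauchy-Schwarz.\<close>

lemma l2_tendsto_inner:
  assumes lim: "l2_tendsto M F f" "l2_tendsto M G g"
    and F: "\<And>k. square_integrable M (F k)" and f: "square_integrable M f"
    and G: "\<And>k. square_integrable M (G k)" and g: "square_integrable M g"
  shows "(\<lambda>k. l2_inner M (F k) (G k)) \<longlonglongrightarrow> l2_inner M f g"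
proof -
  let ?a = "\<lambda>k x. F k x - f x" and ?b = "\<lambda>k x. G k x - g x"
  note sq = F f G g square_integrable_diff
  have eq: "l2_inner M (F k) (G k)
      = l2_inner M f g + (l2_inner M (?a k) (?b k) + l2_inner M (?a k) g + l2_inner M (?b k) f)" for k
  proof -
    have "l2_inner M (?b k) (?a k) = l2_inner M (G k) (?a k) - l2_inner M g (?a k)"
      by (intro l2_inner_diff_left sq)
    moreover have "l2_inner M (?a k) (G k) = l2_inner M (F k) (G k) - l2_inner M f (G k)"
      by (intro l2_inner_diff_left sq)
    moreover have "l2_inner M (?b k) f = l2_inner M (G k) f - l2_inner M g f"
      by (intro l2_inner_diff_left sq)
    ultimately show ?thesis
      by (simp add: l2_inner_commute[of M "?b k" "?a k"] l2_inner_commute[of M "G k"]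
          l2_inner_commute[of M g])
  qed
  have z: "(\<lambda>k. l2_inner M (?a k) (?b k)) \<longlonglongrightarrow> 0"
  proof (rule Lim_null_comparison)
    show "\<forall>\<^sub>F k in sequentially. norm (l2_inner M (?a k) (?b k)) \<le> l2_norm M (?a k) * l2_norm M (?b k)"
      by (intro always_eventually allI)
         (simp add: l2_Cauchy_Schwarz[OF square_integrable_diff[OF F f] square_integrable_diff[OF G g]])
    show "(\<lambda>k. l2_norm M (?a k) * l2_norm M (?b k)) \<longlonglongrightarrow> 0"
      using tendsto_mult[OF lim[unfolded l2_tendsto_def]] by simp
  qed
  have z1: "(\<lambda>k. l2_inner M (?a k) g) \<longlonglongrightarrow> 0"
  proof (rule Lim_null_comparison)
    show "\<forall>\<^sub>F k in sequentially. norm (l2_inner M (?a k) g) \<le> l2_norm M (?a k) * l2_norm M g"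
      by (intro always_eventually allI)
         (simp add: l2_Cauchy_Schwarz[OF square_integrable_diff[OF F f] g])
    show "(\<lambda>k. l2_norm M (?a k) * l2_norm M g) \<longlonglongrightarrow> 0"
      using tendsto_mult_right[OF lim(1)[unfolded l2_tendsto_def]] by simp
  qed
  have z2: "(\<lambda>k. l2_inner M (?b k) f) \<longlonglongrightarrow> 0"
  proof (rule Lim_null_comparison)
    show "\<forall>\<^sub>F k in sequentially. norm (l2_inner M (?b k) f) \<le> l2_norm M (?b k) * l2_norm M f"
      by (intro always_eventually allI)
         (simp add: l2_Cauchy_Schwarz[OF square_integrable_diff[OF G g] f])
    show "(\<lambda>k. l2_norm M (?b k) * l2_norm M f) \<longlonglongrightarrow> 0"
      using tendsto_mult_right[OF lim(2)[unfolded l2_tendsto_def]] by simp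
  qed
  show ?thesis
    unfolding eq using tendsto_add[OF tendsto_const[of "l2_inner M f g"] tendsto_add[OF tendsto_add[OF z z1] z2]] by simp
qed

lemma l2_tendsto_iff_integral:
  "l2_tendsto M F f \<longleftrightarrow> (\<lambda>k. \<integral>x. (norm (F k x - f x))\<^sup>2 \<partial>M) \<longlonglongrightarrow> 0"
proof
  assume "l2_tendsto M F f"
  from tendsto_power[OF this[unfolded l2_tendsto_def], of 2]
  show "(\<lambda>k. \<integral>x. (norm (F k x - f x))\<^sup>2 \<partial>M) \<longlonglongrightarrow> 0"
    by (simp add: l2_norm_power2 l2_inner_self)
next
  assume "(\<lambda>k. \<integral>x. (norm (F k x - f x))\<^sup>2 \<partial>M) \<longlonglongrightarrow> 0"
  from tendsto_real_sqrt[OF this] show "l2_tendsto M F f"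
    by (simp add: l2_tendsto_def l2_norm_def l2_inner_self)
qed

text \<open>Riesz-Fischer. Finiteness of the measure turns L^2-Cauchy into L^1-Cauchy, which gives a
  subsequence converging almost everywhere; Fatou's lemma then shows that its pointwise limit is
  also the L^2 limit of the whole sequence.\<close>

theorem l2_complete:
  assumes "finite_measure M" and F: "\<And>k. square_integrable M (F k)"
    and cauchy: "\<And>e. 0 < e \<Longrightarrow> \<exists>N. \<forall>m\<ge>N. \<forall>n\<ge>N. l2_norm M (\<lambda>x. F m x - F n x) < e"
  obtains f where "square_integrable M f" "l2_tendsto M F f"
proof -
  interpret finite_measure M by fact
  have [measurable]: "F k \<in> borel_measurable M" for k
    using F by (simp add: square_integrable_def)
  have one: "square_integrable M (\<lambda>x. 1::real)" by (simp add: square_integrable_def)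
  have normsq: "square_integrable M (\<lambda>x. norm (F m x - F n x))" for m n
    using square_integrable_diff[OF F F, of m n] by (simp add: square_integrable_def)
  have int: "integrable M (F k)" for k
  proof (rule Bochner_Integration.integrable_bound)
    show "integrable M (\<lambda>x. 1 \<bullet> norm (F k x))"
      using F[of k] by (intro integrable_inner_square_integrable[OF one]) (simp add: square_integrable_def)
  qed auto
  have L1: "(\<integral>x. norm (F m x - F n x) \<partial>M) \<le> l2_norm M (\<lambda>x. 1::real) * l2_norm M (\<lambda>x. F m x - F n x)" for m n
    using l2_Cauchy_Schwarz[OF one normsq, of m n] by (simp add: l2_inner_def l2_norm_def power2_norm_eq_inner flip: power2_eq_square)
  obtain r where r: "strict_mono r" and AEC: "AE x in M. Cauchy (\<lambda>i. F (r i) x)"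
  proof (rule cauchy_L1_AE_cauchy_subseq[where s=F and M=M])
    fix e :: real assume "0 < e"
    \<comment> \<open>The summand 1 keeps the divisor positive even if the measure is zero.\<close>
    define d where "d = e / (l2_norm M (\<lambda>x. 1::real) + 1)"
    have pos: "0 < l2_norm M (\<lambda>x. 1::real) + 1" using l2_norm_nonneg[of M "\<lambda>x. 1::real"] by simp
    then have "0 < d" using \<open>0 < e\<close> by (simp add: d_def)
    from cauchy[OF this] obtain N where N: "\<And>m n. m \<ge> N \<Longrightarrow> n \<ge> N \<Longrightarrow> l2_norm M (\<lambda>x. F m x - F n x) < d" by blast
    show "\<exists>N. \<forall>i\<ge>N. \<forall>j\<ge>N. (LINT x|M. norm (F i x - F j x)) < e"
    proof (intro exI allI impI)
      fix i j assume "N \<le> i" "N \<le> j"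
      have "(LINT x|M. norm (F i x - F j x)) \<le> l2_norm M (\<lambda>x. 1::real) * l2_norm M (\<lambda>x. F i x - F j x)" by (rule L1)
      also have "\<dots> \<le> l2_norm M (\<lambda>x. 1::real) * d"
        using N[OF \<open>N \<le> i\<close> \<open>N \<le> j\<close>] by (intro mult_left_mono) (auto simp: l2_norm_nonneg)
      also have "\<dots> < (l2_norm M (\<lambda>x. 1::real) + 1) * d" using \<open>0 < d\<close> by (simp add: algebra_simps)
      also have "\<dots> = e" using pos by (simp add: d_def)
      finally show "(LINT x|M. norm (F i x - F j x)) < e" .
    qed
  qed (auto simp: int)
  define f where "f x = lim (\<lambda>i. F (r i) x)" for x
  have [measurable]: "f \<in> borel_measurable M"
    unfolding f_def by (rule borel_measurable_lim_metric) measurable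
  have AEL: "AE x in M. (\<lambda>i. F (r i) x) \<longlonglongrightarrow> f x"
    using AEC by eventually_elim (simp add: f_def Cauchy_convergent_iff convergent_LIMSEQ_iff)
  \<comment> \<open>Fatou along the subsequence with \<open>n\<close> fixed: \<open>r i\<close>
    exceeds \<open>N\<close> eventually, so the Cauchy bound passes to the pointwise limit.\<close>
  have fatou: "(\<integral>\<^sup>+x. ennreal ((norm (F n x - f x))\<^sup>2) \<partial>M) \<le> ennreal (e\<^sup>2)"
    if e: "0 < e" and N: "\<And>m. m \<ge> N \<Longrightarrow> l2_norm M (\<lambda>x. F n x - F m x) < e" for n N e
  proof -
    have "(\<integral>\<^sup>+x. ennreal ((norm (F n x - f x))\<^sup>2) \<partial>M)
        = (\<integral>\<^sup>+x. liminf (\<lambda>i. ennreal ((norm (F n x - F (r i) x))\<^sup>2)) \<partial>M)"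
    proof (rule nn_integral_cong_AE)
      show "AE x in M. ennreal ((norm (F n x - f x))\<^sup>2) = liminf (\<lambda>i. ennreal ((norm (F n x - F (r i) x))\<^sup>2))"
        using AEL
      proof eventually_elim
        case (elim x)
        have "(\<lambda>i. ennreal ((norm (F n x - F (r i) x))\<^sup>2)) \<longlonglongrightarrow> ennreal ((norm (F n x - f x))\<^sup>2)"
          by (intro tendsto_intros elim)
        from lim_imp_Liminf[OF _ this] show ?case by simp
      qed
    qed
    also have "\<dots> \<le> liminf (\<lambda>i. \<integral>\<^sup>+x. ennreal ((norm (F n x - F (r i) x))\<^sup>2) \<partial>M)"
      by (rule nn_integral_liminf) measurable
    also have "\<dots> \<le> ennreal (e\<^sup>2)"
    proof (rule Liminf_le)
      show "\<forall>\<^sub>F i in sequentially. (\<integral>\<^sup>+x. ennreal ((norm (F n x - F (r i) x))\<^sup>2) \<partial>M) \<le> ennreal (e\<^sup>2)"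
      proof (rule eventually_sequentiallyI[of N])
        fix i assume "N \<le> i"
        then have "N \<le> r i" using seq_suble[OF r, of i] by simp
        have "(\<integral>\<^sup>+x. ennreal ((norm (F n x - F (r i) x))\<^sup>2) \<partial>M) = ennreal ((l2_norm M (\<lambda>x. F n x - F (r i) x))\<^sup>2)"
          using square_integrable_diff[OF F F, of n "r i"] unfolding l2_norm_power2 l2_inner_self square_integrable_def
          by (intro nn_integral_eq_integral) auto
        also have "\<dots> \<le> ennreal (e\<^sup>2)"
          using N[OF \<open>N \<le> r i\<close>] l2_norm_nonneg by (intro ennreal_leI power_mono) auto
        finally show "(\<integral>\<^sup>+x. ennreal ((norm (F n x - F (r i) x))\<^sup>2) \<partial>M) \<le> ennreal (e\<^sup>2)" .
      qed
    qed simp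
    finally show ?thesis .
  qed
  have diff: "square_integrable M (\<lambda>x. F n x - f x) \<and> l2_norm M (\<lambda>x. F n x - f x) \<le> e"
    if e: "0 < e" and N: "\<And>m. m \<ge> N \<Longrightarrow> l2_norm M (\<lambda>x. F n x - F m x) < e" for n N e
  proof -
    have *: "(\<integral>\<^sup>+x. ennreal ((norm (F n x - f x))\<^sup>2) \<partial>M) \<le> ennreal (e\<^sup>2)"
      using fatou[OF e N] by blast
    have i: "integrable M (\<lambda>x. (norm (F n x - f x))\<^sup>2)"
      by (rule integrableI_bounded) (use le_less_trans[OF *] in auto)
    have "ennreal (l2_inner M (\<lambda>x. F n x - f x) (\<lambda>x. F n x - f x)) \<le> ennreal (e\<^sup>2)"
      using * nn_integral_eq_integral[OF i] unfolding l2_inner_self by simp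
    then have "(l2_norm M (\<lambda>x. F n x - f x))\<^sup>2 \<le> e\<^sup>2"
      by (simp add: l2_norm_power2)
    then have "l2_norm M (\<lambda>x. F n x - f x) \<le> e"
      by (rule power2_le_imp_le) (use e in simp)
    then show ?thesis using i by (simp add: square_integrable_def)
  qed
  obtain N where N: "\<And>m n. m \<ge> N \<Longrightarrow> n \<ge> N \<Longrightarrow> l2_norm M (\<lambda>x. F m x - F n x) < 1"
    using cauchy[of 1] by auto
  \<comment> \<open>Square integrability of \<open>f\<close> is read off from f = F N - (F N -
    f).\<close>
  have "square_integrable M (\<lambda>x. F N x - f x)"
    using diff[of 1 N N] N by auto
  from square_integrable_diff[OF F[of N] this] have sf: "square_integrable M f" by simp
  have "l2_tendsto M F f"
    unfolding l2_tendsto_def LIMSEQ_iff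
  proof (intro allI impI)
    fix e :: real assume "0 < e"
    then obtain N where N: "\<And>m n. m \<ge> N \<Longrightarrow> n \<ge> N \<Longrightarrow> l2_norm M (\<lambda>x. F m x - F n x) < e/2"
      using cauchy[of "e/2"] by auto
    have "l2_norm M (\<lambda>x. F n x - f x) \<le> e/2" if "n \<ge> N" for n
      using diff[of "e/2" N n] N that \<open>0 < e\<close> by auto
    then show "\<exists>N. \<forall>n\<ge>N. norm (l2_norm M (\<lambda>x. F n x - f x) - 0) < e"
      using \<open>0 < e\<close> by (intro exI[of _ N]) (force simp: l2_norm_nonneg dest: le_less_trans)
  qed
  with sf show ?thesis using that by blast
qed

section \<open>Gradients, C^k functions and the algebra of test functions\<close>

section \<open>Smooth functions\<close>

lemma differentiable_has_derivative_grad: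
  fixes f :: "'a::euclidean_space \<Rightarrow> real"
  assumes "f differentiable (at x)"
  shows "(f has_derivative (\<lambda>v. v \<bullet> grad f x)) (at x)"
proof -
  have d: "(f has_derivative frechet_derivative f (at x)) (at x)"
    using assms frechet_derivative_works by blast
  then have lin: "linear (frechet_derivative f (at x))"
    by (rule has_derivative_linear)
  have "frechet_derivative f (at x) v = v \<bullet> grad f x" for v
  proof -
    have "frechet_derivative f (at x) v = frechet_derivative f (at x) (\<Sum>b\<in>Basis. (v \<bullet> b) *\<^sub>R b)"
      by (simp add: euclidean_representation)
    also have "\<dots> = (\<Sum>b\<in>Basis. (v \<bullet> b) * frechet_derivative f (at x) b)"
      by (simp add: linear_sum[OF lin] linear_cmul[OF lin])
    also have "\<dots> = v \<bullet> grad f x"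
      by (simp add: grad_def partial_deriv_def inner_sum_right mult.commute)
    finally show ?thesis .
  qed
  then have "frechet_derivative f (at x) = (\<lambda>v. v \<bullet> grad f x)" by auto
  with d show ?thesis by simp
qed

lemma has_derivative_imp_grad:
  fixes f :: "'a::euclidean_space \<Rightarrow> real"
  assumes "(f has_derivative (\<lambda>v. v \<bullet> g)) (at x)"
  shows "grad f x = g"
proof -
  have "grad f x = (\<Sum>b\<in>Basis. (b \<bullet> g) *\<^sub>R b)"
    by (simp add: grad_def partial_deriv_def frechet_derivative_at[OF assms, symmetric])
  also have "\<dots> = (\<Sum>b\<in>Basis. (g \<bullet> b) *\<^sub>R b)"
    by (intro sum.cong refl) (metis inner_commute)
  finally show ?thesis by (simp add: euclidean_representation)
qed

lemma partial_deriv_eq_grad: "b \<in> Basis \<Longrightarrow> partial_deriv b f x = grad f x \<bullet> b"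
  by (simp add: grad_def inner_sum_left inner_Basis if_distrib cong: if_cong)

lemma partial_deriv_add:
  assumes "f differentiable (at x)" "g differentiable (at x)"
  shows "partial_deriv b (\<lambda>x. f x + g x) x = partial_deriv b f x + partial_deriv b g x"
  unfolding partial_deriv_def
  by (simp add: frechet_derivative_at[OF has_derivative_add[OF assms[unfolded frechet_derivative_works]], symmetric])

lemma partial_deriv_mult:
  fixes f g :: "'a::euclidean_space \<Rightarrow> real"
  assumes "f differentiable (at x)" "g differentiable (at x)"
  shows "partial_deriv b (\<lambda>x. f x * g x) x = f x * partial_deriv b g x + partial_deriv b f x * g x"
  unfolding partial_deriv_def
  by (simp add: frechet_derivative_at[OF has_derivative_mult[OF assms[unfolded frechet_derivative_works]], symmetric])

text \<open>At the bottom, differentiability everywhere supplies continuity; above, the claim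
  descends to the partial derivatives. The product rule needs this, because it pairs an
  undifferentiated factor with a derivative of the other.\<close>

lemma C_k_lower: "C_k (Suc k) f \<Longrightarrow> C_k k f"
proof (induction k arbitrary: f)
  case 0
  then show ?case
    by (auto simp: continuous_on_eq_continuous_at intro: differentiable_imp_continuous_within)
next
  case (Suc k)
  then show ?case by (metis C_k.simps(2))
qed

lemma C_k_const: "C_k k (\<lambda>x. c)"
proof (induction k arbitrary: c)
  case (Suc k)
  have "partial_deriv b (\<lambda>x::'a. c) = (\<lambda>x. 0)" for b
    by (auto simp: partial_deriv_def)
  then show ?case using Suc by simp
qed simp

lemma C_k_add: "C_k k f \<Longrightarrow> C_k k g \<Longrightarrow> C_k k (\<lambda>x. f x + g x)"
proof (induction k arbitrary: f g)
  case (Suc k)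
  then have "partial_deriv b (\<lambda>x. f x + g x) = (\<lambda>x. partial_deriv b f x + partial_deriv b g x)" for b
    by (auto simp: partial_deriv_add)
  with Suc show ?case by auto
qed (auto intro: continuous_on_add)

lemma C_k_mult: "C_k k f \<Longrightarrow> C_k k g \<Longrightarrow> C_k k (\<lambda>x. f x * g x)"
proof (induction k arbitrary: f g)
  case (Suc k)
  then have "partial_deriv b (\<lambda>x. f x * g x) = (\<lambda>x. f x * partial_deriv b g x + partial_deriv b f x * g x)" for b
    by (auto simp: partial_deriv_mult)
  moreover have "C_k k f" "C_k k g" using Suc.prems by (auto intro: C_k_lower simp del: C_k.simps)
  ultimately show ?case using Suc.prems by (auto intro!: C_k_add Suc.IH)
qed (auto intro: continuous_on_mult)

lemma C_k_inner: "C_k k (\<lambda>x. x \<bullet> e)"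
proof (cases k)
  case (Suc m)
  have d: "((\<lambda>x. x \<bullet> e) has_derivative (\<lambda>v. v \<bullet> e)) (at x)" for x :: 'a
    by (intro derivative_eq_intros) auto
  then have "partial_deriv b (\<lambda>x. x \<bullet> e) = (\<lambda>x. b \<bullet> e)" for b
    by (auto simp: partial_deriv_def frechet_derivative_at[OF d, symmetric])
  then show ?thesis using d C_k_const by (auto simp: Suc differentiable_def)
qed (auto intro: continuous_intros)

lemma test_function_differentiable: "test_function \<Omega> \<phi> \<Longrightarrow> \<phi> differentiable (at x)"
  unfolding test_function_def by (metis C_k.simps(2))

lemma test_function_has_derivative:
  "test_function \<Omega> \<phi> \<Longrightarrow> (\<phi> has_derivative (\<lambda>v. v \<bullet> grad \<phi> x)) (at x)"
  by (intro differentiable_has_derivative_grad test_function_differentiable)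

lemma test_function_continuous: "test_function \<Omega> \<phi> \<Longrightarrow> continuous_on UNIV \<phi>"
  unfolding test_function_def by (metis C_k.simps(1))

lemma C_k_grad_continuous: "C_k (Suc 0) f \<Longrightarrow> continuous_on UNIV (grad f)"
  unfolding grad_def by (auto intro!: continuous_intros)

lemma test_function_grad_continuous: "test_function \<Omega> \<phi> \<Longrightarrow> continuous_on UNIV (grad \<phi>)"
  unfolding test_function_def by (metis C_k_grad_continuous)

lemma test_function_support_subset: "test_function \<Omega> \<phi> \<Longrightarrow> closure {x. \<phi> x \<noteq> 0} \<subseteq> \<Omega>"
  by (simp add: test_function_def)

lemma test_function_outside: "test_function \<Omega> \<phi> \<Longrightarrow> x \<notin> \<Omega> \<Longrightarrow> \<phi> x = 0"
  using test_function_support_subset[of \<Omega> \<phi>] closure_subset[of "{x. \<phi> x \<noteq> 0}"] by auto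

lemma grad_outside_support:
  fixes f :: "'a::euclidean_space \<Rightarrow> real"
  assumes "x \<notin> closure {x. f x \<noteq> 0}"
  shows "grad f x = 0"
proof (rule has_derivative_imp_grad)
  show "(f has_derivative (\<lambda>v. v \<bullet> 0)) (at x)"
  proof (rule has_derivative_transform_within_open[of "\<lambda>_. 0"])
    show "open (- closure {x. f x \<noteq> 0})" by auto
    show "0 = f y" if "y \<in> - closure {x. f x \<noteq> 0}" for y
      using that closure_subset[of "{x. f x \<noteq> 0}"] by auto
  qed (use assms in auto)
qed

lemma gradient_outside_support:
  fixes f :: "'a::euclidean_space \<Rightarrow> real"
  assumes deriv: "(f has_derivative (\<lambda>v. v \<bullet> g)) (at x)"
    and K: "compact K" "\<And>x. x \<notin> K \<Longrightarrow> f x = 0" and x: "x \<notin> K"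
  shows "g = 0"
proof -
  have "closure {x. f x \<noteq> 0} \<subseteq> K"
    using K by (intro closure_minimal) (auto intro: compact_imp_closed)
  then have "grad f x = 0" using x by (intro grad_outside_support) auto
  then show ?thesis using has_derivative_imp_grad[OF deriv] by simp
qed

lemma test_function_support:
  assumes "test_function \<Omega> \<phi>"
  shows "compact (closure {x. \<phi> x \<noteq> 0})" "closure {x. \<phi> x \<noteq> 0} \<subseteq> \<Omega>"
    "\<And>x. x \<notin> closure {x. \<phi> x \<noteq> 0} \<Longrightarrow> \<phi> x = 0"
    "\<And>x. x \<notin> closure {x. \<phi> x \<noteq> 0} \<Longrightarrow> grad \<phi> x = 0"
  using assms grad_outside_support[of _ \<phi>] closure_subset[of "{x. \<phi> x \<noteq> 0}"]
  by (auto simp: test_function_def)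

lemma test_function_mult:
  assumes "test_function \<Omega> \<phi>" "\<And>k. C_k k h"
  shows "test_function \<Omega> (\<lambda>x. h x * \<phi> x)"
proof -
  have sub: "closure {x. h x * \<phi> x \<noteq> 0} \<subseteq> closure {x. \<phi> x \<noteq> 0}"
    by (intro closure_mono) auto
  have "compact (closure {x. \<phi> x \<noteq> 0} \<inter> closure {x. h x * \<phi> x \<noteq> 0})"
    using assms by (intro compact_Int_closed) (auto simp: test_function_def)
  moreover have "closure {x. \<phi> x \<noteq> 0} \<inter> closure {x. h x * \<phi> x \<noteq> 0} = closure {x. h x * \<phi> x \<noteq> 0}"
    using sub by blast
  ultimately show ?thesis
    using assms sub by (auto simp: test_function_def intro: C_k_mult)
qed

lemma test_function_zero: "test_function \<Omega> (\<lambda>x. 0)"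
  by (simp add: test_function_def C_k_const)

lemma test_function_add:
  assumes "test_function \<Omega> \<phi>" "test_function \<Omega> \<psi>"
  shows "test_function \<Omega> (\<lambda>x. \<phi> x + \<psi> x)"
proof -
  let ?K = "closure {x. \<phi> x \<noteq> 0} \<union> closure {x. \<psi> x \<noteq> 0}"
  have sub: "closure {x. \<phi> x + \<psi> x \<noteq> 0} \<subseteq> ?K"
    by (subst closure_Un[symmetric]) (intro closure_mono, auto)
  have "compact (?K \<inter> closure {x. \<phi> x + \<psi> x \<noteq> 0})"
    using assms by (intro compact_Int_closed compact_Un) (auto simp: test_function_def)
  moreover have "?K \<inter> closure {x. \<phi> x + \<psi> x \<noteq> 0} = closure {x. \<phi> x + \<psi> x \<noteq> 0}"
    using sub by blast
  moreover have "closure {x. \<phi> x + \<psi> x \<noteq> 0} \<subseteq> \<Omega>"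
    using assms sub unfolding test_function_def by blast
  ultimately show ?thesis
    using assms by (simp add: test_function_def C_k_add)
qed

lemma test_function_scale: "test_function \<Omega> \<phi> \<Longrightarrow> test_function \<Omega> (\<lambda>x. c * \<phi> x)"
  by (erule test_function_mult) (rule C_k_const)

lemma test_function_diff:
  "test_function \<Omega> \<phi> \<Longrightarrow> test_function \<Omega> \<psi> \<Longrightarrow> test_function \<Omega> (\<lambda>x. \<phi> x - \<psi> x)"
  using test_function_add[of \<Omega> \<phi> "\<lambda>x. (-1) * \<psi> x"] test_function_scale[of \<Omega> \<psi> "-1"] by simp

lemma grad_add:
  assumes "f differentiable (at x)" "g differentiable (at x)"
  shows "grad (\<lambda>x. f x + g x) x = grad f x + grad g x"
  using assms by (simp add: grad_def partial_deriv_add scaleR_add_left sum.distrib)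

lemma grad_mult:
  fixes f g :: "'a::euclidean_space \<Rightarrow> real"
  assumes "f differentiable (at x)" "g differentiable (at x)"
  shows "grad (\<lambda>x. f x * g x) x = f x *\<^sub>R grad g x + g x *\<^sub>R grad f x"
  using assms by (simp add: grad_def partial_deriv_mult scaleR_add_left sum.distrib scaleR_sum_right mult.commute)

lemma grad_scale:
  fixes f :: "'a::euclidean_space \<Rightarrow> real"
  assumes "f differentiable (at x)"
  shows "grad (\<lambda>x. c * f x) x = c *\<^sub>R grad f x"
proof -
  have "grad (\<lambda>x::'a. c) x = 0" by (rule has_derivative_imp_grad) simp
  then show ?thesis using grad_mult[of "\<lambda>_. c" x f] assms by simp
qed

lemma grad_diff:
  fixes f g :: "'a::euclidean_space \<Rightarrow> real"
  assumes "f differentiable (at x)" "g differentiable (at x)"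
  shows "grad (\<lambda>x. f x - g x) x = grad f x - grad g x"
  using grad_add[of f x "\<lambda>x. (-1) * g x"] assms grad_scale[of g x "-1"] by simp

lemma grad_inner: "grad (\<lambda>x. x \<bullet> e) x = e"
  by (rule has_derivative_imp_grad) (intro derivative_eq_intros; simp)

section \<open>The divergence theorem for compactly supported functions\<close>

section \<open>Integration by parts\<close>

lemma integrable_compact_support:
  fixes f :: "'a::euclidean_space \<Rightarrow> 'b::euclidean_space"
  assumes "continuous_on UNIV f" "compact K" "\<And>x. x \<notin> K \<Longrightarrow> f x = 0"
  shows "integrable lborel f"
proof -
  have "integrable lborel (\<lambda>x. indicator K x *\<^sub>R f x)"
    using assms by (intro borel_integrable_compact continuous_on_subset[OF assms(1)]) auto
  moreover have "(\<lambda>x. indicator K x *\<^sub>R f x) = f"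
    using assms(3) by (auto simp: indicator_def fun_eq_iff)
  ultimately show ?thesis by simp
qed

lemma integral_lborel_translate:
  fixes f :: "'a::euclidean_space \<Rightarrow> 'b::{banach, second_countable_topology}"
  assumes [measurable]: "f \<in> borel_measurable borel"
  shows "(\<integral>x. f (x + c) \<partial>lborel) = (\<integral>x. f x \<partial>lborel)"
proof -
  have "(\<integral>x. f x \<partial>lborel) = (\<integral>x. f x \<partial>distr lborel borel ((+) c))"
    by (simp add: lborel_distr_plus)
  also have "\<dots> = (\<integral>x. f (x + c) \<partial>lborel)"
    by (subst integral_distr) (auto simp: add.commute)
  finally show ?thesis by simp
qed

lemma nn_integral_lborel_translate:
  fixes f :: "'a::euclidean_space \<Rightarrow> ennreal"
  assumes [measurable]: "f \<in> borel_measurable borel"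
  shows "(\<integral>\<^sup>+x. f (x + c) \<partial>lborel) = (\<integral>\<^sup>+x. f x \<partial>lborel)"
proof -
  have "(\<integral>\<^sup>+x. f x \<partial>lborel) = (\<integral>\<^sup>+x. f x \<partial>distr lborel borel ((+) c))"
    by (simp add: lborel_distr_plus)
  also have "\<dots> = (\<integral>\<^sup>+x. f (x + c) \<partial>lborel)"
    by (subst nn_integral_distr) (auto simp: add.commute)
  finally show ?thesis by simp
qed

lemma has_real_derivative_along_line:
  fixes f :: "'a::euclidean_space \<Rightarrow> real"
  assumes "(f has_derivative (\<lambda>v. v \<bullet> g)) (at (x + t *\<^sub>R b))"
  shows "((\<lambda>t. f (x + t *\<^sub>R b)) has_real_derivative b \<bullet> g) (at t)"
proof -
  have "((\<lambda>t. x + t *\<^sub>R b) has_derivative (\<lambda>s. s *\<^sub>R b)) (at t)"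
    by (intro derivative_eq_intros) auto
  from has_derivative_compose[OF this assms]
  show ?thesis
    by (simp add: has_field_derivative_def mult_commute_abs)
qed

text \<open>By translation invariance every difference quotient of \<open>f\<close> in direction
  \<open>b\<close> has integral 0. Dominated convergence carries this to the derivative, so no
  boundary and no iterated integral occurs.\<close>

lemma integral_directional_derivative_eq_0:
  fixes f :: "'a::euclidean_space \<Rightarrow> real"
  assumes deriv: "\<And>x. (f has_derivative (\<lambda>v. v \<bullet> g x)) (at x)"
    and cont: "continuous_on UNIV g"
    and K: "compact K" "\<And>x. x \<notin> K \<Longrightarrow> f x = 0"
  shows "(\<integral>x. b \<bullet> g x \<partial>lborel) = 0"
proof -
  define d where "d m = inverse (real (Suc m))" for m
  have d: "0 < d m" "d m \<le> 1" for m by (auto simp: d_def inverse_le_1_iff)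
  define s where "s m x = (f (x + d m *\<^sub>R b) - f x) / d m" for m x
  have contf: "continuous_on UNIV f"
    using deriv by (auto simp: continuous_on_eq_continuous_at intro: has_derivative_continuous)
  then have mf[measurable]: "f \<in> borel_measurable borel"
    by (rule borel_measurable_continuous_onI)
  have mg[measurable]: "g \<in> borel_measurable borel"
    using cont by (rule borel_measurable_continuous_onI)
  have g0: "g x = 0" if "x \<notin> K" for x
    using gradient_outside_support[OF deriv K(1) _ that] K(2) by blast
  have "bounded (g ` K)"
    using K cont by (intro compact_imp_bounded compact_continuous_image continuous_on_subset[OF cont]) auto
  then obtain C0 where C0: "\<And>x. x \<in> K \<Longrightarrow> norm (g x) \<le> C0"
    by (auto simp: bounded_iff)
  define C where "C = max C0 0"
  \<comment> \<open>The maximum with 0 in \<open>C\<close> covers an empty \<open>K\<close>, for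
    which \<open>C0\<close> may be negative.\<close>
  have C: "norm (g x) \<le> C" for x
    using C0[of x] g0[of x] by (cases "x \<in> K") (auto simp: C_def)
  \<comment> \<open>Since \<open>d m\<close> is at most 1, all difference quotients are supported in
    the sum of \<open>K\<close> and a ball of radius \<open>norm b\<close>; hence one multiple of an
    indicator dominates them all.\<close>
  define K' where "K' = {x + y | x y. x \<in> K \<and> y \<in> cball 0 (norm b)}"
  define w where "w x = (norm b * C) * indicator K' x" for x
  have K': "compact K'"
    unfolding K'_def using K by (intro compact_sums) auto
  have "integrable lborel w"
    unfolding w_def using K' emeasure_compact_finite[OF K']
    by (intro integrable_mult_right integrable_real_indicator) (auto simp: borel_compact)
  have lim: "(\<lambda>m. s m x) \<longlonglongrightarrow> b \<bullet> g x" for x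
  proof -
    have "((\<lambda>t. f (x + t *\<^sub>R b)) has_real_derivative b \<bullet> g x) (at 0)"
      by (rule has_real_derivative_along_line) (simp add: deriv)
    then have "((\<lambda>h. (f (x + h *\<^sub>R b) - f x) / h) \<longlongrightarrow> b \<bullet> g x) (at 0)"
      by (simp add: has_field_derivative_iff)
    moreover have "filterlim d (at 0) sequentially"
      unfolding filterlim_at using d LIMSEQ_inverse_real_of_nat
      by (auto simp: d_def[abs_def] less_imp_neq[symmetric])
    ultimately show ?thesis
      unfolding s_def by (rule filterlim_compose)
  qed
  have bound: "norm (s m x) \<le> w x" for m x
  proof (cases "x \<in> K'")
    case True
    obtain t where t: "f (x + d m *\<^sub>R b) - f (x + 0 *\<^sub>R b) = (d m - 0) * (b \<bullet> g (x + t *\<^sub>R b))"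
      using MVT2[of 0 "d m" "\<lambda>t. f (x + t *\<^sub>R b)" "\<lambda>t. b \<bullet> g (x + t *\<^sub>R b)"] d
        has_real_derivative_along_line[OF deriv] by blast
    then have "s m x = b \<bullet> g (x + t *\<^sub>R b)" using d[of m] by (simp add: s_def)
    also have "\<bar>\<dots>\<bar> \<le> norm b * norm (g (x + t *\<^sub>R b))" by (rule Cauchy_Schwarz_ineq2)
    also have "\<dots> \<le> norm b * C" by (intro mult_left_mono C) simp
    finally show ?thesis using True by (simp add: w_def)
  next
    case False
    have "x \<notin> K"
    proof
      assume "x \<in> K"
      then have "x + 0 \<in> K'" unfolding K'_def by force
      with False show False by simp
    qed
    moreover have "x + d m *\<^sub>R b \<notin> K"
    proof
      assume *: "x + d m *\<^sub>R b \<in> K"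
      have "norm (- (d m *\<^sub>R b)) \<le> norm b"
        using d[of m] mult_right_mono[of "d m" 1 "norm b"] by simp
      with * have "(x + d m *\<^sub>R b) + (- (d m *\<^sub>R b)) \<in> K'"
        unfolding K'_def by (intro CollectI exI[of _ "x + d m *\<^sub>R b"] exI[of _ "- (d m *\<^sub>R b)"] conjI) simp_all
      with False show False by simp
    qed
    ultimately show ?thesis using K order.trans[OF norm_ge_zero C] by (simp add: s_def w_def)
  qed
  have "(\<lambda>m. \<integral>x. s m x \<partial>lborel) \<longlonglongrightarrow> (\<integral>x. b \<bullet> g x \<partial>lborel)"
  proof (rule integral_dominated_convergence[where w=w])
    show "s m \<in> borel_measurable lborel" for m unfolding s_def by measurable
  qed (use lim bound \<open>integrable lborel w\<close> in auto)
  moreover have "(\<integral>x. s m x \<partial>lborel) = 0" for m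
  proof -
    have i: "integrable lborel f" using contf K by (rule integrable_compact_support)
    then have i': "integrable lborel (\<lambda>x. f (x + d m *\<^sub>R b))"
      using integrable_distr_eq[of "(+) (d m *\<^sub>R b)" lborel borel f]
      by (simp add: lborel_distr_plus add.commute)
    show ?thesis
      unfolding s_def using i i' by (simp add: integral_lborel_translate)
  qed
  ultimately show ?thesis using LIMSEQ_unique[OF tendsto_const] by fastforce
qed

section \<open>Rellich's theorem by averaging over small cubes\<close>

section \<open>Compactness\<close>

text \<open>The increment is the integral of the directional derivative over the segment from
  \<open>x\<close> to \<open>x + h\<close>. Cauchy-Schwarz in the segment parameter, Tonelli and
  translation invariance remove that parameter. With \<open>ennreal\<close> integrals no
  integrability has to be assumed.\<close>

lemma translation_estimate:
  fixes f :: "'a::euclidean_space \<Rightarrow> real"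
  assumes deriv: "\<And>x. (f has_derivative (\<lambda>v. v \<bullet> g x)) (at x)"
    and cont: "continuous_on UNIV g"
  shows "(\<integral>\<^sup>+x. ennreal ((f (x + h) - f x)\<^sup>2) \<partial>lborel) \<le> (\<integral>\<^sup>+x. ennreal ((h \<bullet> g x)\<^sup>2) \<partial>lborel)"
proof -
  have mg[measurable]: "g \<in> borel_measurable borel"
    using cont by (rule borel_measurable_continuous_onI)
  let ?d = "\<lambda>x t. h \<bullet> g (x + t *\<^sub>R h)"
  have contd: "continuous_on UNIV (?d x)" for x
    by (intro continuous_intros continuous_on_compose2[OF cont]) auto
  have pt: "ennreal ((f (x + h) - f x)\<^sup>2) \<le> (\<integral>\<^sup>+t. ennreal ((?d x t)\<^sup>2) * indicator {0..1} t \<partial>lborel)" for x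
  proof -
    have ftc: "(\<integral>t. ?d x t * indicator {0..1} t \<partial>lborel) = f (x + 1 *\<^sub>R h) - f (x + 0 *\<^sub>R h)"
    proof (rule integral_FTC_Icc_real)
      show "((\<lambda>t. f (x + t *\<^sub>R h)) has_real_derivative ?d x t) (at t)" for t
        by (rule has_real_derivative_along_line[OF deriv])
      show "isCont (?d x) t" for t
        using contd continuous_on_eq_continuous_at by blast
    qed simp
    have i2: "integrable lborel (\<lambda>t. (?d x t)\<^sup>2 * indicator {0..1} t)"
      using borel_integrable_compact[of "{0..1::real}" "\<lambda>t. (?d x t)\<^sup>2"] contd[of x]
      by (simp add: mult.commute continuous_on_power continuous_on_subset)
    have sq1: "square_integrable lborel (indicator {0..1} :: real \<Rightarrow> real)"
    proof -
      have "(\<lambda>x::real. (norm (indicator {0..1} x :: real))\<^sup>2) = indicator {0..1}"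
        by (auto simp: indicator_def)
      then show ?thesis by (simp add: square_integrable_def)
    qed
    have sq2: "square_integrable lborel (\<lambda>t. ?d x t * indicator {0..1} t)"
    proof -
      have "(\<lambda>t. (norm (?d x t * indicator {0..1} t))\<^sup>2) = (\<lambda>t. (?d x t)\<^sup>2 * indicator {0..1} t)"
        by (auto simp: indicator_def)
      then show ?thesis using i2 by (simp add: square_integrable_def)
    qed
    have "(l2_inner lborel (indicator {0..1}) (\<lambda>t. ?d x t * indicator {0..1} t))\<^sup>2
      \<le> l2_inner lborel (indicator {0..1} :: real \<Rightarrow> real) (indicator {0..1}) *
        l2_inner lborel (\<lambda>t. ?d x t * indicator {0..1} t) (\<lambda>t. ?d x t * indicator {0..1} t)"
      by (rule l2_Cauchy_Schwarz_square[OF sq1 sq2])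
    moreover have "l2_inner lborel (indicator {0..1}) (\<lambda>t. ?d x t * indicator {0..1} t) = f (x + h) - f x"
    proof -
      have "l2_inner lborel (indicator {0..1}) (\<lambda>t. ?d x t * indicator {0..1} t)
        = (\<integral>t. ?d x t * indicator {0..1} t \<partial>lborel)"
        unfolding l2_inner_def by (rule Bochner_Integration.integral_cong) (auto simp: indicator_def)
      then show ?thesis using ftc by simp
    qed
    moreover have "l2_inner lborel (indicator {0..1} :: real \<Rightarrow> real) (indicator {0..1}) = 1"
    proof -
      have "(\<lambda>t::real. indicator {0..1} t \<bullet> (indicator {0..1} t :: real)) = indicator {0..1}"
        by (auto simp: indicator_def)
      then show ?thesis unfolding l2_inner_def by simp
    qed
    moreover have "l2_inner lborel (\<lambda>t. ?d x t * indicator {0..1} t) (\<lambda>t. ?d x t * indicator {0..1} t)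
       = (\<integral>t. (?d x t)\<^sup>2 * indicator {0..1} t \<partial>lborel)"
      unfolding l2_inner_def
      by (rule Bochner_Integration.integral_cong) (auto simp: indicator_def power2_eq_square)
    ultimately have "(f (x + h) - f x)\<^sup>2 \<le> (\<integral>t. (?d x t)\<^sup>2 * indicator {0..1} t \<partial>lborel)" by simp
    then have "ennreal ((f (x + h) - f x)\<^sup>2) \<le> ennreal (\<integral>t. (?d x t)\<^sup>2 * indicator {0..1} t \<partial>lborel)"
      by (rule ennreal_leI)
    also have "\<dots> = (\<integral>\<^sup>+t. ennreal ((?d x t)\<^sup>2 * indicator {0..1} t) \<partial>lborel)"
      using i2 by (intro nn_integral_eq_integral[symmetric]) auto
    also have "\<dots> = (\<integral>\<^sup>+t. ennreal ((?d x t)\<^sup>2) * indicator {0..1} t \<partial>lborel)"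
      by (intro nn_integral_cong) (auto simp: indicator_def)
    finally show ?thesis .
  qed
  have "(\<integral>\<^sup>+x. ennreal ((f (x + h) - f x)\<^sup>2) \<partial>lborel)
      \<le> (\<integral>\<^sup>+x. (\<integral>\<^sup>+t. ennreal ((?d x t)\<^sup>2) * indicator {0..1} t \<partial>lborel) \<partial>lborel)"
    by (intro nn_integral_mono pt)
  also have "\<dots> = (\<integral>\<^sup>+t. (\<integral>\<^sup>+x. ennreal ((?d x t)\<^sup>2) * indicator {0..1} t \<partial>lborel) \<partial>lborel)"
    by (rule lborel_pair.Fubini') measurable
  also have "\<dots> = (\<integral>\<^sup>+t. (\<integral>\<^sup>+x. ennreal ((h \<bullet> g x)\<^sup>2) \<partial>lborel) * indicator {0..1::real} t \<partial>lborel)"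
  proof (intro nn_integral_cong)
    fix t :: real
    show "(\<integral>\<^sup>+x. ennreal ((?d x t)\<^sup>2) * indicator {0..1} t \<partial>lborel)
        = (\<integral>\<^sup>+x. ennreal ((h \<bullet> g x)\<^sup>2) \<partial>lborel) * indicator {0..1::real} t"
      using nn_integral_lborel_translate[of "\<lambda>x. ennreal ((h \<bullet> g x)\<^sup>2)" "t *\<^sub>R h"]
      by (simp add: nn_integral_multc)
  qed
  also have "\<dots> = (\<integral>\<^sup>+x. ennreal ((h \<bullet> g x)\<^sup>2) \<partial>lborel)"
    by (simp add: nn_integral_cmult_indicator)
  finally show ?thesis .
qed

text \<open>The half-open cube with side \<open>d\<close> that contains a point, labelled by an integer vector.\<close>

definition cube_label :: "real \<Rightarrow> 'a::euclidean_space \<Rightarrow> 'a" where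
  "cube_label d x = (\<Sum>b\<in>Basis. of_int \<lfloor>x \<bullet> b / d\<rfloor> *\<^sub>R b)"

lemma cube_label_inner: "b \<in> Basis \<Longrightarrow> cube_label d x \<bullet> b = of_int \<lfloor>x \<bullet> b / d\<rfloor>"
  by (simp add: cube_label_def inner_sum_left inner_Basis if_distrib cong: if_cong)

lemma cube_label_measurable[measurable]: "cube_label d \<in> borel_measurable borel"
  unfolding cube_label_def by measurable

lemma cube_label_eqD:
  assumes "cube_label d x = cube_label d y" "b \<in> Basis" "0 < d"
  shows "\<bar>(x - y) \<bullet> b\<bar> \<le> d"
proof -
  have "\<lfloor>x \<bullet> b / d\<rfloor> = \<lfloor>y \<bullet> b / d\<rfloor>"
    using assms(1) cube_label_inner[OF assms(2)] by (metis of_int_eq_iff)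
  then have "\<bar>x \<bullet> b / d - y \<bullet> b / d\<bar> \<le> 1" by linarith
  then have "\<bar>(x \<bullet> b - y \<bullet> b) / d\<bar> \<le> 1" by (simp only: diff_divide_distrib)
  then show ?thesis using \<open>0 < d\<close> by (simp add: inner_diff_left divide_le_eq)
qed

lemma finite_cube_label_image:
  fixes S :: "'a::euclidean_space set"
  assumes "bounded S" "0 < d"
  shows "finite (cube_label d ` S)"
proof -
  obtain B where B: "\<And>x. x \<in> S \<Longrightarrow> norm x \<le> B" using assms(1) by (auto simp: bounded_iff)
  define m where "m = \<lceil>B / d\<rceil> + 1"
  have fl: "\<lfloor>x \<bullet> b / d\<rfloor> \<in> {-m..m}" if "x \<in> S" "b \<in> Basis" for x b
  proof -
    have "\<bar>x \<bullet> b / d\<bar> \<le> B / d"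
      using B[OF that(1)] Basis_le_norm[OF that(2), of x] \<open>0 < d\<close> by (simp add: divide_right_mono)
    then have "- (B / d) \<le> x \<bullet> b / d" "x \<bullet> b / d \<le> B / d" by linarith+
    then show ?thesis unfolding m_def atLeastAtMost_iff by linarith
  qed
  have "cube_label d ` S \<subseteq> (\<lambda>c. \<Sum>b\<in>Basis. of_int (c b) *\<^sub>R b) ` (PiE (Basis::'a set) (\<lambda>_. {-m..m}))"
  proof (rule image_subsetI)
    fix x assume "x \<in> S"
    show "cube_label d x \<in> (\<lambda>c. \<Sum>b\<in>Basis. of_int (c b) *\<^sub>R b) ` (PiE (Basis::'a set) (\<lambda>_. {-m..m}))"
    proof (rule image_eqI)
      show "(\<lambda>b\<in>Basis. \<lfloor>x \<bullet> b / d\<rfloor>) \<in> (PiE (Basis::'a set) (\<lambda>_. {-m..m}))"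
        using fl[OF \<open>x \<in> S\<close>] by auto
      show "cube_label d x = (\<Sum>b\<in>Basis. of_int ((\<lambda>b\<in>Basis. \<lfloor>x \<bullet> b / d\<rfloor>) b) *\<^sub>R b)"
        by (simp add: cube_label_def)
    qed
  qed
  then show ?thesis
    by (rule finite_subset) (intro finite_imageI finite_PiE, auto)
qed

text \<open>Only rough control is wanted: a closed cube of side 2d around \<open>x0\<close> gives
  finiteness, and an open box of side d inside the half-open cube gives the lower bound.\<close>

lemma cube_measure:
  fixes x0 :: "'a::euclidean_space"
  assumes "0 < d"
  defines "Q \<equiv> {x. cube_label d x = cube_label d x0}"
  shows "Q \<in> sets lborel" "emeasure lborel Q < \<infinity>" "d ^ DIM('a) \<le> measure lborel Q"
proof -
  have "{x \<in> space borel. cube_label d x = cube_label d x0} \<in> sets borel" by measurable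
  then show m: "Q \<in> sets lborel" by (simp add: Q_def)
  have "Q \<subseteq> cbox (x0 - (\<Sum>b\<in>Basis. d *\<^sub>R b)) (x0 + (\<Sum>b\<in>Basis. d *\<^sub>R b))"
  proof
    fix x assume "x \<in> Q"
    then have "cube_label d x = cube_label d x0" by (simp add: Q_def)
    from cube_label_eqD[OF this _ \<open>0 < d\<close>]
    show "x \<in> cbox (x0 - (\<Sum>b\<in>Basis. d *\<^sub>R b)) (x0 + (\<Sum>b\<in>Basis. d *\<^sub>R b))"
      by (force simp: mem_box inner_simps inner_sum_left inner_Basis abs_le_iff if_distrib cong: if_cong)
  qed
  then have "emeasure lborel Q \<le> emeasure lborel (cbox (x0 - (\<Sum>b\<in>Basis. d *\<^sub>R b)) (x0 + (\<Sum>b\<in>Basis. d *\<^sub>R b)))"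
    by (intro emeasure_mono) auto
  then show fin: "emeasure lborel Q < \<infinity>"
    using emeasure_lborel_cbox_finite le_less_trans by blast
  define a where "a = d *\<^sub>R cube_label d x0"
  have ab: "a \<bullet> b = d * of_int \<lfloor>x0 \<bullet> b / d\<rfloor>" if "b \<in> Basis" for b
    using cube_label_inner[OF that] by (simp add: a_def)
  define e where "e = a + (\<Sum>b\<in>Basis. d *\<^sub>R b)"
  have eb: "e \<bullet> b = a \<bullet> b + d" if "b \<in> Basis" for b
    using that by (simp add: e_def inner_simps inner_sum_left inner_Basis if_distrib cong: if_cong)
  have sub: "box a e \<subseteq> Q"
  proof
    fix x assume x: "x \<in> box a e"
    have "\<lfloor>x \<bullet> b / d\<rfloor> = \<lfloor>x0 \<bullet> b / d\<rfloor>" if "b \<in> Basis" for b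
    proof (rule floor_unique)
      have "d * of_int \<lfloor>x0 \<bullet> b / d\<rfloor> < x \<bullet> b" "x \<bullet> b < d * of_int \<lfloor>x0 \<bullet> b / d\<rfloor> + d"
        using x that ab eb by (auto simp: mem_box)
      then show "of_int \<lfloor>x0 \<bullet> b / d\<rfloor> \<le> x \<bullet> b / d" "x \<bullet> b / d < of_int \<lfloor>x0 \<bullet> b / d\<rfloor> + 1"
        using \<open>0 < d\<close> by (simp_all add: field_simps)
    qed
    then show "x \<in> Q" by (simp add: Q_def cube_label_def)
  qed
  have "emeasure lborel (box a e) = ennreal (\<Prod>b\<in>Basis. (e - a) \<bullet> b)"
    using eb \<open>0 < d\<close> by (intro emeasure_lborel_box) auto
  also have "(\<Prod>b\<in>Basis. (e - a) \<bullet> b) = d ^ DIM('a)"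
    using eb by (simp add: inner_diff_left)
  finally have "ennreal (d ^ DIM('a)) \<le> emeasure lborel Q"
    using emeasure_mono[OF sub m] by simp
  also have "\<dots> = ennreal (measure lborel Q)"
    using fin by (simp add: emeasure_eq_ennreal_measure)
  finally show "d ^ DIM('a) \<le> measure lborel Q"
    using \<open>0 < d\<close> by (subst (asm) ennreal_le_iff) auto
qed

text \<open>Expand the square and integrate first in y, then in x. The right side stays in
  \<open>ennreal\<close>, so that it can be enlarged later without integrability checks.\<close>

lemma variance_double_integral:
  fixes f :: "'a \<Rightarrow> real"
  assumes fm: "finite_measure N" and f: "integrable N f" "integrable N (\<lambda>x. (f x)\<^sup>2)"
  shows "ennreal (2 * (measure N (space N) * (\<integral>x. (f x)\<^sup>2 \<partial>N) - (\<integral>x. f x \<partial>N)\<^sup>2))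
    = (\<integral>\<^sup>+x. (\<integral>\<^sup>+y. ennreal ((f y - f x)\<^sup>2) \<partial>N) \<partial>N)"
proof -
  interpret finite_measure N by fact
  let ?m = "measure N (space N)" and ?A = "\<integral>x. f x \<partial>N" and ?B = "\<integral>x. (f x)\<^sup>2 \<partial>N"
  have exp: "(f y - f x)\<^sup>2 = (f y)\<^sup>2 - 2 * f x * f y + (f x)\<^sup>2" for x y
    by (simp add: power2_eq_square algebra_simps)
  have i: "integrable N (\<lambda>y. (f y - f x)\<^sup>2)" for x
    unfolding exp using f by simp
  have in1: "(\<integral>y. (f y - f x)\<^sup>2 \<partial>N) = ?B - 2 * f x * ?A + ?m * (f x)\<^sup>2" for x
    unfolding exp using f by simp
  have nonneg: "0 \<le> ?B - 2 * f x * ?A + ?m * (f x)\<^sup>2" for x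
    unfolding in1[symmetric] by simp
  have "(\<integral>\<^sup>+x. (\<integral>\<^sup>+y. ennreal ((f y - f x)\<^sup>2) \<partial>N) \<partial>N)
      = (\<integral>\<^sup>+x. ennreal (?B - 2 * f x * ?A + ?m * (f x)\<^sup>2) \<partial>N)"
    using i by (simp add: nn_integral_eq_integral in1)
  also have "\<dots> = ennreal (\<integral>x. ?B - 2 * f x * ?A + ?m * (f x)\<^sup>2 \<partial>N)"
    using f nonneg by (intro nn_integral_eq_integral) auto
  also have "(\<integral>x. ?B - 2 * f x * ?A + ?m * (f x)\<^sup>2 \<partial>N) = 2 * (?m * ?B - ?A\<^sup>2)"
  proof -
    have "(\<integral>x. ?B - 2 * f x * ?A + ?m * (f x)\<^sup>2 \<partial>N) = ?B * ?m - 2 * ?A * ?A + ?m * ?B"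
      using f by simp
    then show ?thesis by (simp add: power2_eq_square algebra_simps)
  qed
  finally show ?thesis by simp
qed

text \<open>The variance of \<open>f\<close> on a cube is a double integral of \<open>(f y - f x)\<^sup>2\<close>, and two points of a cube
  differ by a vector in \<open>[-d, d]\<^sup>n\<close>; so the variances on all cubes together are controlled by
  translation estimates.\<close>

lemma ehrling_inequality:
  fixes f :: "'a::euclidean_space \<Rightarrow> real" and d :: real
  assumes deriv: "\<And>x. (f has_derivative (\<lambda>v. v \<bullet> g x)) (at x)"
    and cont: "continuous_on UNIV g"
    and K: "compact K" "\<And>x. x \<notin> K \<Longrightarrow> f x = 0" "\<And>x. x \<notin> K \<Longrightarrow> g x = 0"
    and S: "bounded S" "K \<subseteq> S" and d: "0 < d"
  shows "d ^ DIM('a) * (\<integral>x. (f x)\<^sup>2 \<partial>lborel)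
    \<le> (\<Sum>v\<in>cube_label d ` S. (\<integral>x. indicator {x. cube_label d x = v} x * f x \<partial>lborel)\<^sup>2)
      + (2 * d) ^ DIM('a) * (DIM('a) * d\<^sup>2) / 2 * (\<integral>x. (norm (g x))\<^sup>2 \<partial>lborel)"
proof -
  let ?n = "DIM('a)" and ?V = "cube_label d ` S"
  define Q where "Q v = {x :: 'a. cube_label d x = v}" for v
  define c :: 'a where "c = (\<Sum>b\<in>Basis. d *\<^sub>R b)"
  have cb: "c \<bullet> b = d" if "b \<in> Basis" for b
    using that by (simp add: c_def inner_sum_left inner_Basis if_distrib cong: if_cong)
  define H where "H = cbox (- c) c"
  \<comment> \<open>Squared increments over all shifts in the box \<open>H\<close>. For x in a given
    cube, \<open>I x\<close> dominates the inner integral of the variance on that cube, and it no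
    longer refers to the cube; integrated over x it falls under the translation estimate.\<close>
  define I where "I x = (\<integral>\<^sup>+y. ennreal ((f (x + y) - f x)\<^sup>2) * indicator H y \<partial>lborel)" for x
  have contf: "continuous_on UNIV f"
    using deriv by (auto simp: continuous_on_eq_continuous_at intro: has_derivative_continuous)
  then have mf[measurable]: "f \<in> borel_measurable borel"
    by (rule borel_measurable_continuous_onI)
  have mg[measurable]: "g \<in> borel_measurable borel"
    using cont by (rule borel_measurable_continuous_onI)
  have mH[measurable]: "H \<in> sets borel" by (simp add: H_def)
  have finV: "finite ?V" using S d by (intro finite_cube_label_image)
  have Q: "Q v \<in> sets lborel" "emeasure lborel (Q v) < \<infinity>" "d ^ ?n \<le> measure lborel (Q v)" if "v \<in> ?V" for v
    using that cube_measure[OF d] by (auto simp: Q_def)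
  have intf: "integrable lborel f" by (rule integrable_compact_support[OF contf K(1,2)])
  have intf2: "integrable lborel (\<lambda>x. (f x)\<^sup>2)"
    by (rule integrable_compact_support[OF _ K(1)]) (use contf K in \<open>auto intro: continuous_intros\<close>)
  have intg2: "integrable lborel (\<lambda>x. (norm (g x))\<^sup>2)"
    by (rule integrable_compact_support[OF _ K(1)]) (use cont K in \<open>auto intro: continuous_intros\<close>)
  have mI[measurable]: "I \<in> borel_measurable lborel"
    unfolding I_def by measurable
  have inner_le: "(\<integral>\<^sup>+y. ennreal ((f y - f x)\<^sup>2) * indicator (Q v) y \<partial>lborel) \<le> I x"
    if v: "v \<in> ?V" and x: "x \<in> Q v" for v x
  proof -
    have [measurable]: "Q v \<in> sets borel" using Q(1)[OF v] by simp
    have "(\<integral>\<^sup>+y. ennreal ((f y - f x)\<^sup>2) * indicator (Q v) y \<partial>lborel)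
      = (\<integral>\<^sup>+y. ennreal ((f (y + x) - f x)\<^sup>2) * indicator (Q v) (y + x) \<partial>lborel)"
      by (rule nn_integral_lborel_translate[symmetric]) measurable
    also have "\<dots> \<le> I x"
      unfolding I_def
    proof (rule nn_integral_mono)
      fix y
      have "y \<in> H" if "y + x \<in> Q v"
      proof -
        have "cube_label d (y + x) = cube_label d x" using that x by (simp add: Q_def)
        from cube_label_eqD[OF this _ d] have "\<bar>y \<bullet> b\<bar> \<le> d" if "b \<in> Basis" for b using that by simp
        then show ?thesis by (force simp: H_def mem_box cb abs_le_iff)
      qed
      then show "ennreal ((f (y + x) - f x)\<^sup>2) * indicator (Q v) (y + x)
          \<le> ennreal ((f (x + y) - f x)\<^sup>2) * indicator H y"
        by (auto simp: indicator_def add.commute)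
    qed
    finally show ?thesis .
  qed
  \<comment> \<open>Twice the unnormalised variance of \<open>f\<close> on the cube, in the form
    produced by \<open>variance_double_integral\<close>.\<close>
  define D where "D v = 2 * (measure lborel (Q v) * (\<integral>x. indicator (Q v) x * (f x)\<^sup>2 \<partial>lborel)
      - (\<integral>x. indicator (Q v) x * f x \<partial>lborel)\<^sup>2)" for v
  have D_le: "ennreal (D v) \<le> (\<integral>\<^sup>+x. I x * indicator (Q v) x \<partial>lborel)" if v: "v \<in> ?V" for v
  proof -
    let ?N = "restrict_space lborel (Q v)"
    have Qs: "Q v \<inter> space lborel \<in> sets lborel" using Q(1)[OF v] by simp
    have fm: "finite_measure ?N"
      using Q[OF v] by (intro finite_measureI) (simp add: emeasure_restrict_space space_restrict_space)
    have "integrable ?N f" "integrable ?N (\<lambda>x. (f x)\<^sup>2)"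
      using intf intf2 Q(1)[OF v]
      by (simp_all add: integrable_restrict_space[OF Qs] integrable_mult_indicator del: real_scaleR_def)
    from variance_double_integral[OF fm this]
    have "ennreal (D v) = (\<integral>\<^sup>+x. (\<integral>\<^sup>+y. ennreal ((f y - f x)\<^sup>2) \<partial>?N) \<partial>?N)"
      using Q(1)[OF v]
      by (simp add: D_def integral_restrict_space[OF Qs] measure_restrict_space space_restrict_space)
    also have "\<dots> = (\<integral>\<^sup>+x. (\<integral>\<^sup>+y. ennreal ((f y - f x)\<^sup>2) * indicator (Q v) y \<partial>lborel) * indicator (Q v) x \<partial>lborel)"
      by (simp add: nn_integral_restrict_space[OF Qs])
    also have "\<dots> \<le> (\<integral>\<^sup>+x. I x * indicator (Q v) x \<partial>lborel)"
      by (rule nn_integral_mono) (use inner_le[OF v] in \<open>auto simp: indicator_def\<close>)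
    finally show ?thesis .
  qed
  \<comment> \<open>\<open>(2 * d) ^ ?n\<close> is the volume of \<open>H\<close>, and
    \<open>?n * d\<^sup>2\<close> bounds the squared length of a shift in \<open>H\<close>.\<close>
  define R where "R = (2 * d) ^ ?n * (?n * d\<^sup>2) * (\<integral>x. (norm (g x))\<^sup>2 \<partial>lborel)"
  have R0: "0 \<le> R" using d by (simp add: R_def)
  have "(\<integral>\<^sup>+x. I x \<partial>lborel) \<le> ennreal R"
  proof -
    have "(\<integral>\<^sup>+x. I x \<partial>lborel) = (\<integral>\<^sup>+y. (\<integral>\<^sup>+x. ennreal ((f (x + y) - f x)\<^sup>2) * indicator H y \<partial>lborel) \<partial>lborel)"
      unfolding I_def by (rule lborel_pair.Fubini'[symmetric]) measurable
    also have "\<dots> = (\<integral>\<^sup>+y. (\<integral>\<^sup>+x. ennreal ((f (x + y) - f x)\<^sup>2) \<partial>lborel) * indicator H y \<partial>lborel)"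
      by (intro nn_integral_cong nn_integral_multc) measurable
    also have "\<dots> \<le> (\<integral>\<^sup>+y. ennreal (?n * d\<^sup>2 * (\<integral>x. (norm (g x))\<^sup>2 \<partial>lborel)) * indicator H y \<partial>lborel)"
    proof (rule nn_integral_mono)
      fix y
      show "(\<integral>\<^sup>+x. ennreal ((f (x + y) - f x)\<^sup>2) \<partial>lborel) * indicator H y
          \<le> ennreal (?n * d\<^sup>2 * (\<integral>x. (norm (g x))\<^sup>2 \<partial>lborel)) * indicator H y"
      proof (cases "y \<in> H")
        case True
        have "(norm y)\<^sup>2 = (\<Sum>b\<in>Basis. (y \<bullet> b)\<^sup>2)"
          by (subst power2_norm_eq_inner, subst euclidean_inner) (simp add: power2_eq_square)
        also have "\<dots> \<le> (\<Sum>b\<in>(Basis::'a set). d\<^sup>2)"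
        proof (rule sum_mono)
          fix b :: 'a assume "b \<in> Basis"
          then have "\<bar>y \<bullet> b\<bar> \<le> d" using True cb by (auto simp: H_def mem_box abs_le_iff)
          then show "(y \<bullet> b)\<^sup>2 \<le> d\<^sup>2" using d by (simp add: abs_le_square_iff[symmetric])
        qed
        finally have ny: "(norm y)\<^sup>2 \<le> ?n * d\<^sup>2" by simp
        have "(\<integral>\<^sup>+x. ennreal ((f (x + y) - f x)\<^sup>2) \<partial>lborel) \<le> (\<integral>\<^sup>+x. ennreal ((y \<bullet> g x)\<^sup>2) \<partial>lborel)"
          by (rule translation_estimate[OF deriv cont])
        also have "\<dots> \<le> (\<integral>\<^sup>+x. ennreal (?n * d\<^sup>2 * (norm (g x))\<^sup>2) \<partial>lborel)"
        proof (intro nn_integral_mono ennreal_leI)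
          fix x
          have "(y \<bullet> g x)\<^sup>2 \<le> (norm y * norm (g x))\<^sup>2"
            using Cauchy_Schwarz_ineq2[of y "g x"] by (simp add: abs_le_square_iff[symmetric] abs_mult)
          also have "\<dots> \<le> ?n * d\<^sup>2 * (norm (g x))\<^sup>2"
            unfolding power_mult_distrib by (intro mult_right_mono ny) simp
          finally show "(y \<bullet> g x)\<^sup>2 \<le> ?n * d\<^sup>2 * (norm (g x))\<^sup>2" .
        qed
        also have "\<dots> = ennreal (\<integral>x. ?n * d\<^sup>2 * (norm (g x))\<^sup>2 \<partial>lborel)"
          using intg2 by (intro nn_integral_eq_integral) auto
        finally show ?thesis using True by simp
      qed simp
    qed
    also have "\<dots> = ennreal (?n * d\<^sup>2 * (\<integral>x. (norm (g x))\<^sup>2 \<partial>lborel)) * emeasure lborel H"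
      by (rule nn_integral_cmult_indicator) simp
    also have "emeasure lborel H = ennreal ((2 * d) ^ ?n)"
    proof -
      have "emeasure lborel H = ennreal (\<Prod>b\<in>Basis. (c - (- c)) \<bullet> b)"
        unfolding H_def using cb d by (intro emeasure_lborel_cbox) auto
      also have "(\<Prod>b\<in>Basis. (c - (- c)) \<bullet> b) = (2 * d) ^ ?n"
        using cb by (simp add: inner_add_left)
      finally show ?thesis .
    qed
    also have "ennreal (?n * d\<^sup>2 * (\<integral>x. (norm (g x))\<^sup>2 \<partial>lborel)) * ennreal ((2 * d) ^ ?n) = ennreal R"
      using d by (simp add: R_def ennreal_mult'[symmetric] mult_ac)
    finally show ?thesis .
  qed
  moreover have "(\<Sum>v\<in>?V. ennreal (D v)) \<le> (\<integral>\<^sup>+x. I x \<partial>lborel)"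
  proof -
    have "(\<Sum>v\<in>?V. ennreal (D v)) \<le> (\<Sum>v\<in>?V. \<integral>\<^sup>+x. I x * indicator (Q v) x \<partial>lborel)"
      by (intro sum_mono D_le)
    also have "\<dots> = (\<integral>\<^sup>+x. (\<Sum>v\<in>?V. I x * indicator (Q v) x) \<partial>lborel)"
      using Q(1) by (intro nn_integral_sum[symmetric]) auto
    also have "\<dots> \<le> (\<integral>\<^sup>+x. I x \<partial>lborel)"
    proof (rule nn_integral_mono)
      fix x
      have "(\<Sum>v\<in>?V. I x * indicator (Q v) x) = (\<Sum>v\<in>?V. if v = cube_label d x then I x else 0)"
        by (intro sum.cong) (auto simp: Q_def indicator_def)
      also have "\<dots> \<le> I x" using finV by (simp add: sum.delta)
      finally show "(\<Sum>v\<in>?V. I x * indicator (Q v) x) \<le> I x" .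
    qed
    finally show ?thesis .
  qed
  \<comment> \<open>\<open>ennreal\<close> truncates negative numbers to 0 and the sign of
    \<open>D v\<close> has not been recorded; hence the detour through
    \<open>max 0 (D v)\<close>.\<close>
  moreover have "(\<Sum>v\<in>?V. ennreal (D v)) = ennreal (\<Sum>v\<in>?V. max 0 (D v))"
  proof -
    have "(\<Sum>v\<in>?V. ennreal (D v)) = (\<Sum>v\<in>?V. ennreal (max 0 (D v)))"
      by (intro sum.cong) (auto simp: max_def ennreal_neg)
    also have "\<dots> = ennreal (\<Sum>v\<in>?V. max 0 (D v))"
      by (rule sum_ennreal) simp
    finally show ?thesis .
  qed
  ultimately have "ennreal (\<Sum>v\<in>?V. max 0 (D v)) \<le> ennreal R" by simp
  then have "(\<Sum>v\<in>?V. max 0 (D v)) \<le> R" using R0 by (simp add: ennreal_le_iff)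
  moreover have "(\<Sum>v\<in>?V. D v) \<le> (\<Sum>v\<in>?V. max 0 (D v))" by (intro sum_mono) simp
  ultimately have sumD: "(\<Sum>v\<in>?V. D v) \<le> R" by linarith
  have intQ: "integrable lborel (\<lambda>x. indicator (Q v) x * (f x)\<^sup>2)" if "v \<in> ?V" for v
    using integrable_mult_indicator[OF Q(1)[OF that] intf2] by simp
  have "(\<integral>x. (f x)\<^sup>2 \<partial>lborel) = (\<integral>x. (\<Sum>v\<in>?V. indicator (Q v) x * (f x)\<^sup>2) \<partial>lborel)"
  proof (intro Bochner_Integration.integral_cong refl)
    fix x
    show "(f x)\<^sup>2 = (\<Sum>v\<in>?V. indicator (Q v) x * (f x)\<^sup>2)"
    proof (cases "x \<in> S")
      case True
      have "(\<Sum>v\<in>?V. indicator (Q v) x * (f x)\<^sup>2) = (\<Sum>v\<in>?V. if v = cube_label d x then (f x)\<^sup>2 else 0)"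
        by (intro sum.cong) (auto simp: Q_def indicator_def)
      then show ?thesis using finV True by (simp add: sum.delta)
    next
      case False
      then have "f x = 0" using K(2)[of x] S(2) by blast
      then show ?thesis by simp
    qed
  qed
  also have "\<dots> = (\<Sum>v\<in>?V. \<integral>x. indicator (Q v) x * (f x)\<^sup>2 \<partial>lborel)"
    by (rule Bochner_Integration.integral_sum) (rule intQ)
  finally have "d ^ ?n * (\<integral>x. (f x)\<^sup>2 \<partial>lborel) = (\<Sum>v\<in>?V. d ^ ?n * (\<integral>x. indicator (Q v) x * (f x)\<^sup>2 \<partial>lborel))"
    by (simp add: sum_distrib_left)
  also have "\<dots> \<le> (\<Sum>v\<in>?V. (\<integral>x. indicator (Q v) x * f x \<partial>lborel)\<^sup>2 + D v / 2)"
  proof (rule sum_mono)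
    fix v assume v: "v \<in> ?V"
    have "d ^ ?n * (\<integral>x. indicator (Q v) x * (f x)\<^sup>2 \<partial>lborel)
        \<le> measure lborel (Q v) * (\<integral>x. indicator (Q v) x * (f x)\<^sup>2 \<partial>lborel)"
      by (intro mult_right_mono Q(3)[OF v] Bochner_Integration.integral_nonneg) auto
    then show "d ^ ?n * (\<integral>x. indicator (Q v) x * (f x)\<^sup>2 \<partial>lborel)
        \<le> (\<integral>x. indicator (Q v) x * f x \<partial>lborel)\<^sup>2 + D v / 2"
      by (simp add: D_def field_simps)
  qed
  also have "\<dots> = (\<Sum>v\<in>?V. (\<integral>x. indicator (Q v) x * f x \<partial>lborel)\<^sup>2) + (\<Sum>v\<in>?V. D v) / 2"
    by (simp add: sum.distrib sum_divide_distrib)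
  also have "\<dots> \<le> (\<Sum>v\<in>?V. (\<integral>x. indicator (Q v) x * f x \<partial>lborel)\<^sup>2) + R / 2"
    using sumD by simp
  finally show ?thesis by (simp add: Q_def R_def)
qed

text \<open>Cubes of side 1/(m+1) meeting the domain are countable in total, and the integrals of
  the functions over them are bounded, so a diagonal subsequence makes all these integrals converge.
  For a given accuracy, one fixed m makes the gradient term of \<open>ehrling_inequality\<close>
  small; what remains involves finitely many convergent sequences.\<close>

lemma rellich:
  fixes \<phi> :: "nat \<Rightarrow> 'a::euclidean_space \<Rightarrow> real"
  assumes bdd: "bounded \<Omega>" and test: "\<And>k. test_function \<Omega> (\<phi> k)"
    and C: "\<And>k. (\<integral>x. (\<phi> k x)\<^sup>2 \<partial>lborel) \<le> C" "\<And>k. (\<integral>x. (norm (grad (\<phi> k) x))\<^sup>2 \<partial>lborel) \<le> C"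
  obtains r :: "nat \<Rightarrow> nat" where "strict_mono r"
    "\<And>e. 0 < e \<Longrightarrow> \<exists>N. \<forall>i\<ge>N. \<forall>j\<ge>N. (\<integral>x. (\<phi> (r i) x - \<phi> (r j) x)\<^sup>2 \<partial>lborel) < e"
proof -
  let ?n = "DIM('a)"
  define \<delta> where "\<delta> m = inverse (real (Suc m))" for m
  have \<delta>: "0 < \<delta> m" for m by (simp add: \<delta>_def)
  define ell where "ell k = (\<lambda>(m, v). \<integral>x. indicator {x. cube_label (\<delta> m) x = v} x * \<phi> k x \<partial>lborel)" for k
  define I where "I = (SIGMA m:UNIV. cube_label (\<delta> m) ` \<Omega>)"
  obtain B where B: "\<Omega> \<subseteq> cbox (- B) B" using bdd bounded_subset_cbox_symmetric by blast
  have cont: "continuous_on UNIV (\<phi> k)" "continuous_on UNIV (grad (\<phi> k))" for k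
    using test test_function_continuous test_function_grad_continuous by blast+
  have supp: "compact (closure {x. \<phi> k x \<noteq> 0})" for k using test by (simp add: test_function_def)
  have z: "\<phi> k x = 0" "grad (\<phi> k) x = 0" if "x \<notin> closure {x. \<phi> k x \<noteq> 0}" for k x
    using that closure_subset[of "{x. \<phi> k x \<noteq> 0}"] grad_outside_support[OF that] by auto
  have int1: "integrable lborel (\<phi> k)" for k
    by (rule integrable_compact_support[OF cont(1)[of k] supp[of k]]) (rule z(1))
  have int2: "integrable lborel (\<lambda>x. (\<phi> k x)\<^sup>2)" for k
    by (rule integrable_compact_support[OF continuous_on_power[OF cont(1)[of k]] supp[of k]]) (drule z(1), simp)
  have int3: "integrable lborel (\<lambda>x. (norm (grad (\<phi> k) x))\<^sup>2)" for k
    by (rule integrable_compact_support[OF continuous_on_power[OF continuous_on_norm[OF cont(2)[of k]]] supp[of k]]) (drule z(2), simp)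
  have cube: "{x :: 'a. cube_label (\<delta> m) x = v} \<in> sets lborel" for m v
  proof -
    have "{x \<in> space borel. cube_label (\<delta> m) x = v} \<in> sets borel" by measurable
    then show ?thesis by simp
  qed
  have intc: "integrable lborel (\<lambda>x. indicator {x. cube_label (\<delta> m) x = v} x * \<phi> k x)" for m v k
    using integrable_mult_indicator[OF cube int1] by simp
  have indB: "integrable lborel (indicator (cbox (- B) B) :: 'a \<Rightarrow> real)"
    by (rule integrable_real_indicator) (simp, rule emeasure_lborel_cbox_finite)
  \<comment> \<open>The bound is uniform in the cube: |phi| is at most phi^2 + 1, and phi vanishes
    off the box.\<close>
  have "norm (ell k p) \<le> C + measure lborel (cbox (- B) B)" for k p
  proof -
    obtain m v where p: "p = (m, v)" by (cases p)
    have "norm (ell k p) \<le> (\<integral>x. norm (indicator {x. cube_label (\<delta> m) x = v} x * \<phi> k x) \<partial>lborel)"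
      unfolding p ell_def prod.case by (rule integral_norm_bound)
    also have "\<dots> \<le> (\<integral>x. (\<phi> k x)\<^sup>2 + indicator (cbox (- B) B) x \<partial>lborel)"
    proof (rule integral_mono)
      show "integrable lborel (\<lambda>x. (\<phi> k x)\<^sup>2 + indicator (cbox (- B) B) x)"
        using int2 indB by (intro Bochner_Integration.integrable_add)
      fix x
      have "\<bar>\<phi> k x\<bar> \<le> (\<phi> k x)\<^sup>2 + indicator (cbox (- B) B) x"
      proof (cases "x \<in> cbox (- B) B")
        case True
        have "0 \<le> (\<bar>\<phi> k x\<bar> - 1)\<^sup>2" by simp
        then have "2 * \<bar>\<phi> k x\<bar> \<le> (\<phi> k x)\<^sup>2 + 1" by (simp add: power2_eq_square algebra_simps)
        moreover have "0 \<le> (\<phi> k x)\<^sup>2" by simp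
        ultimately have "\<bar>\<phi> k x\<bar> \<le> (\<phi> k x)\<^sup>2 + 1" by linarith
        then show ?thesis using True by simp
      next
        case False
        then have "\<phi> k x = 0" using B test_function_outside[OF test] by blast
        then show ?thesis by simp
      qed
      then show "norm (indicator {x. cube_label (\<delta> m) x = v} x * \<phi> k x)
          \<le> (\<phi> k x)\<^sup>2 + indicator (cbox (- B) B) x"
        by (auto simp: indicator_def split: if_splits)
    qed (simp add: intc)
    also have "\<dots> = (\<integral>x. (\<phi> k x)\<^sup>2 \<partial>lborel) + measure lborel (cbox (- B) B)"
      using int2 indB by (subst Bochner_Integration.integral_add) auto
    finally show ?thesis using C(1)[of k] by linarith
  qed
  moreover have "countable I"
    unfolding I_def using finite_cube_label_image[OF bdd \<delta>]
    by (intro countable_SIGMA) (auto intro: countable_finite)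
  ultimately obtain r where r: "strict_mono (r :: nat \<Rightarrow> nat)"
    and conv: "\<And>p. p \<in> I \<Longrightarrow> \<exists>l. (\<lambda>k. ell (r k) p) \<longlonglongrightarrow> l"
    using function_convergent_subsequence[of I ell] by blast
  have "\<exists>N. \<forall>i\<ge>N. \<forall>j\<ge>N. (\<integral>x. (\<phi> (r i) x - \<phi> (r j) x)\<^sup>2 \<partial>lborel) < e" if "0 < e" for e
  proof -
    \<comment> \<open>The gradient term of \<open>ehrling_inequality\<close> divided by
      \<open>(\<delta> m) ^ ?n\<close>, with 4C as bound for the gradient of a difference of two
      members.\<close>
    have "(\<lambda>m. 2 ^ ?n * ?n * (2 * C) * (\<delta> m)\<^sup>2) \<longlonglongrightarrow> 2 ^ ?n * ?n * (2 * C) * 0\<^sup>2"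
      unfolding \<delta>_def by (intro tendsto_mult tendsto_const tendsto_power LIMSEQ_inverse_real_of_nat)
    then have "\<forall>\<^sub>F m in sequentially. 2 ^ ?n * ?n * (2 * C) * (\<delta> m)\<^sup>2 < e / 2"
      using that by (intro order_tendstoD(2)) auto
    then obtain m where m: "2 ^ ?n * ?n * (2 * C) * (\<delta> m)\<^sup>2 < e / 2"
      by (auto simp: eventually_sequentially)
    let ?V = "cube_label (\<delta> m) ` \<Omega>"
    \<comment> \<open>A limit along the product filter yields one threshold \<open>N\<close> for
      both indices and for all cubes of the finite set \<open>?V\<close>.\<close>
    have "((\<lambda>p. \<Sum>v\<in>?V. (ell (r (fst p)) (m, v) - ell (r (snd p)) (m, v))\<^sup>2) \<longlongrightarrow> (\<Sum>v\<in>?V. 0))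
        (sequentially \<times>\<^sub>F sequentially)"
    proof (rule tendsto_sum)
      fix v assume "v \<in> ?V"
      then have "(m, v) \<in> I" by (simp add: I_def)
      then obtain l where l: "(\<lambda>k. ell (r k) (m, v)) \<longlonglongrightarrow> l" using conv by blast
      show "((\<lambda>p. (ell (r (fst p)) (m, v) - ell (r (snd p)) (m, v))\<^sup>2) \<longlongrightarrow> 0)
          (sequentially \<times>\<^sub>F sequentially)"
        using tendsto_power[OF tendsto_diff[OF filterlim_compose[OF l filterlim_fst]
              filterlim_compose[OF l filterlim_snd]], of 2] by simp
    qed
    then have "\<forall>\<^sub>F p in sequentially \<times>\<^sub>F sequentially.
        (\<Sum>v\<in>?V. (ell (r (fst p)) (m, v) - ell (r (snd p)) (m, v))\<^sup>2) < (\<delta> m) ^ ?n * (e / 2)"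
      using that \<delta>[of m] by (intro order_tendstoD(2)) auto
    then obtain N where N: "\<And>i j. i \<ge> N \<Longrightarrow> j \<ge> N \<Longrightarrow>
        (\<Sum>v\<in>?V. (ell (r i) (m, v) - ell (r j) (m, v))\<^sup>2) < (\<delta> m) ^ ?n * (e / 2)"
      by (force simp: eventually_prod_sequentially)
    show ?thesis
    proof (intro exI allI impI)
      fix i j assume ij: "N \<le> i" "N \<le> j"
      let ?\<psi> = "\<lambda>x. \<phi> (r i) x - \<phi> (r j) x"
      have t: "test_function \<Omega> ?\<psi>" by (intro test_function_diff test)
      have gd: "grad ?\<psi> x = grad (\<phi> (r i)) x - grad (\<phi> (r j)) x" for x
        by (intro grad_diff test_function_differentiable[OF test])
      have grad_le: "(\<integral>x. (norm (grad ?\<psi> x))\<^sup>2 \<partial>lborel) \<le> 4 * C"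
      proof -
        have "(\<integral>x. (norm (grad ?\<psi> x))\<^sup>2 \<partial>lborel)
            \<le> (\<integral>x. 2 * (norm (grad (\<phi> (r i)) x))\<^sup>2 + 2 * (norm (grad (\<phi> (r j)) x))\<^sup>2 \<partial>lborel)"
        proof (rule integral_mono')
          show "integrable lborel (\<lambda>x. 2 * (norm (grad (\<phi> (r i)) x))\<^sup>2 + 2 * (norm (grad (\<phi> (r j)) x))\<^sup>2)"
            using int3 by auto
          show "(norm (grad ?\<psi> x))\<^sup>2 \<le> 2 * (norm (grad (\<phi> (r i)) x))\<^sup>2 + 2 * (norm (grad (\<phi> (r j)) x))\<^sup>2" for x
          proof -
            let ?a = "norm (grad (\<phi> (r i)) x)" and ?b = "norm (grad (\<phi> (r j)) x)"
            have "(norm (grad ?\<psi> x))\<^sup>2 \<le> (?a + ?b)\<^sup>2"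
              unfolding gd by (intro power_mono norm_triangle_ineq4) auto
            moreover have "0 \<le> (?a - ?b)\<^sup>2" by simp
            ultimately show ?thesis by (simp add: power2_eq_square algebra_simps)
          qed
        qed auto
        also have "\<dots> = 2 * (\<integral>x. (norm (grad (\<phi> (r i)) x))\<^sup>2 \<partial>lborel) + 2 * (\<integral>x. (norm (grad (\<phi> (r j)) x))\<^sup>2 \<partial>lborel)"
          using int3 by simp
        also have "\<dots> \<le> 4 * C" using C(2)[of "r i"] C(2)[of "r j"] by linarith
        finally show ?thesis .
      qed
      have lin: "(\<integral>x. indicator {x. cube_label (\<delta> m) x = v} x * ?\<psi> x \<partial>lborel)
          = ell (r i) (m, v) - ell (r j) (m, v)" for v
        unfolding ell_def prod.case right_diff_distrib using intc
        by (intro Bochner_Integration.integral_diff) auto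
      have "(\<delta> m) ^ ?n * (\<integral>x. (?\<psi> x)\<^sup>2 \<partial>lborel)
          \<le> (\<Sum>v\<in>?V. (\<integral>x. indicator {x. cube_label (\<delta> m) x = v} x * ?\<psi> x \<partial>lborel)\<^sup>2)
            + (2 * \<delta> m) ^ ?n * (?n * (\<delta> m)\<^sup>2) / 2 * (\<integral>x. (norm (grad ?\<psi> x))\<^sup>2 \<partial>lborel)"
      proof (rule ehrling_inequality[where K="closure {x. ?\<psi> x \<noteq> 0}"])
        show "compact (closure {x. ?\<psi> x \<noteq> 0})" "closure {x. ?\<psi> x \<noteq> 0} \<subseteq> \<Omega>"
          using t by (simp_all add: test_function_def)
        show "?\<psi> x = 0" if "x \<notin> closure {x. ?\<psi> x \<noteq> 0}" for x
          using that closure_subset[of "{x. ?\<psi> x \<noteq> 0}"] by auto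
        show "grad ?\<psi> x = 0" if "x \<notin> closure {x. ?\<psi> x \<noteq> 0}" for x
          using that by (rule grad_outside_support)
        show "(?\<psi> has_derivative (\<lambda>v. v \<bullet> grad ?\<psi> x)) (at x)" for x
          by (rule test_function_has_derivative[OF t])
        show "continuous_on UNIV (grad ?\<psi>)" by (rule test_function_grad_continuous[OF t])
      qed (fact bdd \<delta>)+
      also have "\<dots> \<le> (\<Sum>v\<in>?V. (ell (r i) (m, v) - ell (r j) (m, v))\<^sup>2)
            + (2 * \<delta> m) ^ ?n * (?n * (\<delta> m)\<^sup>2) / 2 * (4 * C)"
        unfolding lin using \<delta>[of m] by (intro add_left_mono mult_left_mono grad_le) auto
      also have "(2 * \<delta> m) ^ ?n * (?n * (\<delta> m)\<^sup>2) / 2 * (4 * C) = (\<delta> m) ^ ?n * (2 ^ ?n * ?n * (2 * C) * (\<delta> m)\<^sup>2)"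
        by (simp add: power_mult_distrib)
      also have "(\<Sum>v\<in>?V. (ell (r i) (m, v) - ell (r j) (m, v))\<^sup>2) + (\<delta> m) ^ ?n * (2 ^ ?n * ?n * (2 * C) * (\<delta> m)\<^sup>2)
          < (\<delta> m) ^ ?n * (e / 2) + (\<delta> m) ^ ?n * (e / 2)"
        using \<delta>[of m] m by (intro add_strict_mono N ij mult_strict_left_mono) auto
      also have "\<dots> = (\<delta> m) ^ ?n * e" by (simp add: algebra_simps)
      finally show "(\<integral>x. (?\<psi> x)\<^sup>2 \<partial>lborel) < e"
        using \<delta>[of m] by simp
    qed
  qed
  with r show ?thesis using that by blast
qed

section \<open>H^1_0 as a closed space of function-gradient pairs\<close>

section \<open>Jets\<close>

text \<open>A jet \<open>F\<close> pairs a function \<open>fst \<circ> F\<close> with a candidate \<open>snd \<circ> F\<close> for its weak gradient, so that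
  the \<open>H\<^sup>1\<close> norm of a function is the \<open>L\<^sup>2\<close> norm of its jet.\<close>

definition jet :: "('a::euclidean_space \<Rightarrow> real) \<Rightarrow> 'a \<Rightarrow> real \<times> 'a" where
  "jet f x = (f x, grad f x)"

definition l2_value :: "'a measure \<Rightarrow> ('a \<Rightarrow> real \<times> 'b::euclidean_space) \<Rightarrow> ('a \<Rightarrow> real \<times> 'b) \<Rightarrow> real" where
  "l2_value M F G = l2_inner M (\<lambda>x. fst (F x)) (\<lambda>x. fst (G x))"

text \<open>For the weighted measure this is the Dirichlet form of the negative drifted Laplacian;
  the Rayleigh quotient of \<open>F\<close> is
  \<open>l2_energy M F F / l2_value M F F\<close>.\<close>

definition l2_energy :: "'a measure \<Rightarrow> ('a \<Rightarrow> real \<times> 'b::euclidean_space) \<Rightarrow> ('a \<Rightarrow> real \<times> 'b) \<Rightarrow> real" where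
  "l2_energy M F G = l2_inner M (\<lambda>x. snd (F x)) (\<lambda>x. snd (G x))"

lemma l2_value_commute: "l2_value M F G = l2_value M G F"
  by (simp add: l2_value_def l2_inner_commute)

lemma l2_energy_commute: "l2_energy M F G = l2_energy M G F"
  by (simp add: l2_energy_def l2_inner_commute)

lemma l2_value_nonneg: "0 \<le> l2_value M F F"
  by (simp add: l2_value_def l2_inner_nonneg)

lemma l2_energy_nonneg: "0 \<le> l2_energy M F F"
  by (simp add: l2_energy_def l2_inner_nonneg)

text \<open>Two free coefficients make sums, differences and multiples instances of one rule; hence
  the explicit coefficients \<open>1\<close> and \<open>- 1\<close> in later terms.\<close>

lemma l2_value_comb_left:
  assumes "square_integrable M F" "square_integrable M G" "square_integrable M H"
  shows "l2_value M (\<lambda>x. a *\<^sub>R F x + b *\<^sub>R G x) H = a * l2_value M F H + b * l2_value M G H"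
proof -
  have "l2_value M (\<lambda>x. a *\<^sub>R F x + b *\<^sub>R G x) H
      = l2_inner M (\<lambda>x. a *\<^sub>R fst (F x)) (\<lambda>x. fst (H x)) + l2_inner M (\<lambda>x. b *\<^sub>R fst (G x)) (\<lambda>x. fst (H x))"
    unfolding l2_value_def fst_add fst_scaleR
    by (intro l2_inner_add_left square_integrable_scaleR square_integrable_fst assms)
  then show ?thesis by (simp only: l2_inner_scaleR_left l2_value_def)
qed

lemma l2_energy_comb_left:
  assumes "square_integrable M F" "square_integrable M G" "square_integrable M H"
  shows "l2_energy M (\<lambda>x. a *\<^sub>R F x + b *\<^sub>R G x) H = a * l2_energy M F H + b * l2_energy M G H"
proof -
  have "l2_energy M (\<lambda>x. a *\<^sub>R F x + b *\<^sub>R G x) H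
      = l2_inner M (\<lambda>x. a *\<^sub>R snd (F x)) (\<lambda>x. snd (H x)) + l2_inner M (\<lambda>x. b *\<^sub>R snd (G x)) (\<lambda>x. snd (H x))"
    unfolding l2_energy_def snd_add snd_scaleR
    by (intro l2_inner_add_left square_integrable_scaleR square_integrable_snd assms)
  then show ?thesis by (simp only: l2_inner_scaleR_left l2_energy_def)
qed

lemma square_integrable_comb:
  assumes "square_integrable M F" "square_integrable M G"
  shows "square_integrable M (\<lambda>x. a *\<^sub>R F x + b *\<^sub>R G x)"
  by (intro square_integrable_add square_integrable_scaleR assms)

lemma l2_value_comb:
  assumes "square_integrable M F" "square_integrable M G"
  shows "l2_value M (\<lambda>x. a *\<^sub>R F x + b *\<^sub>R G x) (\<lambda>x. a *\<^sub>R F x + b *\<^sub>R G x)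
    = a\<^sup>2 * l2_value M F F + 2 * a * b * l2_value M F G + b\<^sup>2 * l2_value M G G"
proof -
  let ?H = "\<lambda>x. a *\<^sub>R F x + b *\<^sub>R G x"
  have "l2_value M ?H ?H = a * l2_value M F ?H + b * l2_value M G ?H"
    by (intro l2_value_comb_left assms square_integrable_comb)
  also have "l2_value M F ?H = a * l2_value M F F + b * l2_value M G F"
    by (subst l2_value_commute) (intro l2_value_comb_left assms)
  also have "l2_value M G ?H = a * l2_value M F G + b * l2_value M G G"
    by (subst l2_value_commute) (intro l2_value_comb_left assms)
  finally show ?thesis
    by (simp add: l2_value_commute[of M G F] power2_eq_square algebra_simps)
qed

lemma l2_energy_comb:
  assumes "square_integrable M F" "square_integrable M G"
  shows "l2_energy M (\<lambda>x. a *\<^sub>R F x + b *\<^sub>R G x) (\<lambda>x. a *\<^sub>R F x + b *\<^sub>R G x)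
    = a\<^sup>2 * l2_energy M F F + 2 * a * b * l2_energy M F G + b\<^sup>2 * l2_energy M G G"
proof -
  let ?H = "\<lambda>x. a *\<^sub>R F x + b *\<^sub>R G x"
  have "l2_energy M ?H ?H = a * l2_energy M F ?H + b * l2_energy M G ?H"
    by (intro l2_energy_comb_left assms square_integrable_comb)
  also have "l2_energy M F ?H = a * l2_energy M F F + b * l2_energy M G F"
    by (subst l2_energy_commute) (intro l2_energy_comb_left assms)
  also have "l2_energy M G ?H = a * l2_energy M F G + b * l2_energy M G G"
    by (subst l2_energy_commute) (intro l2_energy_comb_left assms)
  finally show ?thesis
    by (simp add: l2_energy_commute[of M G F] power2_eq_square algebra_simps)
qed

lemma l2_inner_jets:
  assumes "square_integrable M F" "square_integrable M G"
  shows "l2_inner M F G = l2_value M F G + l2_energy M F G"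
proof -
  have "l2_inner M F G = (\<integral>x. fst (F x) \<bullet> fst (G x) + snd (F x) \<bullet> snd (G x) \<partial>M)"
    by (simp add: l2_inner_def inner_prod_def)
  then show ?thesis
    using assms unfolding l2_value_def l2_energy_def l2_inner_def
    by (simp only:) (intro Bochner_Integration.integral_add integrable_inner_square_integrable
        square_integrable_fst square_integrable_snd)
qed

lemma l2_tendsto_fst:
  assumes "l2_tendsto M F f" "\<And>k. square_integrable M (F k)" "square_integrable M f"
  shows "l2_tendsto M (\<lambda>k x. fst (F k x)) (\<lambda>x. fst (f x))"
proof (rule l2_tendsto_dominated[OF assms, of _ _ 1])
  show "norm (fst (F k x) - fst (f x)) \<le> 1 * norm (F k x - f x)" for k x
    by (metis fst_diff mult_1 norm_fst_le prod.collapse)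
qed (use assms in \<open>auto intro: square_integrable_fst square_integrable_measurable\<close>)

lemma l2_tendsto_snd:
  assumes "l2_tendsto M F f" "\<And>k. square_integrable M (F k)" "square_integrable M f"
  shows "l2_tendsto M (\<lambda>k x. snd (F k x)) (\<lambda>x. snd (f x))"
proof (rule l2_tendsto_dominated[OF assms, of _ _ 1])
  show "norm (snd (F k x) - snd (f x)) \<le> 1 * norm (F k x - f x)" for k x
    by (metis snd_diff mult_1 norm_snd_le prod.collapse)
qed (use assms in \<open>auto intro: square_integrable_snd square_integrable_measurable\<close>)

lemma l2_value_tendsto:
  assumes "l2_tendsto M F f" "l2_tendsto M G g"
    and "\<And>k. square_integrable M (F k)" "square_integrable M f"
    and "\<And>k. square_integrable M (G k)" "square_integrable M g"
  shows "(\<lambda>k. l2_value M (F k) (G k)) \<longlonglongrightarrow> l2_value M f g"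
  unfolding l2_value_def
  by (intro l2_tendsto_inner l2_tendsto_fst square_integrable_fst assms)

lemma l2_energy_tendsto:
  assumes "l2_tendsto M F f" "l2_tendsto M G g"
    and "\<And>k. square_integrable M (F k)" "square_integrable M f"
    and "\<And>k. square_integrable M (G k)" "square_integrable M g"
  shows "(\<lambda>k. l2_energy M (F k) (G k)) \<longlonglongrightarrow> l2_energy M f g"
  unfolding l2_energy_def
  by (intro l2_tendsto_inner l2_tendsto_snd square_integrable_snd assms)

text \<open>The drift enters through a continuous gradient \<open>d\<eta>\<close> only. The Gaussian
  form is imposed at the very end, where the integral of the squared trial field is
  computed.\<close>

locale drifted_domain =
  fixes \<eta> :: "'a::euclidean_space \<Rightarrow> real" and d\<eta> :: "'a \<Rightarrow> 'a" and \<Omega> :: "'a set"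
  assumes \<eta>_deriv: "(\<eta> has_derivative (\<lambda>v. v \<bullet> d\<eta> x)) (at x)"
    and d\<eta>_cont: "continuous_on UNIV d\<eta>"
    and open_\<Omega>: "open \<Omega>" and bounded_\<Omega>: "bounded \<Omega>"
begin

abbreviation M :: "'a measure" where "M \<equiv> drift_measure \<eta> \<Omega>"

lemma \<eta>_cont: "continuous_on UNIV \<eta>"
  using \<eta>_deriv by (auto simp: continuous_on_eq_continuous_at intro: has_derivative_continuous)

lemma \<eta>_measurable[measurable]: "\<eta> \<in> borel_measurable borel"
  by (rule borel_measurable_continuous_onI[OF \<eta>_cont])

lemma sets_\<Omega>: "\<Omega> \<in> sets borel"
  using open_\<Omega> by simp

lemma space_M: "space M = \<Omega>"
  by (simp add: drift_measure_def space_restrict_space)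

lemma sets_M: "sets M = sets (lebesgue_on \<Omega>)"
  by (simp add: drift_measure_def)

lemma borel_measurable_M: "f \<in> borel_measurable borel \<Longrightarrow> f \<in> borel_measurable M"
  unfolding measurable_cong_sets[OF sets_M refl]
  by (intro measurable_restrict_space1 measurable_completion) simp

text \<open>\<open>\<eta>\<close> is continuous on the compact closure of the domain. The bounds
  make weighted and unweighted norms comparable, so compactness for Lebesgue measure transfers to
  the drift measure.\<close>

lemma weight_bounds:
  obtains a b where "0 < a" "0 < b" "\<And>x. x \<in> \<Omega> \<Longrightarrow> a \<le> exp (- \<eta> x)" "\<And>x. x \<in> \<Omega> \<Longrightarrow> exp (- \<eta> x) \<le> b"
proof -
  have "compact (closure \<Omega>)" using bounded_\<Omega> by (simp add: compact_closure)
  then have "bounded (\<eta> ` closure \<Omega>)"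
    by (intro compact_imp_bounded compact_continuous_image continuous_on_subset[OF \<eta>_cont]) auto
  then obtain B where "\<And>x. x \<in> closure \<Omega> \<Longrightarrow> \<bar>\<eta> x\<bar> \<le> B" by (auto simp: bounded_iff)
  then have "\<And>x. x \<in> \<Omega> \<Longrightarrow> \<bar>\<eta> x\<bar> \<le> B" using closure_subset by blast
  then have "\<And>x. x \<in> \<Omega> \<Longrightarrow> \<eta> x \<le> B \<and> - \<eta> x \<le> B" by (simp add: abs_le_iff)
  then show ?thesis by (intro that[of "exp (- B)" "exp B"]) auto
qed

text \<open>The drift measure lives on completed Lebesgue measure restricted to the domain, whereas
  the calculus above is for \<open>lborel\<close>. For Borel functions vanishing off the domain the
  two integrals agree.\<close>

lemma integral_M:
  fixes f :: "'a \<Rightarrow> real"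
  assumes f: "f \<in> borel_measurable borel" "\<And>x. x \<notin> \<Omega> \<Longrightarrow> f x = 0"
  shows "(\<integral>x. f x \<partial>M) = (\<integral>x. exp (- \<eta> x) * f x \<partial>lborel)"
    and "integrable M f \<longleftrightarrow> integrable lborel (\<lambda>x. exp (- \<eta> x) * f x)"
proof -
  have \<Omega>: "\<Omega> \<inter> space lebesgue \<in> sets lebesgue" using sets_\<Omega> by simp
  have fm: "f \<in> borel_measurable (lebesgue_on \<Omega>)"
    using f by (intro measurable_restrict_space1 measurable_completion) simp
  have em: "(\<lambda>x. exp (- \<eta> x)) \<in> borel_measurable (lebesgue_on \<Omega>)"
    by (intro measurable_restrict_space1 measurable_completion) simp
  have eq: "(\<lambda>x. indicator \<Omega> x *\<^sub>R (exp (- \<eta> x) *\<^sub>R f x)) = (\<lambda>x. exp (- \<eta> x) * f x)"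
    using f(2) by (intro ext) (auto split: split_indicator)
  have m: "(\<lambda>x. exp (- \<eta> x) * f x) \<in> borel_measurable lborel"
    using f by simp
  have "(\<integral>x. f x \<partial>M) = (\<integral>x. exp (- \<eta> x) *\<^sub>R f x \<partial>lebesgue_on \<Omega>)"
    unfolding drift_measure_def using fm em by (intro integral_density) auto
  also have "\<dots> = (\<integral>x. exp (- \<eta> x) * f x \<partial>lebesgue)"
    unfolding integral_restrict_space[OF \<Omega>] eq ..
  also have "\<dots> = (\<integral>x. exp (- \<eta> x) * f x \<partial>lborel)"
    by (rule integral_completion[OF m])
  finally show "(\<integral>x. f x \<partial>M) = (\<integral>x. exp (- \<eta> x) * f x \<partial>lborel)" .
  have "integrable M f \<longleftrightarrow> integrable (lebesgue_on \<Omega>) (\<lambda>x. exp (- \<eta> x) *\<^sub>R f x)"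
    unfolding drift_measure_def using fm em by (intro integrable_density) auto
  also have "\<dots> \<longleftrightarrow> integrable lebesgue (\<lambda>x. exp (- \<eta> x) * f x)"
    unfolding integrable_restrict_space[OF \<Omega>] eq ..
  also have "\<dots> \<longleftrightarrow> integrable lborel (\<lambda>x. exp (- \<eta> x) * f x)"
    by (rule integrable_completion[OF m])
  finally show "integrable M f \<longleftrightarrow> integrable lborel (\<lambda>x. exp (- \<eta> x) * f x)" .
qed

lemma finite_measure_M: "finite_measure M"
proof
  obtain b where b: "\<And>x. x \<in> \<Omega> \<Longrightarrow> exp (- \<eta> x) \<le> b" using weight_bounds by metis
  have em: "(\<lambda>x. ennreal (exp (- \<eta> x))) \<in> borel_measurable (lebesgue_on \<Omega>)"
    by (intro measurable_restrict_space1 measurable_completion) simp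
  have "emeasure M (space M) = (\<integral>\<^sup>+x. ennreal (exp (- \<eta> x)) * indicator (space M) x \<partial>lebesgue_on \<Omega>)"
    unfolding drift_measure_def using em by (subst emeasure_density) auto
  also have "\<dots> \<le> (\<integral>\<^sup>+x. ennreal b \<partial>lebesgue_on \<Omega>)"
    using b by (intro nn_integral_mono) (auto simp: space_M space_restrict_space indicator_def intro: ennreal_leI)
  also have "\<dots> = ennreal b * emeasure (lebesgue_on \<Omega>) \<Omega>"
    by (simp add: space_restrict_space)
  also have "emeasure (lebesgue_on \<Omega>) \<Omega> = emeasure lborel \<Omega>"
    using sets_\<Omega> by (simp add: emeasure_restrict_space)
  also have "ennreal b * emeasure lborel \<Omega> < \<infinity>"
    using emeasure_bounded_finite[OF bounded_\<Omega>] by (simp add: ennreal_mult_less_top)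
  finally show "emeasure M (space M) \<noteq> \<infinity>" by simp
qed

lemma square_integrable_M_compact_support:
  fixes f :: "'a \<Rightarrow> 'b::euclidean_space"
  assumes "continuous_on UNIV f" "compact K" "K \<subseteq> \<Omega>" "\<And>x. x \<notin> K \<Longrightarrow> f x = 0"
  shows "square_integrable M f"
proof -
  have m[measurable]: "f \<in> borel_measurable borel" by (rule borel_measurable_continuous_onI[OF assms(1)])
  have "integrable lborel (\<lambda>x. exp (- \<eta> x) * (norm (f x))\<^sup>2)"
  proof (rule integrable_compact_support[OF _ assms(2)])
    show "continuous_on UNIV (\<lambda>x. exp (- \<eta> x) * (norm (f x))\<^sup>2)"
      by (intro continuous_on_mult continuous_on_exp continuous_on_minus \<eta>_cont continuous_on_power
          continuous_on_norm assms)
  qed (simp add: assms(4))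
  moreover have "(norm (f x))\<^sup>2 = 0" if "x \<notin> \<Omega>" for x using that assms(3,4) by auto
  moreover have "(\<lambda>x. (norm (f x))\<^sup>2) \<in> borel_measurable borel" by measurable
  ultimately have "integrable M (\<lambda>x. (norm (f x))\<^sup>2)" using integral_M(2) by simp
  then show ?thesis using borel_measurable_M[OF m] by (simp add: square_integrable_def)
qed

lemma jet_square_integrable:
  assumes "test_function \<Omega> \<phi>"
  shows "square_integrable M (jet \<phi>)"
proof (rule square_integrable_M_compact_support)
  show "continuous_on UNIV (jet \<phi>)"
    unfolding jet_def[abs_def]
    by (intro continuous_on_Pair test_function_continuous[OF assms] test_function_grad_continuous[OF assms])
  show "compact (closure {x. \<phi> x \<noteq> 0})" "closure {x. \<phi> x \<noteq> 0} \<subseteq> \<Omega>"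
    by (fact test_function_support[OF assms])+
  show "jet \<phi> x = 0" if "x \<notin> closure {x. \<phi> x \<noteq> 0}" for x
    using test_function_support(3,4)[OF assms that] by (simp add: jet_def zero_prod_def)
qed

text \<open>The L^2 closure of the jets of test functions. The gradient is part of the data, so
  uniqueness of weak gradients never has to be discussed.\<close>

definition sobolev :: "('a \<Rightarrow> real \<times> 'a) \<Rightarrow> bool" where
  "sobolev F \<longleftrightarrow> square_integrable M F \<and>
    (\<exists>\<phi>. (\<forall>k. test_function \<Omega> (\<phi> k)) \<and> l2_tendsto M (\<lambda>k. jet (\<phi> k)) F)"

lemma sobolev_square_integrable: "sobolev F \<Longrightarrow> square_integrable M F"
  by (simp add: sobolev_def)

lemma sobolev_jet: "test_function \<Omega> \<phi> \<Longrightarrow> sobolev (jet \<phi>)"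
  unfolding sobolev_def using jet_square_integrable l2_tendsto_const
  by (intro conjI exI[of _ "\<lambda>_. \<phi>"]) auto

lemma sobolev_comb:
  assumes "sobolev F" "sobolev G"
  shows "sobolev (\<lambda>x. a *\<^sub>R F x + b *\<^sub>R G x)"
proof -
  obtain \<phi> \<psi> where \<phi>: "\<And>k. test_function \<Omega> (\<phi> k)" "l2_tendsto M (\<lambda>k. jet (\<phi> k)) F"
    and \<psi>: "\<And>k. test_function \<Omega> (\<psi> k)" "l2_tendsto M (\<lambda>k. jet (\<psi> k)) G"
    using assms by (auto simp: sobolev_def)
  let ?\<chi> = "\<lambda>k x. a * \<phi> k x + b * \<psi> k x"
  have t: "test_function \<Omega> (?\<chi> k)" for k
    by (intro test_function_add test_function_scale \<phi> \<psi>)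
  have jet: "jet (?\<chi> k) x = a *\<^sub>R jet (\<phi> k) x + b *\<^sub>R jet (\<psi> k) x" for k x
  proof -
    have d: "\<phi> k differentiable (at x)" "\<psi> k differentiable (at x)"
      "(\<lambda>x. a * \<phi> k x) differentiable (at x)" "(\<lambda>x. b * \<psi> k x) differentiable (at x)"
      using test_function_differentiable \<phi>(1) \<psi>(1) test_function_scale by blast+
    show ?thesis using grad_add[OF d(3,4)] grad_scale[OF d(1)] grad_scale[OF d(2)] by (simp add: jet_def)
  qed
  have scale: "l2_tendsto M (\<lambda>k x. c *\<^sub>R H k x) (\<lambda>x. c *\<^sub>R h x)"
    if "l2_tendsto M H h" "\<And>k. square_integrable M (H k)" "square_integrable M h"
    for c and H :: "nat \<Rightarrow> 'a \<Rightarrow> real \<times> 'a" and h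
  proof (rule l2_tendsto_dominated[OF that, of _ _ "\<bar>c\<bar>"])
    show "norm (c *\<^sub>R H k x - c *\<^sub>R h x) \<le> \<bar>c\<bar> * norm (H k x - h x)" for k x
      by (metis norm_scaleR order_refl scaleR_right_diff_distrib)
  qed (use that in \<open>auto intro: square_integrable_scaleR square_integrable_measurable\<close>)
  have "l2_tendsto M (\<lambda>k. jet (?\<chi> k)) (\<lambda>x. a *\<^sub>R F x + b *\<^sub>R G x)"
    unfolding jet[abs_def] using \<phi> \<psi> assms
    by (intro l2_tendsto_add scale square_integrable_scaleR jet_square_integrable sobolev_square_integrable)
  then show ?thesis
    unfolding sobolev_def using t assms
    by (intro conjI exI[of _ ?\<chi>] square_integrable_comb sobolev_square_integrable) auto
qed

lemma sobolev_scaleR: "sobolev F \<Longrightarrow> sobolev (\<lambda>x. c *\<^sub>R F x)"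
  using sobolev_comb[of F F c 0] by simp

lemma sobolev_zero: "sobolev (\<lambda>x. 0)"
  using sobolev_scaleR[OF sobolev_jet[OF test_function_zero], of 0] by simp

lemma sobolev_sum:
  assumes "\<And>i. i \<in> I \<Longrightarrow> sobolev (F i)"
  shows "sobolev (\<lambda>x. \<Sum>i\<in>I. c i *\<^sub>R F i x)"
  using assms
proof (induction I rule: infinite_finite_induct)
  case (insert i I)
  then show ?case
    using sobolev_comb[of "F i" "\<lambda>x. \<Sum>i\<in>I. c i *\<^sub>R F i x" "c i" 1] by simp
qed (simp_all add: sobolev_zero)

lemma sobolev_approx:
  assumes "sobolev F" "0 < e"
  obtains \<phi> where "test_function \<Omega> \<phi>" "l2_norm M (\<lambda>x. jet \<phi> x - F x) < e"
proof -
  obtain \<phi> where \<phi>: "\<And>k. test_function \<Omega> (\<phi> k)" "l2_tendsto M (\<lambda>k. jet (\<phi> k)) F"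
    using assms(1) by (auto simp: sobolev_def)
  have "\<forall>\<^sub>F k in sequentially. l2_norm M (\<lambda>x. jet (\<phi> k) x - F x) < e"
    using \<phi>(2) assms(2) unfolding l2_tendsto_def by (intro order_tendstoD(2))
  then obtain k where "l2_norm M (\<lambda>x. jet (\<phi> k) x - F x) < e"
    by (auto simp: eventually_sequentially)
  with \<phi>(1) show ?thesis using that by blast
qed

text \<open>Replace each \<open>F k\<close> by a test function within 1/(k+1).\<close>

lemma sobolev_closed:
  assumes F: "\<And>k. sobolev (F k)" and f: "square_integrable M f" and lim: "l2_tendsto M F f"
  shows "sobolev f"
proof -
  have "\<exists>\<phi>. test_function \<Omega> \<phi> \<and> l2_norm M (\<lambda>x. jet \<phi> x - F k x) < inverse (real (Suc k))" for k
    using sobolev_approx[OF F, of "inverse (real (Suc k))" k] by auto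
  then obtain \<phi> where \<phi>: "\<And>k. test_function \<Omega> (\<phi> k)"
    "\<And>k. l2_norm M (\<lambda>x. jet (\<phi> k) x - F k x) < inverse (real (Suc k))" by metis
  have "l2_tendsto M (\<lambda>k. jet (\<phi> k)) f"
    unfolding l2_tendsto_def
  proof (rule real_tendsto_sandwich[where f="\<lambda>_. 0"])
    show "\<forall>\<^sub>F k in sequentially. l2_norm M (\<lambda>x. jet (\<phi> k) x - f x)
        \<le> inverse (real (Suc k)) + l2_norm M (\<lambda>x. F k x - f x)"
    proof (intro always_eventually allI)
      fix k
      have "l2_norm M (\<lambda>x. jet (\<phi> k) x - f x)
          \<le> l2_norm M (\<lambda>x. jet (\<phi> k) x - F k x) + l2_norm M (\<lambda>x. F k x - f x)"
        by (intro l2_norm_diff_triangle jet_square_integrable \<phi> sobolev_square_integrable F f)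
      then show "l2_norm M (\<lambda>x. jet (\<phi> k) x - f x) \<le> inverse (real (Suc k)) + l2_norm M (\<lambda>x. F k x - f x)"
        using \<phi>(2)[of k] by simp
    qed
    show "(\<lambda>k. inverse (real (Suc k)) + l2_norm M (\<lambda>x. F k x - f x)) \<longlonglongrightarrow> 0"
      using tendsto_add[OF LIMSEQ_inverse_real_of_nat lim[unfolded l2_tendsto_def]] by simp
  qed (simp_all add: l2_norm_nonneg)
  then show ?thesis using f \<phi>(1) unfolding sobolev_def by blast
qed

text \<open>The density principle: two functionals that are sequentially continuous at
  \<open>F\<close> and agree on jets of test functions agree at \<open>F\<close>. Green's formula
  and the weighted identities below are checked on test functions and extended by this rule.\<close>

lemma sobolev_induct_eq:
  assumes "sobolev F"
    and eq: "\<And>\<phi>. test_function \<Omega> \<phi> \<Longrightarrow> P (jet \<phi>) = Q (jet \<phi>)"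
    and P: "\<And>G. (\<And>k. square_integrable M (G k)) \<Longrightarrow> l2_tendsto M G F \<Longrightarrow> (\<lambda>k. P (G k)) \<longlonglongrightarrow> (P F :: real)"
    and Q: "\<And>G. (\<And>k. square_integrable M (G k)) \<Longrightarrow> l2_tendsto M G F \<Longrightarrow> (\<lambda>k. Q (G k)) \<longlonglongrightarrow> Q F"
  shows "P F = Q F"
proof -
  obtain \<phi> where \<phi>: "\<And>k. test_function \<Omega> (\<phi> k)" "l2_tendsto M (\<lambda>k. jet (\<phi> k)) F"
    using assms(1) by (auto simp: sobolev_def)
  have sq: "square_integrable M (jet (\<phi> k))" for k by (intro jet_square_integrable \<phi>)
  show ?thesis
    using LIMSEQ_unique[OF P[OF sq \<phi>(2)]] Q[OF sq \<phi>(2)] eq[OF \<phi>(1)] by simp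
qed

text \<open>Each jet is approximated by a test function within 1/(k+1), to which the unweighted
  theorem applies; along the subsequence these errors vanish because \<open>r k\<close> is at least
  \<open>k\<close>. Only the function components become Cauchy, not the gradients.\<close>

lemma sobolev_rellich:
  assumes F: "\<And>k. sobolev (F k)" and C: "\<And>k. l2_norm M (F k) \<le> C"
  obtains r :: "nat \<Rightarrow> nat" where "strict_mono r"
    "\<And>e. 0 < e \<Longrightarrow> \<exists>N. \<forall>i\<ge>N. \<forall>j\<ge>N. l2_norm M (\<lambda>x. fst (F (r i) x) - fst (F (r j) x)) < e"
proof -
  have "\<exists>\<phi>. test_function \<Omega> \<phi> \<and> l2_norm M (\<lambda>x. jet \<phi> x - F k x) < inverse (real (Suc k))" for k
    using sobolev_approx[OF F, of "inverse (real (Suc k))" k] by auto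
  then obtain \<phi> where \<phi>: "\<And>k. test_function \<Omega> (\<phi> k)"
    "\<And>k. l2_norm M (\<lambda>x. jet (\<phi> k) x - F k x) < inverse (real (Suc k))" by metis
  obtain a b where ab: "0 < a" "0 < b" "\<And>x. x \<in> \<Omega> \<Longrightarrow> a \<le> exp (- \<eta> x)" "\<And>x. x \<in> \<Omega> \<Longrightarrow> exp (- \<eta> x) \<le> b"
    using weight_bounds by metis
  note sqF = sobolev_square_integrable[OF F] and sq\<phi> = jet_square_integrable[OF \<phi>(1)]
  have le1: "l2_norm M (jet (\<phi> k)) \<le> C + 1" for k
  proof -
    have "l2_norm M (\<lambda>x. (jet (\<phi> k) x - F k x) + F k x) \<le> l2_norm M (\<lambda>x. jet (\<phi> k) x - F k x) + l2_norm M (F k)"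
      by (intro l2_norm_triangle square_integrable_diff sqF sq\<phi>)
    moreover have "inverse (real (Suc k)) \<le> 1" by (simp add: inverse_le_1_iff)
    ultimately show ?thesis using C[of k] \<phi>(2)[of k] by simp
  qed
  \<comment> \<open>The lower bound transfers the H^1 bound to Lebesgue measure, the upper bound
    brings the Cauchy property back.\<close>
  have compare: "a * (\<integral>x. (norm (f x))\<^sup>2 \<partial>lborel) \<le> l2_inner M f f"
    "l2_inner M f f \<le> b * (\<integral>x. (norm (f x))\<^sup>2 \<partial>lborel)"
    if f: "continuous_on UNIV f" "compact K" "K \<subseteq> \<Omega>" "\<And>x. x \<notin> K \<Longrightarrow> f x = 0"
    for f :: "'a \<Rightarrow> 'b::euclidean_space" and K
  proof -
    have m[measurable]: "f \<in> borel_measurable borel" by (rule borel_measurable_continuous_onI[OF f(1)])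
    have i1: "integrable lborel (\<lambda>x. (norm (f x))\<^sup>2)"
      by (rule integrable_compact_support[OF continuous_on_power[OF continuous_on_norm[OF f(1)]] f(2)])
        (simp add: f(4))
    have z: "f x = 0" if "x \<notin> \<Omega>" for x using that f by auto
    have i2: "integrable lborel (\<lambda>x. exp (- \<eta> x) * (norm (f x))\<^sup>2)"
      using square_integrable_M_compact_support[OF f] integral_M(2)[of "\<lambda>x. (norm (f x))\<^sup>2"] z
      by (simp add: square_integrable_def)
    have e: "l2_inner M f f = (\<integral>x. exp (- \<eta> x) * (norm (f x))\<^sup>2 \<partial>lborel)"
      unfolding l2_inner_self using z by (intro integral_M(1)) auto
    have "(\<integral>x. a * (norm (f x))\<^sup>2 \<partial>lborel) \<le> l2_inner M f f"
      unfolding e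
    proof (rule integral_mono)
      show "a * (norm (f x))\<^sup>2 \<le> exp (- \<eta> x) * (norm (f x))\<^sup>2" for x
        using ab(3)[of x] z[of x] by (cases "x \<in> \<Omega>") (auto intro: mult_right_mono)
    qed (use i1 i2 in auto)
    then show "a * (\<integral>x. (norm (f x))\<^sup>2 \<partial>lborel) \<le> l2_inner M f f" by simp
    have "l2_inner M f f \<le> (\<integral>x. b * (norm (f x))\<^sup>2 \<partial>lborel)"
      unfolding e
    proof (rule integral_mono)
      show "exp (- \<eta> x) * (norm (f x))\<^sup>2 \<le> b * (norm (f x))\<^sup>2" for x
        using ab(4)[of x] z[of x] by (cases "x \<in> \<Omega>") (auto intro: mult_right_mono)
    qed (use i1 i2 in auto)
    then show "l2_inner M f f \<le> b * (\<integral>x. (norm (f x))\<^sup>2 \<partial>lborel)" by simp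
  qed
  have parts: "l2_inner M (\<phi> k) (\<phi> k) \<le> (C + 1)\<^sup>2" "l2_inner M (grad (\<phi> k)) (grad (\<phi> k)) \<le> (C + 1)\<^sup>2" for k
  proof -
    have "l2_inner M (jet (\<phi> k)) (jet (\<phi> k)) \<le> (C + 1)\<^sup>2"
      using power_mono[OF le1 l2_norm_nonneg, of k 2] by (simp add: l2_norm_power2)
    moreover have "l2_inner M (jet (\<phi> k)) (jet (\<phi> k))
        = l2_inner M (\<phi> k) (\<phi> k) + l2_inner M (grad (\<phi> k)) (grad (\<phi> k))"
      using l2_inner_jets[OF sq\<phi> sq\<phi>, of k k] by (simp add: l2_value_def l2_energy_def jet_def)
    ultimately show "l2_inner M (\<phi> k) (\<phi> k) \<le> (C + 1)\<^sup>2" "l2_inner M (grad (\<phi> k)) (grad (\<phi> k)) \<le> (C + 1)\<^sup>2"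
      using l2_inner_nonneg[of M "\<phi> k"] l2_inner_nonneg[of M "grad (\<phi> k)"] by linarith+
  qed
  have b1: "(\<integral>x. (\<phi> k x)\<^sup>2 \<partial>lborel) \<le> (C + 1)\<^sup>2 / a" for k
    using order.trans[OF compare(1)[OF test_function_continuous[OF \<phi>(1)] test_function_support(1,2,3)[OF \<phi>(1)]] parts(1), of k]
    by (simp add: pos_le_divide_eq[OF ab(1)] mult.commute)
  have b2: "(\<integral>x. (norm (grad (\<phi> k) x))\<^sup>2 \<partial>lborel) \<le> (C + 1)\<^sup>2 / a" for k
    using order.trans[OF compare(1)[OF test_function_grad_continuous[OF \<phi>(1)] test_function_support(1,2,4)[OF \<phi>(1)]] parts(2), of k]
    by (simp add: pos_le_divide_eq[OF ab(1)] mult.commute)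
  obtain r :: "nat \<Rightarrow> nat" where r: "strict_mono r" and cauchy:
    "\<And>e. 0 < e \<Longrightarrow> \<exists>N. \<forall>i\<ge>N. \<forall>j\<ge>N. (\<integral>x. (\<phi> (r i) x - \<phi> (r j) x)\<^sup>2 \<partial>lborel) < e"
    using rellich[where \<phi>=\<phi>, OF bounded_\<Omega> \<phi>(1) b1 b2] by blast
  have "\<exists>N. \<forall>i\<ge>N. \<forall>j\<ge>N. l2_norm M (\<lambda>x. fst (F (r i) x) - fst (F (r j) x)) < e" if e: "0 < e" for e
  proof -
    \<comment> \<open>Three errors of size e/3: two approximations and the difference of the test
      functions. The divisor \<open>b\<close> compensates for the weight.\<close>
    have "0 < (e / 3)\<^sup>2 / b" using e ab by simp
    from cauchy[OF this] obtain N1 where N1: "\<And>i j. i \<ge> N1 \<Longrightarrow> j \<ge> N1 \<Longrightarrow> (\<integral>x. (\<phi> (r i) x - \<phi> (r j) x)\<^sup>2 \<partial>lborel) < (e / 3)\<^sup>2 / b"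
      by blast
    obtain N2 where N2: "inverse (real (Suc N2)) < e / 3"
      using reals_Archimedean[of "e / 3"] e by auto
    show ?thesis
    proof (intro exI[of _ "max N1 N2"] allI impI)
      fix i j assume ij: "max N1 N2 \<le> i" "max N1 N2 \<le> j"
      have sq1: "square_integrable M (\<phi> k)" for k
        using square_integrable_fst[OF sq\<phi>[of k]] by (simp add: jet_def)
      have sq2: "square_integrable M (\<lambda>x. fst (F k x))" for k
        by (rule square_integrable_fst[OF sqF])
      have d: "l2_norm M (\<lambda>x. \<phi> (r k) x - fst (F (r k) x)) < e / 3" if "k \<ge> N2" for k
      proof -
        have "l2_norm M (\<lambda>x. \<phi> (r k) x - fst (F (r k) x)) \<le> 1 * l2_norm M (\<lambda>x. jet (\<phi> (r k)) x - F (r k) x)"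
        proof (rule l2_norm_dominated)
          show "norm (\<phi> (r k) x - fst (F (r k) x)) \<le> 1 * norm (jet (\<phi> (r k)) x - F (r k) x)" for x
            using norm_fst_le[of "\<phi> (r k) x - fst (F (r k) x)" "grad (\<phi> (r k)) x - snd (F (r k) x)"]
            by (simp add: jet_def minus_prod_def)
        qed (use square_integrable_diff[OF sq\<phi> sqF] square_integrable_diff[OF sq1 sq2] in
            \<open>auto simp: square_integrable_measurable\<close>)
        also have "\<dots> < inverse (real (Suc (r k)))" using \<phi>(2) by simp
        also have "\<dots> \<le> inverse (real (Suc N2))"
          using seq_suble[OF r, of k] that by (intro le_imp_inverse_le) auto
        finally show ?thesis using N2 by linarith
      qed
      have mid: "l2_norm M (\<lambda>x. \<phi> (r i) x - \<phi> (r j) x) < e / 3"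
      proof -
        have t: "test_function \<Omega> (\<lambda>x. \<phi> (r i) x - \<phi> (r j) x)" by (intro test_function_diff \<phi>)
        have "(l2_norm M (\<lambda>x. \<phi> (r i) x - \<phi> (r j) x))\<^sup>2 \<le> b * (\<integral>x. (\<phi> (r i) x - \<phi> (r j) x)\<^sup>2 \<partial>lborel)"
          using compare(2)[OF test_function_continuous[OF t] test_function_support(1,2,3)[OF t]] by (simp add: l2_norm_power2)
        also have "\<dots> < (e / 3)\<^sup>2"
          using N1[of i j] ij ab by (simp add: field_simps)
        finally show ?thesis by (rule power_less_imp_less_base) (use e in simp)
      qed
      have "l2_norm M (\<lambda>x. fst (F (r i) x) - fst (F (r j) x))
          \<le> l2_norm M (\<lambda>x. fst (F (r i) x) - \<phi> (r i) x) + l2_norm M (\<lambda>x. \<phi> (r i) x - fst (F (r j) x))"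
        by (intro l2_norm_diff_triangle sq1 sq2)
      also have "l2_norm M (\<lambda>x. \<phi> (r i) x - fst (F (r j) x))
          \<le> l2_norm M (\<lambda>x. \<phi> (r i) x - \<phi> (r j) x) + l2_norm M (\<lambda>x. \<phi> (r j) x - fst (F (r j) x))"
        by (intro l2_norm_diff_triangle sq1 sq2)
      finally show "l2_norm M (\<lambda>x. fst (F (r i) x) - fst (F (r j) x)) < e"
        using d[of i] d[of j] mid ij l2_norm_minus_commute[of M "\<lambda>x. fst (F (r i) x)" "\<phi> (r i)"]
        by simp
    qed
  qed
  with r show ?thesis using that by blast
qed

end

section \<open>Successive minimisers of the Rayleigh quotient and their Euler-Lagrange
  equation\<close>

section \<open>Eigenfunctions\<close>

text \<open>First-variation argument: near t = 0 the linear term would decide the sign. The witness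
  t = - \<beta> / (|\<gamma>| + 1) makes the expression at most - \<beta>^2 / (|\<gamma>| +
  1).\<close>

lemma linear_coefficient_eq_0:
  fixes \<beta> \<gamma> :: real
  assumes "\<And>t. 0 \<le> 2 * t * \<beta> + t\<^sup>2 * \<gamma>"
  shows "\<beta> = 0"
proof (rule ccontr)
  assume "\<beta> \<noteq> 0"
  define g where "g = \<bar>\<gamma>\<bar> + 1"
  have g: "0 < g" "\<gamma> \<le> g" by (auto simp: g_def)
  have "0 \<le> 2 * (- \<beta> / g) * \<beta> + (- \<beta> / g)\<^sup>2 * \<gamma>" by (rule assms)
  also have "\<dots> \<le> 2 * (- \<beta> / g) * \<beta> + (- \<beta> / g)\<^sup>2 * g"
    using g by (intro add_left_mono mult_left_mono) auto
  also have "\<dots> = - (\<beta>\<^sup>2 / g)"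
    using g by (simp add: power2_eq_square field_simps)
  also have "\<dots> < 0" using g \<open>\<beta> \<noteq> 0\<close> by simp
  finally show False by simp
qed

text \<open>Gaussian elimination with \<open>m\<close> equations in \<open>card J\<close> unknowns:
  a pivot \<open>i0\<close> for the last equation removes one unknown and one equation.\<close>

lemma homogeneous_system_solution:
  fixes c :: "'i \<Rightarrow> nat \<Rightarrow> real"
  assumes "finite J" "m < card J"
  shows "\<exists>d. (\<exists>i\<in>J. d i \<noteq> 0) \<and> (\<forall>k<m. (\<Sum>i\<in>J. d i * c i k) = 0)"
  using assms
proof (induction m arbitrary: J c)
  case 0
  then have "J \<noteq> {}" by auto
  then show ?case by (intro exI[of _ "\<lambda>_. 1"]) auto
next
  case (Suc m)
  show ?case
  proof (cases "\<forall>i\<in>J. c i m = 0")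
    case True
    from Suc.IH[of J c] Suc.prems obtain d where d: "\<exists>i\<in>J. d i \<noteq> 0" "\<forall>k<m. (\<Sum>i\<in>J. d i * c i k) = 0" by auto
    with True show ?thesis by (intro exI[of _ d]) (auto simp: less_Suc_eq)
  next
    case False
    then obtain i0 where i0: "i0 \<in> J" "c i0 m \<noteq> 0" by auto
    let ?J = "J - {i0}" and ?c = "\<lambda>i k. c i k - c i m / c i0 m * c i0 k"
    have "finite ?J" "m < card ?J" using Suc.prems i0 by auto
    from Suc.IH[OF this, of ?c] obtain d where
      d: "\<exists>i\<in>?J. d i \<noteq> 0" "\<forall>k<m. (\<Sum>i\<in>?J. d i * ?c i k) = 0" by blast
    \<comment> \<open>The value at the pivot is solved from equation \<open>m\<close>; substituting
      it turns every equation into the reduced one.\<close>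
    define e where "e i = (if i = i0 then - (\<Sum>i\<in>?J. d i * (c i m / c i0 m)) else d i)" for i
    have sum: "(\<Sum>i\<in>J. e i * c i k) = (\<Sum>i\<in>?J. d i * ?c i k)" for k
    proof -
      have "(\<Sum>i\<in>J. e i * c i k) = e i0 * c i0 k + (\<Sum>i\<in>?J. e i * c i k)"
        using Suc.prems i0 by (intro sum.remove) auto
      also have "(\<Sum>i\<in>?J. e i * c i k) = (\<Sum>i\<in>?J. d i * c i k)"
        by (intro sum.cong) (auto simp: e_def)
      also have "e i0 * c i0 k + \<dots> = (\<Sum>i\<in>?J. d i * ?c i k)"
        by (simp add: e_def sum_distrib_right right_diff_distrib sum_subtractf mult.assoc)
      finally show ?thesis .
    qed
    have "(\<Sum>i\<in>J. e i * c i k) = 0" if "k < Suc m" for k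
      using that d(2) i0 unfolding sum by (auto simp: less_Suc_eq)
    moreover have "\<exists>i\<in>J. e i \<noteq> 0" using d(1) by (auto simp: e_def)
    ultimately show ?thesis by blast
  qed
qed

lemma l2_value_sum_left:
  assumes "\<And>i. i \<in> I \<Longrightarrow> square_integrable M (F i)" "square_integrable M H"
  shows "l2_value M (\<lambda>x. \<Sum>i\<in>I. c i *\<^sub>R F i x) H = (\<Sum>i\<in>I. c i * l2_value M (F i) H)"
  using assms
proof (induction I rule: infinite_finite_induct)
  case (insert i I)
  have "l2_value M (\<lambda>x. c i *\<^sub>R F i x + 1 *\<^sub>R (\<Sum>i\<in>I. c i *\<^sub>R F i x)) H
      = c i * l2_value M (F i) H + 1 * l2_value M (\<lambda>x. \<Sum>i\<in>I. c i *\<^sub>R F i x) H"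
    using insert.prems by (intro l2_value_comb_left square_integrable_sum square_integrable_scaleR) auto
  with insert show ?case by simp
qed (simp_all add: l2_value_def l2_inner_def)

lemma l2_energy_sum_left:
  assumes "\<And>i. i \<in> I \<Longrightarrow> square_integrable M (F i)" "square_integrable M H"
  shows "l2_energy M (\<lambda>x. \<Sum>i\<in>I. c i *\<^sub>R F i x) H = (\<Sum>i\<in>I. c i * l2_energy M (F i) H)"
  using assms
proof (induction I rule: infinite_finite_induct)
  case (insert i I)
  have "l2_energy M (\<lambda>x. c i *\<^sub>R F i x + 1 *\<^sub>R (\<Sum>i\<in>I. c i *\<^sub>R F i x)) H
      = c i * l2_energy M (F i) H + 1 * l2_energy M (\<lambda>x. \<Sum>i\<in>I. c i *\<^sub>R F i x) H"
    using insert.prems by (intro l2_energy_comb_left square_integrable_sum square_integrable_scaleR) auto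
  with insert show ?case by simp
qed (simp_all add: l2_energy_def l2_inner_def)

context drifted_domain
begin

text \<open>The direct method without weak convergence. Compactness makes a minimising sequence
  Cauchy in L^2, and the parallelogram law upgrades this to Cauchy in H^1, so a strong limit exists
  and lies in the closed subspace \<open>A\<close>.\<close>

lemma sobolev_minimiser:
  assumes A: "\<And>F. F \<in> A \<Longrightarrow> sobolev F"
    and comb: "\<And>F G a b. F \<in> A \<Longrightarrow> G \<in> A \<Longrightarrow> (\<lambda>x. a *\<^sub>R F x + b *\<^sub>R G x) \<in> A"
    and closed: "\<And>F f. (\<And>k. F k \<in> A) \<Longrightarrow> sobolev f \<Longrightarrow> l2_tendsto M F f \<Longrightarrow> f \<in> A"
    and G0: "G0 \<in> A" "0 < l2_value M G0 G0"
  obtains F where "F \<in> A" "l2_value M F F = 1"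
    "\<And>G. G \<in> A \<Longrightarrow> l2_energy M F F * l2_value M G G \<le> l2_energy M G G"
proof -
  note sq = sobolev_square_integrable[OF A]
  define E where "E = {l2_energy M F F | F. F \<in> A \<and> l2_value M F F = 1}"
  define \<mu> where "\<mu> = Inf E"
  have bdd: "bdd_below E"
    by (rule bdd_belowI[of _ 0]) (auto simp: E_def l2_energy_nonneg)
  have normalise: "l2_energy M G G / l2_value M G G \<in> E" if G: "G \<in> A" "0 < l2_value M G G" for G
  proof -
    let ?c = "1 / sqrt (l2_value M G G)"
    let ?H = "\<lambda>x. ?c *\<^sub>R G x + 0 *\<^sub>R G x"
    have "?H \<in> A" by (intro comb G)
    moreover have "l2_value M ?H ?H = 1"
      unfolding l2_value_comb[OF sq[OF G(1)] sq[OF G(1)]] using G(2) by (simp add: power_divide)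
    moreover have "l2_energy M ?H ?H = l2_energy M G G / l2_value M G G"
      unfolding l2_energy_comb[OF sq[OF G(1)] sq[OF G(1)]] using G(2) by (simp add: power_divide)
    ultimately show ?thesis unfolding E_def by (intro CollectI exI[of _ ?H]) simp
  qed
  have ne: "E \<noteq> {}" using normalise[OF G0] by auto
  have \<mu>0: "0 \<le> \<mu>"
    unfolding \<mu>_def by (rule cInf_greatest[OF ne]) (auto simp: E_def l2_energy_nonneg)
  have lower: "\<mu> * l2_value M G G \<le> l2_energy M G G" if G: "G \<in> A" for G
  proof (cases "l2_value M G G = 0")
    case False
    then have pos: "0 < l2_value M G G" using l2_value_nonneg[of M G] by simp
    have "\<mu> \<le> l2_energy M G G / l2_value M G G"
      unfolding \<mu>_def by (rule cInf_lower[OF normalise[OF G pos] bdd])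
    then show ?thesis using pos by (simp add: field_simps)
  qed (simp add: l2_energy_nonneg)
  have "\<exists>F. F \<in> A \<and> l2_value M F F = 1 \<and> l2_energy M F F < \<mu> + inverse (real (Suc k))" for k
  proof -
    have "\<exists>y\<in>E. y < \<mu> + inverse (real (Suc k))"
      unfolding \<mu>_def by (rule cInf_lessD[OF ne]) simp
    then show ?thesis unfolding E_def by blast
  qed
  then obtain F where F: "\<And>k. F k \<in> A" "\<And>k. l2_value M (F k) (F k) = 1"
    "\<And>k. l2_energy M (F k) (F k) < \<mu> + inverse (real (Suc k))" by metis
  \<comment> \<open>Value 1 plus an energy below \<mu> + 1.\<close>
  have "l2_norm M (F k) \<le> sqrt (\<mu> + 2)" for k
  proof -
    have "inverse (real (Suc k)) \<le> 1" by (simp add: inverse_le_1_iff)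
    then have "l2_inner M (F k) (F k) \<le> \<mu> + 2"
      using F(2,3)[of k] l2_inner_jets[OF sq[OF F(1)] sq[OF F(1)], of k k] by simp
    then show ?thesis by (simp add: l2_norm_def)
  qed
  from sobolev_rellich[where F=F, OF A[OF F(1)] this] obtain r :: "nat \<Rightarrow> nat"
    where r: "strict_mono r" and cauchy: "\<And>e. 0 < e \<Longrightarrow>
      \<exists>N. \<forall>i\<ge>N. \<forall>j\<ge>N. l2_norm M (\<lambda>x. fst (F (r i) x) - fst (F (r j) x)) < e" by blast
  \<comment> \<open>Parallelogram law for value and energy. The sum \<open>?S\<close> lies in
    \<open>A\<close>, so its energy is at least \<mu> times its value; as both energies are nearly
    \<mu>, little energy is left for the difference \<open>?D\<close> beyond \<mu> times its
    value.\<close>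
  have key: "(l2_norm M (\<lambda>x. F i x - F j x))\<^sup>2 \<le> (1 + \<mu>) * (l2_norm M (\<lambda>x. fst (F i x) - fst (F j x)))\<^sup>2
      + 2 * (inverse (real (Suc i)) + inverse (real (Suc j)))" for i j
  proof -
    let ?D = "\<lambda>x. 1 *\<^sub>R F i x + (- 1) *\<^sub>R F j x" and ?S = "\<lambda>x. 1 *\<^sub>R F i x + 1 *\<^sub>R F j x"
    have s: "square_integrable M (F i)" "square_integrable M (F j)" by (intro sq F)+
    have e1: "(l2_norm M (\<lambda>x. F i x - F j x))\<^sup>2 = l2_value M ?D ?D + l2_energy M ?D ?D"
    proof -
      have "l2_inner M ?D ?D = l2_value M ?D ?D + l2_energy M ?D ?D"
        by (intro l2_inner_jets sq comb F)
      then show ?thesis by (simp add: l2_norm_power2)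
    qed
    have e2: "(l2_norm M (\<lambda>x. fst (F i x) - fst (F j x)))\<^sup>2 = l2_value M ?D ?D"
      unfolding l2_norm_power2 l2_value_def by simp
    have e3: "\<mu> * l2_value M ?S ?S \<le> l2_energy M ?S ?S" by (intro lower comb F)
    have e4: "l2_value M ?S ?S = 4 - l2_value M ?D ?D"
      unfolding l2_value_comb[OF s] by (simp add: F)
    have e5: "l2_energy M ?S ?S = 2 * l2_energy M (F i) (F i) + 2 * l2_energy M (F j) (F j) - l2_energy M ?D ?D"
      unfolding l2_energy_comb[OF s] by simp
    have alg: "N \<le> (1 + \<mu>) * v + 2 * (a + b)"
      if "N = v + d" "\<mu> * s \<le> d'" "s = 4 - v" "d' = 2 * x + 2 * y - d" "x < \<mu> + a" "y < \<mu> + b"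
      for N v d s d' x y a b :: real
    proof -
      have "4 * \<mu> - \<mu> * v \<le> d'" using that(2,3) by (simp add: algebra_simps)
      then have "d \<le> 2 * (a + b) + \<mu> * v" using that(4-6) by argo
      then show ?thesis using that(1) by (simp add: distrib_right)
    qed
    show ?thesis
      unfolding e2 by (rule alg[OF e1 e3 e4 e5 F(3)[of i] F(3)[of j]])
  qed
  have "\<exists>N. \<forall>i\<ge>N. \<forall>j\<ge>N. l2_norm M (\<lambda>x. F (r i) x - F (r j) x) < e" if e: "0 < e" for e
  proof -
    \<comment> \<open>The two terms of \<open>key\<close> each receive half of e^2: the first by
      this threshold, the second because both inverses are below e^2 / 8.\<close>
    have "0 < e / sqrt (2 * (1 + \<mu>))" using e \<mu>0 by simp
    from cauchy[OF this] obtain N1 where N1: "\<And>i j. i \<ge> N1 \<Longrightarrow> j \<ge> N1 \<Longrightarrow>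
      l2_norm M (\<lambda>x. fst (F (r i) x) - fst (F (r j) x)) < e / sqrt (2 * (1 + \<mu>))" by blast
    obtain N2 where N2: "inverse (real (Suc N2)) < e\<^sup>2 / 8"
      using reals_Archimedean[of "e\<^sup>2 / 8"] e by auto
    show ?thesis
    proof (intro exI[of _ "max N1 N2"] allI impI)
      fix i j assume ij: "max N1 N2 \<le> i" "max N1 N2 \<le> j"
      have inv: "inverse (real (Suc (r k))) < e\<^sup>2 / 8" if "k \<ge> N2" for k
      proof -
        have "inverse (real (Suc (r k))) \<le> inverse (real (Suc N2))"
          using seq_suble[OF r, of k] that by (intro le_imp_inverse_le) auto
        from this N2 show ?thesis by (rule le_less_trans)
      qed
      have "(l2_norm M (\<lambda>x. fst (F (r i) x) - fst (F (r j) x)))\<^sup>2 \<le> (e / sqrt (2 * (1 + \<mu>)))\<^sup>2"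
        using N1[of i j] ij by (intro power_mono) (auto simp: l2_norm_nonneg)
      then have "(1 + \<mu>) * (l2_norm M (\<lambda>x. fst (F (r i) x) - fst (F (r j) x)))\<^sup>2 \<le> (1 + \<mu>) * (e\<^sup>2 / (2 * (1 + \<mu>)))"
        using \<mu>0 by (intro mult_left_mono) (auto simp: power_divide)
      also have "\<dots> = e\<^sup>2 / 2" using \<mu>0 by (simp add: field_simps)
      finally have "(l2_norm M (\<lambda>x. F (r i) x - F (r j) x))\<^sup>2 < e\<^sup>2"
        using key[of "r i" "r j"] inv[of i] inv[of j] ij
        unfolding max.bounded_iff by argo
      then show "l2_norm M (\<lambda>x. F (r i) x - F (r j) x) < e"
        by (rule power_less_imp_less_base) (use e in simp)
    qed
  qed
  from l2_complete[where F="\<lambda>k. F (r k)", OF finite_measure_M sq[OF F(1)] this]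
  obtain f where f: "square_integrable M f" "l2_tendsto M (\<lambda>k. F (r k)) f" by blast
  have sf: "sobolev f" by (rule sobolev_closed[OF A[OF F(1)] f])
  have fA: "f \<in> A" by (rule closed[OF F(1) sf f(2)])
  have "(\<lambda>k. l2_value M (F (r k)) (F (r k))) \<longlonglongrightarrow> l2_value M f f"
    by (rule l2_value_tendsto[OF f(2) f(2) sq[OF F(1)] f(1) sq[OF F(1)] f(1)])
  then have v: "l2_value M f f = 1" using F(2) by (simp add: LIMSEQ_const_iff)
  have "(\<lambda>k. l2_energy M (F (r k)) (F (r k))) \<longlonglongrightarrow> l2_energy M f f"
    by (rule l2_energy_tendsto[OF f(2) f(2) sq[OF F(1)] f(1) sq[OF F(1)] f(1)])
  moreover have "(\<lambda>k. \<mu> + inverse (real (Suc (r k)))) \<longlonglongrightarrow> \<mu> + 0"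
    using LIMSEQ_subseq_LIMSEQ[OF LIMSEQ_inverse_real_of_nat r]
    by (intro tendsto_add tendsto_const) (simp add: o_def)
  ultimately have "l2_energy M f f \<le> \<mu> + 0"
    by (rule LIMSEQ_le) (use F(3) less_imp_le in blast)
  then have en: "l2_energy M f f \<le> \<mu>" by simp
  have "l2_energy M f f * l2_value M G G \<le> l2_energy M G G" if "G \<in> A" for G
    using mult_right_mono[OF en l2_value_nonneg[of M G]] lower[OF that] by linarith
  with fA v show ?thesis using that by blast
qed

text \<open>In the inequality for F + t G the constant terms cancel, since \<open>F\<close> is
  normalised; the linear coefficient in t must then vanish.\<close>

lemma minimiser_variation:
  assumes F: "sobolev F" "l2_value M F F = 1" and G: "sobolev G"
    and min: "\<And>t. l2_energy M F F * l2_value M (\<lambda>x. 1 *\<^sub>R F x + t *\<^sub>R G x) (\<lambda>x. 1 *\<^sub>R F x + t *\<^sub>R G x)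
      \<le> l2_energy M (\<lambda>x. 1 *\<^sub>R F x + t *\<^sub>R G x) (\<lambda>x. 1 *\<^sub>R F x + t *\<^sub>R G x)"
  shows "l2_energy M F G = l2_energy M F F * l2_value M F G"
proof -
  let ?\<mu> = "l2_energy M F F"
  have s: "square_integrable M F" "square_integrable M G"
    using F G by (auto intro: sobolev_square_integrable)
  have "l2_energy M F G - ?\<mu> * l2_value M F G = 0"
  proof (rule linear_coefficient_eq_0[where \<gamma>="l2_energy M G G - ?\<mu> * l2_value M G G"])
    fix t
    show "0 \<le> 2 * t * (l2_energy M F G - ?\<mu> * l2_value M F G) + t\<^sup>2 * (l2_energy M G G - ?\<mu> * l2_value M G G)"
      using min[of t] unfolding l2_value_comb[OF s] l2_energy_comb[OF s] by (simp add: F algebra_simps)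
  qed
  then show ?thesis by simp
qed

text \<open>The weak eigenvalue equation, tested against all of H^1_0. The zero jet qualifies for
  every s, so nontriviality is stated separately as a positive \<open>l2_value\<close>.\<close>

definition eigenjet :: "('a \<Rightarrow> real \<times> 'a) \<Rightarrow> real \<Rightarrow> bool" where
  "eigenjet F s \<longleftrightarrow> sobolev F \<and> (\<forall>H. sobolev H \<longrightarrow> l2_energy M F H = s * l2_value M F H)"

text \<open>Both forms are symmetric, and the energy of the pair can be evaluated with either
  eigenvalue.\<close>

lemma eigenjet_orthogonal:
  assumes "eigenjet F s" "eigenjet G t" "s \<noteq> t"
  shows "l2_value M F G = 0"
proof -
  have "s * l2_value M F G = t * l2_value M G F"
    using assms by (metis eigenjet_def l2_energy_commute)
  then show ?thesis using assms(3) by (simp add: l2_value_commute[of M G F])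
qed

text \<open>Refers to \<open>f\<close> only below \<open>j\<close>, as required for a recursive
  choice in which each step sees the whole previous history.\<close>

definition minimiser_step :: "(nat \<Rightarrow> 'a \<Rightarrow> real \<times> 'a) \<Rightarrow> nat \<Rightarrow> ('a \<Rightarrow> real \<times> 'a) \<Rightarrow> bool" where
  "minimiser_step f j F \<longleftrightarrow> sobolev F \<and> l2_value M F F = 1 \<and> (\<forall>i<j. l2_value M (f i) F = 0) \<and>
    (\<forall>G. sobolev G \<and> (\<forall>i<j. l2_value M (f i) G = 0) \<longrightarrow>
      l2_energy M F F * l2_value M G G \<le> l2_energy M G G)"

text \<open>Variation gives the equation only in directions orthogonal to the earlier minimisers. In
  the remaining directions both sides vanish, because the earlier minimisers are themselves
  eigenjets orthogonal to \<open>f j\<close>; hence the strong induction.\<close>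

lemma minimiser_step_eigenjet:
  assumes "\<And>i. i \<le> j \<Longrightarrow> minimiser_step f i (f i)"
  shows "eigenjet (f j) (l2_energy M (f j) (f j))"
  using assms
proof (induction j rule: less_induct)
  case (less j)
  have step: "minimiser_step f i (f i)" if "i \<le> j" for i using less.prems that by blast
  have eig: "eigenjet (f i) (l2_energy M (f i) (f i))" if "i < j" for i
    using less.IH[OF that] less.prems that by simp
  have sob: "sobolev (f i)" if "i \<le> j" for i using step[OF that] by (simp add: minimiser_step_def)
  have sq: "square_integrable M (f i)" if "i \<le> j" for i using sob[OF that] by (rule sobolev_square_integrable)
  have ortho: "l2_value M (f i) (f k) = (if i = k then 1 else 0)" if "i \<le> j" "k \<le> j" for i k
    using step[OF that(1)] step[OF that(2)] l2_value_commute[of M "f i" "f k"]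
    by (cases i k rule: linorder_cases) (auto simp: minimiser_step_def)
  have orthogonal: "l2_energy M (f j) G = l2_energy M (f j) (f j) * l2_value M (f j) G"
    if G: "sobolev G" "\<And>i. i < j \<Longrightarrow> l2_value M (f i) G = 0" for G
  proof (rule minimiser_variation)
    fix t
    let ?H = "\<lambda>x. 1 *\<^sub>R f j x + t *\<^sub>R G x"
    have "sobolev ?H" using sob[of j] G by (intro sobolev_comb) auto
    moreover have "l2_value M (f i) ?H = 0" if "i < j" for i
    proof -
      have "l2_value M ?H (f i) = 1 * l2_value M (f j) (f i) + t * l2_value M G (f i)"
        using that sq G by (intro l2_value_comb_left) (auto intro: sobolev_square_integrable)
      then show ?thesis
        using that ortho[of j i] G(2)[OF that] by (simp add: l2_value_commute[of M _ "f i"])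
    qed
    ultimately show "l2_energy M (f j) (f j) * l2_value M ?H ?H \<le> l2_energy M ?H ?H"
      using step[of j] unfolding minimiser_step_def by blast
  qed (use step[of j] G in \<open>auto simp: minimiser_step_def\<close>)
  show ?case
    unfolding eigenjet_def
  proof (intro conjI allI impI)
    show "sobolev (f j)" by (rule sob) simp
    fix H assume H: "sobolev H"
    let ?c = "\<lambda>i. l2_value M (f i) H"
    \<comment> \<open>The projection of \<open>H\<close> to the span of the earlier minimisers;
      \<open>?G\<close> is the orthogonal remainder.\<close>
    let ?P = "\<lambda>x. \<Sum>i<j. ?c i *\<^sub>R f i x"
    let ?G = "\<lambda>x. 1 *\<^sub>R H x + (- 1) *\<^sub>R ?P x"
    have P: "sobolev ?P" using sob by (intro sobolev_sum) auto
    have sqs: "square_integrable M H" "square_integrable M ?P"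
      using H P by (auto intro: sobolev_square_integrable)
    have G: "sobolev ?G" by (intro sobolev_comb H P)
    have Pf: "l2_value M ?P (f k) = (\<Sum>i<j. ?c i * l2_value M (f i) (f k))" if "k \<le> j" for k
      using sq that by (intro l2_value_sum_left) auto
    have "l2_value M (f k) ?G = 0" if "k < j" for k
    proof -
      have "l2_value M ?G (f k) = 1 * l2_value M H (f k) + (- 1) * l2_value M ?P (f k)"
        using that by (intro l2_value_comb_left sqs sq) auto
      also have "l2_value M ?P (f k) = (\<Sum>i<j. if i = k then ?c i else 0)"
        using that unfolding Pf[OF less_imp_le[OF that]] by (intro sum.cong) (auto simp: ortho)
      also have "\<dots> = ?c k" using that by simp
      finally show ?thesis by (simp add: l2_value_commute[of M _ "f k"])
    qed
    from orthogonal[OF G this]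
    have "l2_energy M (f j) ?G = l2_energy M (f j) (f j) * l2_value M (f j) ?G" by blast
    moreover have "l2_energy M ?G (f j) = 1 * l2_energy M H (f j) + (- 1) * l2_energy M ?P (f j)"
      by (intro l2_energy_comb_left sqs sq) auto
    moreover have "l2_value M ?G (f j) = 1 * l2_value M H (f j) + (- 1) * l2_value M ?P (f j)"
      by (intro l2_value_comb_left sqs sq) auto
    moreover have "l2_value M ?P (f j) = 0"
      unfolding Pf[OF order_refl] by (intro sum.neutral) (auto simp: ortho)
    moreover have "l2_energy M ?P (f j) = 0"
    proof -
      have "l2_energy M ?P (f j) = (\<Sum>i<j. ?c i * l2_energy M (f i) (f j))"
        using sq by (intro l2_energy_sum_left) auto
      also have "\<dots> = 0"
      proof (intro sum.neutral ballI)
        fix i assume "i \<in> {..<j}"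
        then have "i < j" by simp
        have "l2_energy M (f i) (f j) = l2_energy M (f i) (f i) * l2_value M (f i) (f j)"
          using eig[OF \<open>i < j\<close>] sob[of j] unfolding eigenjet_def by blast
        then show "?c i * l2_energy M (f i) (f j) = 0" using ortho[of i j] \<open>i < j\<close> by simp
      qed
      finally show ?thesis .
    qed
    ultimately show "l2_energy M (f j) H = l2_energy M (f j) (f j) * l2_value M (f j) H"
      by (simp only: l2_energy_commute[of M "f j" H] l2_value_commute[of M "f j" H]
          l2_energy_commute[of M "f j" ?G] l2_value_commute[of M "f j" ?G]
          mult_1 mult_zero_right add_0_right)
  qed
qed

text \<open>Each stage needs a nonzero competitor orthogonal to all earlier minimisers. An eigenjet
  whose eigenvalue exceeds all earlier ones is such a competitor, and \<open>unbounded\<close>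
  supplies it.\<close>

lemma minimiser_sequence:
  assumes unbounded: "\<And>s. \<exists>t>s. \<exists>G. eigenjet G t \<and> 0 < l2_value M G G"
  obtains U :: "nat \<Rightarrow> 'a \<Rightarrow> real \<times> 'a" and \<mu> :: "nat \<Rightarrow> real"
  where "\<And>j. eigenjet (U j) (\<mu> j)"
    "\<And>i j. l2_value M (U i) (U j) = (if i = j then 1 else 0)"
    "\<And>j G. sobolev G \<Longrightarrow> (\<And>i. i < j \<Longrightarrow> l2_value M (U i) G = 0) \<Longrightarrow>
      \<mu> j * l2_value M G G \<le> l2_energy M G G"
proof -
  have "\<exists>U. \<forall>j. minimiser_step U j (U j)"
  proof (rule dependent_wellorder_choice)
    fix r and f g :: "nat \<Rightarrow> 'a \<Rightarrow> real \<times> 'a" and x :: nat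
    assume "\<And>y. y < x \<Longrightarrow> f y = g y"
    then show "minimiser_step f x r = minimiser_step g x r" by (simp add: minimiser_step_def)
  next
    fix j :: nat and f :: "nat \<Rightarrow> 'a \<Rightarrow> real \<times> 'a"
    assume step: "\<And>i. i < j \<Longrightarrow> minimiser_step f i (f i)"
    let ?\<mu> = "\<lambda>i. l2_energy M (f i) (f i)"
    have eig: "eigenjet (f i) (?\<mu> i)" if "i < j" for i
      using that step by (intro minimiser_step_eigenjet) auto
    then have sq: "square_integrable M (f i)" if "i < j" for i
      using that by (auto simp: eigenjet_def intro: sobolev_square_integrable)
    \<comment> \<open>The earlier values are nonnegative energies, so their sum bounds each of
      them.\<close>
    obtain t G0 where G0: "(\<Sum>i<j. ?\<mu> i) < t" "eigenjet G0 t" "0 < l2_value M G0 G0"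
      using unbounded[of "\<Sum>i<j. ?\<mu> i"] by blast
    have "?\<mu> i < t" if "i < j" for i
      using member_le_sum[of i "{..<j}" ?\<mu>] that G0(1) by (auto simp: l2_energy_nonneg)
    then have orth: "l2_value M (f i) G0 = 0" if "i < j" for i
      using eigenjet_orthogonal[OF eig G0(2)] that by (metis less_irrefl)
    define A where "A = {G. sobolev G \<and> (\<forall>i<j. l2_value M (f i) G = 0)}"
    obtain F where F: "F \<in> A" "l2_value M F F = 1"
      "\<And>G. G \<in> A \<Longrightarrow> l2_energy M F F * l2_value M G G \<le> l2_energy M G G"
    proof (rule sobolev_minimiser[of A G0])
      fix F G and a b :: real
      assume FG: "F \<in> A" "G \<in> A"
      then have s: "sobolev F" "sobolev G" by (auto simp: A_def)
      have "l2_value M (f i) (\<lambda>x. a *\<^sub>R F x + b *\<^sub>R G x) = 0" if "i < j" for i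
      proof -
        have "l2_value M (\<lambda>x. a *\<^sub>R F x + b *\<^sub>R G x) (f i) = a * l2_value M F (f i) + b * l2_value M G (f i)"
          by (intro l2_value_comb_left sobolev_square_integrable s sq that)
        then show ?thesis using FG that by (simp add: A_def l2_value_commute[of M _ "f i"])
      qed
      then show "(\<lambda>x. a *\<^sub>R F x + b *\<^sub>R G x) \<in> A" using s by (simp add: A_def sobolev_comb)
    next
      fix F and h
      assume F: "\<And>k. F k \<in> A" and h: "sobolev h" "l2_tendsto M F h"
      have "l2_value M (f i) h = 0" if "i < j" for i
      proof -
        have "(\<lambda>k. l2_value M (f i) (F k)) \<longlonglongrightarrow> l2_value M (f i) h"
          using F by (intro l2_value_tendsto l2_tendsto_const sq that h sobolev_square_integrable) (auto simp: A_def)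
        moreover have "l2_value M (f i) (F k) = 0" for k using F[of k] that by (simp add: A_def)
        ultimately show ?thesis by (simp add: LIMSEQ_const_iff)
      qed
      then show "h \<in> A" using h by (simp add: A_def)
    qed (use G0 orth in \<open>auto simp: A_def eigenjet_def\<close>)
    then have "minimiser_step f j F" by (auto simp: minimiser_step_def A_def)
    then show "\<exists>F. minimiser_step f j F" by blast
  qed
  then obtain U where U: "\<And>j. minimiser_step U j (U j)" by blast
  show ?thesis
  proof (rule that[of U "\<lambda>j. l2_energy M (U j) (U j)"])
    show "eigenjet (U j) (l2_energy M (U j) (U j))" for j
      by (rule minimiser_step_eigenjet) (rule U)
    show "l2_value M (U i) (U j) = (if i = j then 1 else 0)" for i j
      using U[of i] U[of j] l2_value_commute[of M "U i" "U j"]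
      by (cases i j rule: linorder_cases) (auto simp: minimiser_step_def)
    show "l2_energy M (U j) (U j) * l2_value M G G \<le> l2_energy M G G"
      if "sobolev G" "\<And>i. i < j \<Longrightarrow> l2_value M (U i) G = 0" for j G
      using U[of j] that by (auto simp: minimiser_step_def)
  qed
qed

end

section \<open>Green's formula, and eigenspaces expressed through jets\<close>

context drifted_domain
begin

lemma integrable_M_compact_support:
  fixes f :: "'a \<Rightarrow> real"
  assumes "continuous_on UNIV f" "compact K" "K \<subseteq> \<Omega>" "\<And>x. x \<notin> K \<Longrightarrow> f x = 0"
  shows "integrable M f"
proof -
  have "integrable lborel (\<lambda>x. exp (- \<eta> x) * f x)"
    by (rule integrable_compact_support[OF continuous_on_mult[OF continuous_on_exp[OF
              continuous_on_minus[OF \<eta>_cont]] assms(1)] assms(2)]) (simp add: assms(4))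
  moreover have "f x = 0" if "x \<notin> \<Omega>" for x using that assms(3,4) by auto
  ultimately show ?thesis
    using integral_M(2)[OF borel_measurable_continuous_onI[OF assms(1)]] by blast
qed

text \<open>The directional derivative of exp(-\<eta>) f is exp(-\<eta>) times the integrand, and
  its Lebesgue integral vanishes.\<close>

lemma drifted_integration_by_parts:
  assumes deriv: "\<And>x. (f has_derivative (\<lambda>v. v \<bullet> g x)) (at x)"
    and cont: "continuous_on UNIV g"
    and K: "compact K" "K \<subseteq> \<Omega>" "\<And>x. x \<notin> K \<Longrightarrow> f x = 0"
  shows "(\<integral>x. b \<bullet> g x - f x * (b \<bullet> d\<eta> x) \<partial>M) = 0"
proof -
  let ?g = "\<lambda>x. exp (- \<eta> x) *\<^sub>R (g x - f x *\<^sub>R d\<eta> x)"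
  have contf: "continuous_on UNIV f"
    using deriv by (auto simp: continuous_on_eq_continuous_at intro: has_derivative_continuous)
  have contb: "continuous_on UNIV (\<lambda>x. b \<bullet> g x - f x * (b \<bullet> d\<eta> x))"
    by (intro continuous_on_diff continuous_on_mult continuous_on_inner continuous_on_const cont contf d\<eta>_cont)
  have g0: "g x = 0" if "x \<notin> K" for x
    using gradient_outside_support[OF deriv K(1) _ that] K(3) by blast
  have "(\<integral>x. b \<bullet> g x - f x * (b \<bullet> d\<eta> x) \<partial>M) = (\<integral>x. exp (- \<eta> x) * (b \<bullet> g x - f x * (b \<bullet> d\<eta> x)) \<partial>lborel)"
  proof (rule integral_M(1)[OF borel_measurable_continuous_onI[OF contb]])
    show "b \<bullet> g x - f x * (b \<bullet> d\<eta> x) = 0" if "x \<notin> \<Omega>" for x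
    proof -
      have "x \<notin> K" using that K(2) by blast
      then show ?thesis using g0 K(3) by simp
    qed
  qed
  also have "\<dots> = (\<integral>x. b \<bullet> ?g x \<partial>lborel)"
    by (simp add: inner_diff_right)
  also have "\<dots> = 0"
  proof (rule integral_directional_derivative_eq_0)
    show "((\<lambda>x. exp (- \<eta> x) * f x) has_derivative (\<lambda>v. v \<bullet> ?g x)) (at x)" for x
      by (rule derivative_eq_intros deriv \<eta>_deriv refl)+ (simp add: inner_diff_right algebra_simps)
    show "continuous_on UNIV ?g"
      by (intro continuous_on_scaleR continuous_on_exp continuous_on_minus continuous_on_diff
          cont contf d\<eta>_cont \<eta>_cont)
    show "compact K" by fact
    show "exp (- \<eta> x) * f x = 0" if "x \<notin> K" for x using K(3)[OF that] by simp
  qed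
  finally show ?thesis .
qed

lemma grad_\<eta>: "grad \<eta> x = d\<eta> x"
  by (rule has_derivative_imp_grad[OF \<eta>_deriv])

lemma partial_deriv_support:
  assumes "b \<in> Basis"
  shows "closure {x. partial_deriv b \<phi> x \<noteq> 0} \<subseteq> closure {x. \<phi> x \<noteq> 0}"
proof (rule closure_minimal)
  show "{x. partial_deriv b \<phi> x \<noteq> 0} \<subseteq> closure {x. \<phi> x \<noteq> 0}"
    using grad_outside_support[of _ \<phi>] by (force simp: partial_deriv_eq_grad[OF assms])
qed simp

lemma test_function_partial_deriv:
  assumes "test_function \<Omega> \<phi>" "b \<in> Basis"
  shows "test_function \<Omega> (partial_deriv b \<phi>)"
proof -
  have sub: "closure {x. partial_deriv b \<phi> x \<noteq> 0} \<subseteq> closure {x. \<phi> x \<noteq> 0}"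
    by (rule partial_deriv_support[OF assms(2)])
  have "compact (closure {x. \<phi> x \<noteq> 0} \<inter> closure {x. partial_deriv b \<phi> x \<noteq> 0})"
    using assms by (intro compact_Int_closed) (auto simp: test_function_def)
  moreover have "closure {x. \<phi> x \<noteq> 0} \<inter> closure {x. partial_deriv b \<phi> x \<noteq> 0} = closure {x. partial_deriv b \<phi> x \<noteq> 0}"
    using sub by blast
  moreover have "C_k k (partial_deriv b \<phi>)" for k
    using assms unfolding test_function_def by (metis C_k.simps(2))
  ultimately show ?thesis
    using assms sub unfolding test_function_def by auto
qed

text \<open>Makes the drifted Laplacian of a test function a fixed L^2 factor when the other factor
  runs through an approximating sequence.\<close>

lemma drifted_laplacian_square_integrable:
  assumes \<phi>: "test_function \<Omega> \<phi>"
  shows "square_integrable M (drifted_laplacian \<eta> \<phi>)"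
proof (rule square_integrable_M_compact_support[OF _ test_function_support(1,2)[OF \<phi>]])
  have "continuous_on UNIV (laplacian \<phi>)"
    unfolding laplacian_def[abs_def]
    by (intro continuous_on_sum test_function_continuous[of \<Omega>] test_function_partial_deriv \<phi>)
  then show "continuous_on UNIV (drifted_laplacian \<eta> \<phi>)"
    unfolding drifted_laplacian_def[abs_def] grad_\<eta>
    by (intro continuous_on_diff continuous_on_inner d\<eta>_cont test_function_grad_continuous[OF \<phi>])
  fix x assume x: "x \<notin> closure {x. \<phi> x \<noteq> 0}"
  have "partial_deriv b (partial_deriv b \<phi>) x = 0" if b: "b \<in> Basis" for b
  proof -
    have "closure {x. partial_deriv b \<phi> x \<noteq> 0} \<subseteq> closure {x. \<phi> x \<noteq> 0}"
      by (rule partial_deriv_support[OF b])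
    then have "grad (partial_deriv b \<phi>) x = 0" using x by (intro grad_outside_support) auto
    then show ?thesis by (simp add: partial_deriv_eq_grad[OF b, of "partial_deriv b \<phi>"])
  qed
  then show "drifted_laplacian \<eta> \<phi> x = 0"
    using test_function_support(4)[OF \<phi> x] by (simp add: drifted_laplacian_def laplacian_def)
qed

text \<open>Divergence theorem for the field \<psi> grad \<phi>, applied to one coordinate at a time
  and summed.\<close>

lemma green_test_functions:
  assumes \<psi>: "test_function \<Omega> \<psi>" and \<phi>: "test_function \<Omega> \<phi>"
  shows "(\<integral>x. \<psi> x * drifted_laplacian \<eta> \<phi> x \<partial>M) = - l2_energy M (jet \<psi>) (jet \<phi>)"
proof -
  let ?p = "\<lambda>b. partial_deriv b \<phi>"
  let ?g = "\<lambda>b x. \<psi> x *\<^sub>R grad (?p b) x + ?p b x *\<^sub>R grad \<psi> x"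
  let ?f = "\<lambda>b x. b \<bullet> ?g b x - (\<psi> x * ?p b x) * (b \<bullet> d\<eta> x)"
  have p: "test_function \<Omega> (?p b)" if "b \<in> Basis" for b
    by (rule test_function_partial_deriv[OF \<phi> that])
  have contg: "continuous_on UNIV (?g b)" if "b \<in> Basis" for b
    by (intro continuous_on_add continuous_on_scaleR test_function_continuous[OF \<psi>]
        test_function_continuous[OF p[OF that]] test_function_grad_continuous[OF \<psi>]
        test_function_grad_continuous[OF p[OF that]])
  have int: "integrable M (?f b)" if "b \<in> Basis" for b
  proof (rule integrable_M_compact_support[OF _ test_function_support(1,2)[OF \<psi>]])
    show "continuous_on UNIV (?f b)"
      by (intro continuous_on_diff continuous_on_mult continuous_on_inner continuous_on_const
          contg[OF that] d\<eta>_cont test_function_continuous[OF \<psi>] test_function_continuous[OF p[OF that]])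
    show "?f b x = 0" if "x \<notin> closure {x. \<psi> x \<noteq> 0}" for x
      using test_function_support(3,4)[OF \<psi> that] by simp
  qed
  have zero: "(\<integral>x. ?f b x \<partial>M) = 0" if "b \<in> Basis" for b
  proof (rule drifted_integration_by_parts[OF _ contg[OF that] test_function_support(1,2)[OF \<psi>]])
    show "((\<lambda>x. \<psi> x * ?p b x) has_derivative (\<lambda>v. v \<bullet> ?g b x)) (at x)" for x
      using has_derivative_mult[OF test_function_has_derivative[OF \<psi>] test_function_has_derivative[OF p[OF that]], of x]
      by (simp add: inner_add_right mult.commute)
    show "\<psi> x * ?p b x = 0" if "x \<notin> closure {x. \<psi> x \<noteq> 0}" for x
      using test_function_support(3)[OF \<psi> that] by simp
  qed
  \<comment> \<open>The summands of \<open>?f\<close> are coordinate parts of the weighted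
    divergence of \<psi> grad \<phi>: second derivatives give the Laplacian, the drift parts
    complete it to \<open>drifted_laplacian\<close>.\<close>
  have pt: "(\<Sum>b\<in>Basis. ?f b x) = \<psi> x * drifted_laplacian \<eta> \<phi> x + grad \<psi> x \<bullet> grad \<phi> x" for x
  proof -
    have a: "(\<Sum>b\<in>Basis. b \<bullet> grad (?p b) x) = laplacian \<phi> x"
      unfolding laplacian_def
      by (intro sum.cong refl) (simp add: partial_deriv_eq_grad[of _ "?p _"] inner_commute)
    have b: "(\<Sum>b\<in>Basis. ?p b x * (b \<bullet> v)) = grad \<phi> x \<bullet> v" for v
      by (subst euclidean_inner) (intro sum.cong refl, simp add: partial_deriv_eq_grad inner_commute)
    have "(\<Sum>b\<in>Basis. ?f b x) = \<psi> x * (\<Sum>b\<in>Basis. b \<bullet> grad (?p b) x)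
        + (\<Sum>b\<in>Basis. ?p b x * (b \<bullet> grad \<psi> x)) - \<psi> x * (\<Sum>b\<in>Basis. ?p b x * (b \<bullet> d\<eta> x))"
      by (simp add: inner_add_right sum.distrib sum_subtractf sum_distrib_left mult.assoc)
    also have "\<dots> = \<psi> x * laplacian \<phi> x + grad \<phi> x \<bullet> grad \<psi> x - \<psi> x * (grad \<phi> x \<bullet> d\<eta> x)"
      by (simp only: a b)
    finally show ?thesis
      by (simp add: drifted_laplacian_def grad_\<eta> inner_commute algebra_simps)
  qed
  have "(\<integral>x. \<psi> x * drifted_laplacian \<eta> \<phi> x + grad \<psi> x \<bullet> grad \<phi> x \<partial>M) = (\<integral>x. (\<Sum>b\<in>Basis. ?f b x) \<partial>M)"
    unfolding pt ..
  also have "\<dots> = (\<Sum>b\<in>Basis. \<integral>x. ?f b x \<partial>M)" by (rule Bochner_Integration.integral_sum) (rule int)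
  also have "\<dots> = 0" using zero by (intro sum.neutral) auto
  finally have "(\<integral>x. \<psi> x * drifted_laplacian \<eta> \<phi> x + grad \<psi> x \<bullet> grad \<phi> x \<partial>M) = 0" .
  moreover have "integrable M (\<lambda>x. grad \<psi> x \<bullet> grad \<phi> x)"
    using integrable_inner_square_integrable[OF square_integrable_snd[OF jet_square_integrable[OF \<psi>]]
        square_integrable_snd[OF jet_square_integrable[OF \<phi>]]] by (simp add: jet_def)
  moreover have "integrable M (\<lambda>x. \<psi> x * drifted_laplacian \<eta> \<phi> x)"
    using integrable_inner_square_integrable[OF square_integrable_fst[OF jet_square_integrable[OF \<psi>]]
        drifted_laplacian_square_integrable[OF \<phi>]] by (simp add: jet_def)
  ultimately show ?thesis by (simp add: l2_energy_def l2_inner_def jet_def)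
qed

text \<open>Both sides are L^2-continuous in \<open>F\<close>. The left side sees only the function
  component, so the energy against a test jet does not depend on the chosen gradient.\<close>

lemma green_sobolev:
  assumes F: "sobolev F" and \<phi>: "test_function \<Omega> \<phi>"
  shows "(\<integral>x. fst (F x) * drifted_laplacian \<eta> \<phi> x \<partial>M) = - l2_energy M F (jet \<phi>)"
proof -
  note sq = sobolev_square_integrable[OF F] drifted_laplacian_square_integrable[OF \<phi>]
    jet_square_integrable[OF \<phi>]
  have "l2_inner M (\<lambda>x. fst (F x)) (drifted_laplacian \<eta> \<phi>) = - l2_energy M F (jet \<phi>)"
  proof (rule sobolev_induct_eq[OF F, where P="\<lambda>F. l2_inner M (\<lambda>x. fst (F x)) (drifted_laplacian \<eta> \<phi>)"
        and Q="\<lambda>F. - l2_energy M F (jet \<phi>)"])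
    show "l2_inner M (\<lambda>x. fst (jet \<psi> x)) (drifted_laplacian \<eta> \<phi>) = - l2_energy M (jet \<psi>) (jet \<phi>)"
      if "test_function \<Omega> \<psi>" for \<psi>
      using green_test_functions[OF that \<phi>] by (simp add: l2_inner_def jet_def)
  next
    fix G assume G: "\<And>k. square_integrable M (G k)" "l2_tendsto M G F"
    show "(\<lambda>k. l2_inner M (\<lambda>x. fst (G k x)) (drifted_laplacian \<eta> \<phi>))
        \<longlonglongrightarrow> l2_inner M (\<lambda>x. fst (F x)) (drifted_laplacian \<eta> \<phi>)"
      by (intro l2_tendsto_inner l2_tendsto_fst l2_tendsto_const square_integrable_fst G sq)
    show "(\<lambda>k. - l2_energy M (G k) (jet \<phi>)) \<longlonglongrightarrow> - l2_energy M F (jet \<phi>)"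
      by (intro tendsto_minus l2_energy_tendsto l2_tendsto_const G sq)
  qed
  then show ?thesis by (simp add: l2_inner_def)
qed

text \<open>The squared L^2 distance of pairs is the sum of the squared distances of the components,
  so the two limits in \<open>H10\<close> are one limit of jets.\<close>

lemma H10_iff_sobolev: "u \<in> H10 \<eta> \<Omega> \<longleftrightarrow> (\<exists>F. sobolev F \<and> (\<lambda>x. fst (F x)) = u)"
proof
  assume "u \<in> H10 \<eta> \<Omega>"
  then obtain G \<phi> where u: "square_integrable M u" and G: "square_integrable M G"
    and \<phi>: "\<And>k. test_function \<Omega> (\<phi> k)"
    and lim: "(\<lambda>k. \<integral>x. (u x - \<phi> k x)\<^sup>2 \<partial>M) \<longlonglongrightarrow> 0"
      "(\<lambda>k. \<integral>x. (norm (G x - grad (\<phi> k) x))\<^sup>2 \<partial>M) \<longlonglongrightarrow> 0"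
    unfolding H10_def by blast
  let ?F = "\<lambda>x. (u x, G x)"
  have F: "square_integrable M ?F" by (intro square_integrable_Pair u G)
  have "(l2_norm M (\<lambda>x. jet (\<phi> k) x - ?F x))\<^sup>2
      = (\<integral>x. (u x - \<phi> k x)\<^sup>2 \<partial>M) + (\<integral>x. (norm (G x - grad (\<phi> k) x))\<^sup>2 \<partial>M)" for k
  proof -
    have d: "square_integrable M (\<lambda>x. jet (\<phi> k) x - ?F x)"
      by (intro square_integrable_diff F jet_square_integrable \<phi>)
    show ?thesis
      unfolding l2_norm_power2 l2_inner_jets[OF d d]
      unfolding l2_value_def l2_energy_def l2_inner_self
      by (simp add: jet_def norm_minus_commute power2_commute)
  qed
  then have "(\<lambda>k. (l2_norm M (\<lambda>x. jet (\<phi> k) x - ?F x))\<^sup>2) \<longlonglongrightarrow> 0"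
    using tendsto_add[OF lim] by simp
  then have "l2_tendsto M (\<lambda>k. jet (\<phi> k)) ?F"
    by (simp add: l2_tendsto_iff_integral l2_norm_power2 l2_inner_self)
  then have "sobolev ?F" unfolding sobolev_def using F \<phi> by blast
  then show "\<exists>F. sobolev F \<and> (\<lambda>x. fst (F x)) = u" by (intro exI[of _ ?F]) auto
next
  assume "\<exists>F. sobolev F \<and> (\<lambda>x. fst (F x)) = u"
  then obtain F where F: "sobolev F" and u: "(\<lambda>x. fst (F x)) = u" by blast
  then obtain \<phi> where \<phi>: "\<And>k. test_function \<Omega> (\<phi> k)" "l2_tendsto M (\<lambda>k. jet (\<phi> k)) F"
    by (auto simp: sobolev_def)
  have sq: "square_integrable M F" "\<And>k. square_integrable M (jet (\<phi> k))"
    using F \<phi> by (auto intro: sobolev_square_integrable jet_square_integrable)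
  have "(\<lambda>k. \<integral>x. (u x - \<phi> k x)\<^sup>2 \<partial>M) \<longlonglongrightarrow> 0"
    using l2_tendsto_fst[OF \<phi>(2) sq(2,1)]
    unfolding l2_tendsto_iff_integral u[symmetric] jet_def by (simp add: power2_commute)
  moreover have "(\<lambda>k. \<integral>x. (norm (snd (F x) - grad (\<phi> k) x))\<^sup>2 \<partial>M) \<longlonglongrightarrow> 0"
    using l2_tendsto_snd[OF \<phi>(2) sq(2,1)]
    unfolding l2_tendsto_iff_integral jet_def by (simp add: norm_minus_commute)
  ultimately show "u \<in> H10 \<eta> \<Omega>"
    unfolding H10_def using \<phi>(1) square_integrable_fst[OF sq(1)] square_integrable_snd[OF sq(1)] u
    by (intro CollectI conjI exI[of _ "\<lambda>x. snd (F x)"] exI[of _ \<phi>]) auto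
qed

text \<open>Green's formula turns the distributional equation into the weak one for test functions;
  density extends the latter to all of H^1_0.\<close>

lemma weak_eq_iff_eigenjet:
  assumes F: "sobolev F"
  shows "weak_drifted_laplacian_eq \<eta> \<Omega> (\<lambda>x. fst (F x)) (\<lambda>x. - s * fst (F x)) \<longleftrightarrow> eigenjet F s"
proof -
  note sqF = sobolev_square_integrable[OF F]
  have "weak_drifted_laplacian_eq \<eta> \<Omega> (\<lambda>x. fst (F x)) (\<lambda>x. - s * fst (F x))
      \<longleftrightarrow> (\<forall>\<phi>. test_function \<Omega> \<phi> \<longrightarrow> l2_energy M F (jet \<phi>) = s * l2_value M F (jet \<phi>))"
  proof -
    have "(\<integral>x. - s * fst (F x) * \<phi> x \<partial>M) = - (s * l2_value M F (jet \<phi>))" for \<phi>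
      by (simp add: l2_value_def l2_inner_def jet_def mult.assoc)
    then show ?thesis
      unfolding weak_drifted_laplacian_eq_def using green_sobolev[OF F] by auto
  qed
  also have "\<dots> \<longleftrightarrow> eigenjet F s"
  proof
    assume eq: "\<forall>\<phi>. test_function \<Omega> \<phi> \<longrightarrow> l2_energy M F (jet \<phi>) = s * l2_value M F (jet \<phi>)"
    have "l2_energy M F H = s * l2_value M F H" if H: "sobolev H" for H
    proof (rule sobolev_induct_eq[OF H, where P="\<lambda>H. l2_energy M F H" and Q="\<lambda>H. s * l2_value M F H"])
      fix G assume G: "\<And>k. square_integrable M (G k)" "l2_tendsto M G H"
      show "(\<lambda>k. l2_energy M F (G k)) \<longlonglongrightarrow> l2_energy M F H"
        by (intro l2_energy_tendsto l2_tendsto_const G sqF sobolev_square_integrable[OF H])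
      show "(\<lambda>k. s * l2_value M F (G k)) \<longlonglongrightarrow> s * l2_value M F H"
        by (intro tendsto_mult_left l2_value_tendsto l2_tendsto_const G sqF sobolev_square_integrable[OF H])
    qed (use eq in blast)
    then show "eigenjet F s" using F by (simp add: eigenjet_def)
  next
    assume "eigenjet F s"
    then show "\<forall>\<phi>. test_function \<Omega> \<phi> \<longrightarrow> l2_energy M F (jet \<phi>) = s * l2_value M F (jet \<phi>)"
      using sobolev_jet unfolding eigenjet_def by blast
  qed
  finally show ?thesis .
qed

lemma dirichlet_eigenspace_iff_eigenjet:
  "u \<in> dirichlet_eigenspace \<eta> \<Omega> s \<longleftrightarrow> (\<exists>F. eigenjet F s \<and> (\<lambda>x. fst (F x)) = u)"
proof -
  have "u \<in> dirichlet_eigenspace \<eta> \<Omega> s \<longleftrightarrow>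
    (\<exists>F. sobolev F \<and> (\<lambda>x. fst (F x)) = u \<and>
      weak_drifted_laplacian_eq \<eta> \<Omega> (\<lambda>x. fst (F x)) (\<lambda>x. - s * fst (F x)))"
    unfolding dirichlet_eigenspace_def mem_Collect_eq H10_iff_sobolev by (auto simp: fun_eq_iff[symmetric])
  then show ?thesis using weak_eq_iff_eigenjet by (metis eigenjet_def)
qed

section \<open>Comparison of the listed eigenvalues with the Rayleigh minima\<close>

section \<open>Counting eigenvalues\<close>

text \<open>The usual dimension count modulo null sets: more than m members expanded in m functions
  have a nontrivial combination vanishing almost everywhere, against orthonormality.\<close>

lemma orthonormal_card_le_multiplicity:
  assumes mult: "has_multiplicity \<eta> \<Omega> s m"
    and U: "\<And>i. i \<in> J \<Longrightarrow> eigenjet (U i) s"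
    and ortho: "\<And>i j. i \<in> J \<Longrightarrow> j \<in> J \<Longrightarrow> l2_value M (U i) (U j) = (if i = j then 1 else 0)"
    and "finite J"
  shows "card J \<le> m"
proof (rule ccontr)
  assume "\<not> card J \<le> m"
  then have less: "m < card J" by simp
  obtain u where u: "\<And>v. v \<in> dirichlet_eigenspace \<eta> \<Omega> s \<Longrightarrow>
      \<exists>c. AE x in M. v x = (\<Sum>k<m. c k * u k x)"
    using mult unfolding has_multiplicity_def by blast
  have "\<exists>c. AE x in M. fst (U i x) = (\<Sum>k<m. c k * u k x)" if "i \<in> J" for i
    using u[of "\<lambda>x. fst (U i x)"] U[OF that] dirichlet_eigenspace_iff_eigenjet by blast
  then obtain c where c: "\<And>i. i \<in> J \<Longrightarrow> AE x in M. fst (U i x) = (\<Sum>k<m. c i k * u k x)"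
    by metis
  obtain d i0 where i0: "i0 \<in> J" "d i0 \<noteq> 0" and d: "\<And>k. k < m \<Longrightarrow> (\<Sum>i\<in>J. d i * c i k) = 0"
    using homogeneous_system_solution[OF \<open>finite J\<close> less, of c] by blast
  have sq: "square_integrable M (U i)" if "i \<in> J" for i
    using U[OF that] by (auto simp: eigenjet_def intro: sobolev_square_integrable)
  let ?W = "\<lambda>x. \<Sum>i\<in>J. d i *\<^sub>R U i x"
  have "AE x in M. \<forall>i\<in>J. fst (U i x) = (\<Sum>k<m. c i k * u k x)"
    using c \<open>finite J\<close> by (simp add: AE_ball_countable uncountable_def countable_finite)
  then have AE0: "AE x in M. fst (?W x) = 0"
  proof eventually_elim
    case (elim x)
    have "fst (?W x) = (\<Sum>i\<in>J. d i * fst (U i x))" by (simp add: fst_sum)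
    also have "\<dots> = (\<Sum>i\<in>J. \<Sum>k<m. d i * c i k * u k x)"
      using elim by (intro sum.cong) (auto simp: sum_distrib_left mult.assoc)
    also have "\<dots> = (\<Sum>k<m. (\<Sum>i\<in>J. d i * c i k) * u k x)"
      by (subst sum.swap) (simp add: sum_distrib_right)
    also have "\<dots> = 0" using d by (intro sum.neutral) auto
    finally show ?case .
  qed
  have "l2_value M ?W (U i0) = 0"
  proof -
    have "l2_value M ?W (U i0) = (\<integral>x. 0 \<partial>M)"
      unfolding l2_value_def l2_inner_def
    proof (rule integral_cong_AE)
      show "AE x in M. fst (?W x) \<bullet> fst (U i0 x) = 0" using AE0 by eventually_elim simp
      have "square_integrable M ?W" using sq by (intro square_integrable_sum square_integrable_scaleR)
      then show "(\<lambda>x. fst (?W x) \<bullet> fst (U i0 x)) \<in> borel_measurable M"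
        using integrable_inner_square_integrable[OF square_integrable_fst square_integrable_fst[OF sq[OF i0(1)]]]
        by (intro borel_measurable_integrable) blast
    qed simp
    then show ?thesis by simp
  qed
  moreover have "l2_value M ?W (U i0) = (\<Sum>i\<in>J. d i * l2_value M (U i) (U i0))"
    using sq i0 by (intro l2_value_sum_left) auto
  moreover have "\<dots> = (\<Sum>i\<in>J. if i = i0 then d i else 0)"
    using ortho i0 by (intro sum.cong) auto
  ultimately show False using i0 \<open>finite J\<close> by (simp add: sum.delta)
qed

text \<open>The multiplicity of \<sigma> i is a cardinality, and \<open>card\<close> is 0 on
  infinite sets. Divergence of \<sigma> makes the index set finite, and it contains
  \<open>i\<close>, so a basis function \<open>u 0\<close> exists.\<close>

lemma dirichlet_eigenvalue_eigenjet:
  assumes \<sigma>: "dirichlet_eigenvalues \<eta> \<Omega> \<sigma>" and i: "1 \<le> i"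
  obtains F where "eigenjet F (\<sigma> i)" "0 < l2_value M F F"
proof -
  let ?S = "{j. 1 \<le> j \<and> \<sigma> j = \<sigma> i}"
  have "filterlim \<sigma> at_top sequentially" using \<sigma> by (simp add: dirichlet_eigenvalues_def)
  then have "\<forall>\<^sub>F j in sequentially. \<sigma> i < \<sigma> j" by (simp add: filterlim_at_top_dense)
  then obtain N where N: "\<And>j. N \<le> j \<Longrightarrow> \<sigma> i < \<sigma> j" by (auto simp: eventually_sequentially)
  have "?S \<subseteq> {..N}"
  proof
    fix j assume "j \<in> ?S"
    then show "j \<in> {..N}" using N[of j] by (cases "N \<le> j") auto
  qed
  then have "finite ?S" by (rule finite_subset) simp
  moreover have "i \<in> ?S" using i by simp
  ultimately have pos: "0 < card ?S" by (metis card_gt_0_iff empty_iff)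
  have "has_multiplicity \<eta> \<Omega> (\<sigma> i) (card ?S)" using \<sigma> by (simp add: dirichlet_eigenvalues_def)
  then obtain u where u: "\<And>k. k < card ?S \<Longrightarrow> u k \<in> dirichlet_eigenspace \<eta> \<Omega> (\<sigma> i)"
    and ind: "\<And>c. AE x in M. (\<Sum>k<card ?S. c k * u k x) = 0 \<Longrightarrow> \<forall>k<card ?S. c k = 0"
    unfolding has_multiplicity_def by blast
  obtain F where F: "eigenjet F (\<sigma> i)" "(\<lambda>x. fst (F x)) = u 0"
    using u[OF pos] dirichlet_eigenspace_iff_eigenjet by blast
  have sq: "square_integrable M (\<lambda>x. fst (F x))"
    using F(1) by (auto simp: eigenjet_def intro: square_integrable_fst sobolev_square_integrable)
  have "l2_value M F F \<noteq> 0"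
  proof
    assume "l2_value M F F = 0"
    then have "AE x in M. fst (F x) = 0"
      using l2_inner_self_eq_0[OF sq] by (simp add: l2_value_def)
    \<comment> \<open>A null \<open>u 0\<close> would be a linear relation with coefficient 1 at
      index 0.\<close>
    then have "AE x in M. (\<Sum>k<card ?S. (if k = 0 then 1 else 0) * u k x) = 0"
    proof eventually_elim
      case (elim x)
      have "u 0 x = 0" using elim F(2) by (metis (no_types))
      then show ?case by (intro sum.neutral) auto
    qed
    from ind[OF this] pos show False by auto
  qed
  then have "0 < l2_value M F F" using l2_value_nonneg[of M F] by simp
  with F(1) show ?thesis using that by blast
qed

text \<open>Provides the competitors demanded by \<open>minimiser_sequence\<close>.\<close>

lemma dirichlet_eigenvalues_unbounded:
  assumes \<sigma>: "dirichlet_eigenvalues \<eta> \<Omega> \<sigma>"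
  shows "\<exists>t>s. \<exists>G. eigenjet G t \<and> 0 < l2_value M G G"
proof -
  have "filterlim \<sigma> at_top sequentially" using \<sigma> by (simp add: dirichlet_eigenvalues_def)
  then have "\<forall>\<^sub>F j in sequentially. s < \<sigma> j" by (simp add: filterlim_at_top_dense)
  then obtain N where "\<And>j. N \<le> j \<Longrightarrow> s < \<sigma> j" by (auto simp: eventually_sequentially)
  then have "s < \<sigma> (Suc N)" by simp
  moreover obtain G where "eigenjet G (\<sigma> (Suc N))" "0 < l2_value M G G"
    using dirichlet_eigenvalue_eigenjet[OF \<sigma>, of "Suc N"] by auto
  ultimately show ?thesis by blast
qed

text \<open>Pigeonhole. If \<mu> j were below \<sigma> (Suc j), values up to \<mu> j would occur in
  \<sigma> at the indices 1 to j only, while \<open>U 0\<close> to \<open>U j\<close> are j + 1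
  orthonormal eigenjets with such values. The shift in index arises because the minimisers start at
  0 and the eigenvalues at 1.\<close>

lemma dirichlet_eigenvalue_le:
  assumes \<sigma>: "dirichlet_eigenvalues \<eta> \<Omega> \<sigma>"
    and eig: "\<And>i. eigenjet (U i) (\<mu> i)"
    and ortho: "\<And>i j. l2_value M (U i) (U j) = (if i = j then 1 else 0)"
    and mono: "\<And>i. i \<le> j \<Longrightarrow> \<mu> i \<le> \<mu> j"
  shows "\<sigma> (Suc j) \<le> \<mu> j"
proof (rule ccontr)
  assume "\<not> \<sigma> (Suc j) \<le> \<mu> j"
  then have less: "\<mu> j < \<sigma> (Suc j)" by simp
  have mono\<sigma>: "mono_on {1..} \<sigma>" using \<sigma> by (simp add: dirichlet_eigenvalues_def)
  have fibre: "{i. 1 \<le> i \<and> \<sigma> i = s} = {i\<in>{1..j}. \<sigma> i = s}" if "s \<le> \<mu> j" for s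
  proof -
    have "i \<le> j" if "1 \<le> i" "\<sigma> i = s" for i
    proof (rule ccontr)
      assume "\<not> i \<le> j"
      then have "\<sigma> (Suc j) \<le> \<sigma> i" using that by (intro mono_onD[OF mono\<sigma>]) auto
      then show False using less that \<open>s \<le> \<mu> j\<close> by simp
    qed
    then show ?thesis by auto
  qed
  have le: "card {i\<in>{..j}. \<mu> i = s} \<le> card {i\<in>{1..j}. \<sigma> i = s}" if "s \<in> \<mu> ` {..j}" for s
  proof -
    have "s \<le> \<mu> j" using that mono by auto
    have "has_multiplicity \<eta> \<Omega> s (card {i. 1 \<le> i \<and> \<sigma> i = s})"
      using \<sigma> by (simp add: dirichlet_eigenvalues_def)
    then show ?thesis
      unfolding fibre[OF \<open>s \<le> \<mu> j\<close>]
      by (rule orthonormal_card_le_multiplicity[where U=U]) (use eig ortho in auto)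
  qed
  \<comment> \<open>The indices are grouped by eigenvalue, since multiplicities are compared for one
    value at a time.\<close>
  have "Suc j = card {..j}" by simp
  also have "{..j} = (\<Union>s\<in>\<mu> ` {..j}. {i\<in>{..j}. \<mu> i = s})" by auto
  also have "card \<dots> = (\<Sum>s\<in>\<mu> ` {..j}. card {i\<in>{..j}. \<mu> i = s})"
    by (rule card_UN_disjoint) auto
  also have "\<dots> \<le> (\<Sum>s\<in>\<mu> ` {..j}. card {i\<in>{1..j}. \<sigma> i = s})"
    by (rule sum_mono) (rule le)
  also have "\<dots> = card (\<Union>s\<in>\<mu> ` {..j}. {i\<in>{1..j}. \<sigma> i = s})"
    by (rule card_UN_disjoint[symmetric]) auto
  also have "\<dots> \<le> card {1..j}" by (rule card_mono) auto
  finally show False by simp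
qed

end

section \<open>Coordinate trial functions and the resulting estimate\<close>

section \<open>Trial functions\<close>

text \<open>A QR decomposition: the matrix of all e j . A i is made triangular. Later
  \<open>A i\<close> holds the moments of x u against the i-th minimiser, so the vanishing entries
  are orthogonality relations.\<close>

lemma orthonormal_basis_triangular:
  fixes A :: "nat \<Rightarrow> 'a::euclidean_space"
  obtains e :: "nat \<Rightarrow> 'a"
  where "\<And>i j. i \<in> {1..DIM('a)} \<Longrightarrow> j \<in> {1..DIM('a)} \<Longrightarrow> e i \<bullet> e j = (if i = j then 1 else 0)"
    "\<And>i j. 1 \<le> i \<Longrightarrow> i < j \<Longrightarrow> j \<le> DIM('a) \<Longrightarrow> e j \<bullet> A i = 0"
proof -
  let ?n = "DIM('a)"
  \<comment> \<open>The guard \<open>m < ?n\<close> makes the condition void past the dimension, so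
    the choice can run over all naturals.\<close>
  define P where "P f m r \<longleftrightarrow> (m < ?n \<longrightarrow> norm r = 1 \<and> (\<forall>k<m. f k \<bullet> r = 0) \<and> (\<forall>i\<in>{1..<?n - m}. r \<bullet> A i = 0))"
    for f m and r :: 'a
  \<comment> \<open>The vectors are chosen from the last to the first: each has to be orthogonal to the later
    ones and to the earlier \<open>A i\<close>, which is always \<open>DIM('a) - 1\<close> conditions.\<close>
  have "\<exists>f. \<forall>m. P f m (f m)"
  proof (rule dependent_wellorder_choice)
    fix r and f g :: "nat \<Rightarrow> 'a" and x :: nat
    assume "\<And>y. y < x \<Longrightarrow> f y = g y"
    then show "P f x r = P g x r" by (simp add: P_def)
  next
    fix m :: nat and f :: "nat \<Rightarrow> 'a"
    show "\<exists>r. P f m r"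
    proof (cases "m < ?n")
      case True
      let ?S = "f ` {..<m} \<union> A ` {1..<?n - m}"
      have "card ?S \<le> card (f ` {..<m}) + card (A ` {1..<?n - m})" by (rule card_Un_le)
      also have "\<dots> \<le> card {..<m} + card {1..<?n - m}" by (intro add_mono card_image_le) auto
      also have "\<dots> < ?n" using True by simp
      finally have "dim ?S < ?n" using dim_le_card'[of ?S] by simp
      then obtain x where x: "x \<noteq> 0" "\<And>y. y \<in> span ?S \<Longrightarrow> orthogonal x y"
        using orthogonal_to_subspace_exists by blast
      have xS: "x \<bullet> y = 0" if "y \<in> ?S" for y
        using x(2)[OF span_base[OF that]] by (simp add: orthogonal_def)
      have "f k \<bullet> x = 0" if "k < m" for k using xS[of "f k"] that by (simp add: inner_commute)
      moreover have "x \<bullet> A i = 0" if "i \<in> {1..<?n - m}" for i using xS[of "A i"] that by blast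
      ultimately have "P f m (x /\<^sub>R norm x)" using x(1) by (simp add: P_def)
      then show ?thesis ..
    qed (simp add: P_def)
  qed
  then obtain f where f: "\<And>m. P f m (f m)" by blast
  show ?thesis
  \<comment> \<open>The order is reversed: stage m yields vector number ?n - m, which must be
    orthogonal to \<open>A i\<close> for 1 \<le> i < ?n - m.\<close>
  proof (rule that[of "\<lambda>j. f (?n - j)"])
    fix i j assume ij: "i \<in> {1..?n}" "j \<in> {1..?n}"
    have orth: "f k \<bullet> f m = 0" if "k < m" "m < ?n" for k m using f[of m] that by (simp add: P_def)
    consider "i < j" | "i = j" | "j < i" by linarith
    then show "f (?n - i) \<bullet> f (?n - j) = (if i = j then 1 else 0)"
    proof cases
      case 1
      then have "f (?n - j) \<bullet> f (?n - i) = 0" using ij by (intro orth) auto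
      then show ?thesis using 1 by (simp add: inner_commute)
    next
      case 2
      have "norm (f (?n - j)) = 1" using f[of "?n - j"] ij by (auto simp: P_def)
      then show ?thesis using 2 by (simp add: norm_eq_1)
    next
      case 3
      then have "f (?n - i) \<bullet> f (?n - j) = 0" using ij by (intro orth) auto
      then show ?thesis using 3 by simp
    qed
  next
    fix i j :: nat assume ij: "1 \<le> i" "i < j" "j \<le> ?n"
    then show "f (?n - j) \<bullet> A i = 0" using f[of "?n - j"] by (auto simp: P_def)
  qed
qed

text \<open>Parseval: as many orthonormal vectors as the dimension span the space, so the remainder
  \<open>w\<close> is orthogonal to itself.\<close>

lemma sum_inner_orthonormal_basis:
  fixes e :: "nat \<Rightarrow> 'a::euclidean_space"
  assumes "\<And>i j. i \<in> {1..DIM('a)} \<Longrightarrow> j \<in> {1..DIM('a)} \<Longrightarrow> e i \<bullet> e j = (if i = j then 1 else 0)"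
  shows "(\<Sum>j=1..DIM('a). (e j \<bullet> v)\<^sup>2) = (norm v)\<^sup>2"
proof -
  let ?I = "{1..DIM('a)}" and ?B = "e ` {1..DIM('a)}"
  have inj: "inj_on e ?I"
    by (rule inj_onI) (metis assms zero_neq_one)
  have ne: "0 \<notin> ?B"
  proof
    assume "0 \<in> ?B"
    then obtain i where i: "i \<in> ?I" "e i = 0" by auto
    then show False using assms[OF i(1) i(1)] by simp
  qed
  have orth: "pairwise orthogonal ?B"
    using assms by (auto simp: pairwise_def orthogonal_def)
  have "independent ?B" using orth ne by (rule pairwise_orthogonal_independent)
  then have span: "span ?B = UNIV"
    using card_image[OF inj] by (intro dim_eq_full[THEN iffD1]) (simp add: dim_eq_card_independent)
  define w where "w = v - (\<Sum>j\<in>?I. (e j \<bullet> v) *\<^sub>R e j)"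
  have we: "w \<bullet> e i = 0" if "i \<in> ?I" for i
  proof -
    have "(\<Sum>j\<in>?I. (e j \<bullet> v) * (e j \<bullet> e i)) = (\<Sum>j\<in>?I. if j = i then e j \<bullet> v else 0)"
      using assms that by (intro sum.cong) auto
    also have "\<dots> = e i \<bullet> v" using that by simp
    finally have "(\<Sum>j\<in>?I. (e j \<bullet> v) * (e j \<bullet> e i)) = v \<bullet> e i" by (simp add: inner_commute)
    then show ?thesis by (simp only: w_def inner_diff_left inner_sum_left inner_scaleR_left)
  qed
  have "w \<bullet> y = 0" if "y \<in> span ?B" for y
    by (rule orthogonal_to_span[OF that, of w, unfolded orthogonal_def]) (use we in blast)
  then have "w = 0" using span by (metis UNIV_I inner_eq_zero_iff)
  then have v: "v = (\<Sum>j\<in>?I. (e j \<bullet> v) *\<^sub>R e j)" by (simp add: w_def)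
  have "(norm v)\<^sup>2 = v \<bullet> v" by (simp add: power2_norm_eq_inner)
  also have "\<dots> = (\<Sum>j\<in>?I. (e j \<bullet> v) *\<^sub>R e j) \<bullet> v" using v by simp
  also have "\<dots> = (\<Sum>j\<in>?I. (e j \<bullet> v)\<^sup>2)" by (simp add: inner_sum_left power2_eq_square)
  finally show ?thesis by simp
qed

text \<open>The Leibniz rule as an operation on pairs: it turns the jet of u into that of h
  u.\<close>

definition jet_mult :: "('a::euclidean_space \<Rightarrow> real) \<Rightarrow> ('a \<Rightarrow> real \<times> 'a) \<Rightarrow> 'a \<Rightarrow> real \<times> 'a" where
  "jet_mult h F x = (h x * fst (F x), h x *\<^sub>R snd (F x) + fst (F x) *\<^sub>R grad h x)"

context drifted_domain
begin

text \<open>The reason why multiplication by coordinates and by \<open>d\<eta>\<close> preserves L^2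
  on the bounded domain.\<close>

lemma continuous_bounded_on_\<Omega>:
  fixes v :: "'a \<Rightarrow> 'b::real_normed_vector"
  assumes "continuous_on UNIV v"
  obtains C where "0 \<le> C" "\<And>x. x \<in> \<Omega> \<Longrightarrow> norm (v x) \<le> C"
proof -
  have "compact (closure \<Omega>)" using bounded_\<Omega> by (simp add: compact_closure)
  then have "bounded (v ` closure \<Omega>)"
    by (intro compact_imp_bounded compact_continuous_image continuous_on_subset[OF assms]) auto
  then obtain B where B: "\<And>x. x \<in> closure \<Omega> \<Longrightarrow> norm (v x) \<le> B" by (auto simp: bounded_iff)
  have "norm (v x) \<le> \<bar>B\<bar>" if "x \<in> \<Omega>" for x
    using B[of x] closure_subset[of \<Omega>] that by fastforce
  then show ?thesis using that[of "\<bar>B\<bar>"] by simp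
qed

lemma square_integrable_mult:
  fixes f :: "'a \<Rightarrow> 'b::euclidean_space"
  assumes w: "continuous_on UNIV (w :: 'a \<Rightarrow> real)" and f: "square_integrable M f"
  shows "square_integrable M (\<lambda>x. w x *\<^sub>R f x)"
proof -
  obtain C where C: "\<And>x. x \<in> \<Omega> \<Longrightarrow> norm (w x) \<le> C" using continuous_bounded_on_\<Omega>[OF w] by metis
  have [measurable]: "w \<in> borel_measurable M" "f \<in> borel_measurable M"
    using borel_measurable_M[OF borel_measurable_continuous_onI[OF w]] f by (auto simp: square_integrable_def)
  show ?thesis
  proof (rule square_integrable_dominated[OF f])
    show "norm (w x *\<^sub>R f x) \<le> C * norm (f x)" if "x \<in> space M" for x
      using C[of x] that by (simp add: space_M mult_right_mono)
  qed measurable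
qed

lemma square_integrable_mult_vector:
  fixes v :: "'a \<Rightarrow> 'b::euclidean_space"
  assumes v: "continuous_on UNIV v" and f: "square_integrable M f"
  shows "square_integrable M (\<lambda>x. f x *\<^sub>R v x)"
proof -
  obtain C where C: "\<And>x. x \<in> \<Omega> \<Longrightarrow> norm (v x) \<le> C" using continuous_bounded_on_\<Omega>[OF v] by metis
  have [measurable]: "v \<in> borel_measurable M" "f \<in> borel_measurable M"
    using borel_measurable_M[OF borel_measurable_continuous_onI[OF v]] f by (auto simp: square_integrable_def)
  show ?thesis
  proof (rule square_integrable_dominated[OF f])
    show "norm (f x *\<^sub>R v x) \<le> C * norm (f x)" if "x \<in> space M" for x
      using C[of x] that mult_left_mono[of "norm (v x)" C "\<bar>f x\<bar>"] by (simp add: space_M mult.commute)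
  qed measurable
qed

lemma square_integrable_inner_const:
  assumes f: "square_integrable M f"
  shows "square_integrable M (\<lambda>x. e \<bullet> f x)"
proof (rule square_integrable_dominated[OF f])
  show "(\<lambda>x. e \<bullet> f x) \<in> borel_measurable M" using square_integrable_measurable[OF f] by simp
  show "norm (e \<bullet> f x) \<le> norm e * norm (f x)" for x using Cauchy_Schwarz_ineq2[of e "f x"] by simp
qed

lemma l2_tendsto_mult:
  fixes f :: "'a \<Rightarrow> 'b::euclidean_space"
  assumes w: "continuous_on UNIV (w :: 'a \<Rightarrow> real)" and lim: "l2_tendsto M F f"
    and sq: "\<And>k. square_integrable M (F k)" "square_integrable M f"
  shows "l2_tendsto M (\<lambda>k x. w x *\<^sub>R F k x) (\<lambda>x. w x *\<^sub>R f x)"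
proof -
  obtain C where C: "\<And>x. x \<in> \<Omega> \<Longrightarrow> norm (w x) \<le> C" using continuous_bounded_on_\<Omega>[OF w] by metis
  show ?thesis
  proof (rule l2_tendsto_dominated[OF lim sq])
    show "norm (w x *\<^sub>R F k x - w x *\<^sub>R f x) \<le> C * norm (F k x - f x)" if "x \<in> space M" for k x
      using C[of x] that
      by (simp add: space_M mult_right_mono flip: scaleR_right_diff_distrib)
  qed (intro square_integrable_measurable square_integrable_mult w sq)+
qed

lemma C_k_continuous: "(\<And>k. C_k k h) \<Longrightarrow> continuous_on UNIV h"
  by (metis C_k.simps(1))

lemma square_integrable_jet_mult:
  assumes h: "\<And>k. C_k k h" and F: "square_integrable M F"
  shows "square_integrable M (jet_mult h F)"
  unfolding jet_mult_def[abs_def]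
  using square_integrable_mult[OF C_k_continuous[OF h] square_integrable_fst[OF F]]
  by (intro square_integrable_Pair square_integrable_add square_integrable_mult square_integrable_mult_vector
      C_k_continuous C_k_grad_continuous h square_integrable_snd square_integrable_fst F) simp

text \<open>\<open>jet_mult h\<close> sends jets of test functions to jets of test functions and is
  Lipschitz in L^2, with constant 2C + D from bounds C for h and D for its gradient.\<close>

lemma sobolev_jet_mult:
  assumes h: "\<And>k. C_k k h" and F: "sobolev F"
  shows "sobolev (jet_mult h F)"
proof -
  obtain \<phi> where \<phi>: "\<And>k. test_function \<Omega> (\<phi> k)" "l2_tendsto M (\<lambda>k. jet (\<phi> k)) F"
    using F by (auto simp: sobolev_def)
  note sqF = sobolev_square_integrable[OF F] and sq\<phi> = jet_square_integrable[OF \<phi>(1)]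
  have hd: "h differentiable (at x)" for x using h[of 1] by simp
  have jet: "jet (\<lambda>x. h x * \<phi> k x) = jet_mult h (jet (\<phi> k))" for k
    using grad_mult[OF hd test_function_differentiable[OF \<phi>(1)]]
    by (simp add: jet_def jet_mult_def fun_eq_iff)
  obtain C where C: "0 \<le> C" "\<And>x. x \<in> \<Omega> \<Longrightarrow> norm (h x) \<le> C"
    using continuous_bounded_on_\<Omega>[OF C_k_continuous[OF h]] by metis
  obtain D where D: "0 \<le> D" "\<And>x. x \<in> \<Omega> \<Longrightarrow> norm (grad h x) \<le> D"
    using continuous_bounded_on_\<Omega>[OF C_k_grad_continuous[OF h]] by metis
  have "l2_tendsto M (\<lambda>k. jet_mult h (jet (\<phi> k))) (jet_mult h F)"
  proof (rule l2_tendsto_dominated[OF \<phi>(2) sq\<phi> sqF, where C="2 * C + D"])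
    fix k x assume "x \<in> space M"
    then have x: "x \<in> \<Omega>" by (simp add: space_M)
    let ?p = "\<phi> k x - fst (F x)" and ?q = "grad (\<phi> k) x - snd (F x)"
    have "jet_mult h (jet (\<phi> k)) x - jet_mult h F x = (h x * ?p, h x *\<^sub>R ?q + ?p *\<^sub>R grad h x)"
      by (simp add: jet_mult_def jet_def algebra_simps)
    also have "norm \<dots> \<le> norm (h x * ?p) + norm (h x *\<^sub>R ?q + ?p *\<^sub>R grad h x)"
      unfolding norm_Pair by (rule sqrt_sum_squares_le_sum) auto
    also have "\<dots> \<le> \<bar>h x\<bar> * \<bar>?p\<bar> + (\<bar>h x\<bar> * norm ?q + \<bar>?p\<bar> * norm (grad h x))"
      using norm_triangle_ineq[of "h x *\<^sub>R ?q" "?p *\<^sub>R grad h x"] by (simp add: abs_mult)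
    also have "\<dots> \<le> C * norm (?p, ?q) + (C * norm (?p, ?q) + norm (?p, ?q) * D)"
      using C(2)[OF x] D(2)[OF x] C(1) D(1) norm_fst_le[of ?p ?q] norm_snd_le[of ?q ?p]
      by (intro add_mono mult_mono) auto
    also have "\<dots> = (2 * C + D) * norm (jet (\<phi> k) x - F x)"
      by (cases "F x") (simp add: jet_def algebra_simps)
    finally show "norm (jet_mult h (jet (\<phi> k)) x - jet_mult h F x) \<le> (2 * C + D) * norm (jet (\<phi> k) x - F x)" .
  qed (intro square_integrable_measurable square_integrable_jet_mult h sqF sq\<phi>)+
  moreover have "square_integrable M (jet_mult h F)" by (rule square_integrable_jet_mult[OF h sqF])
  moreover have "test_function \<Omega> (\<lambda>x. h x * \<phi> k x)" for k by (rule test_function_mult[OF \<phi>(1) h])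
  ultimately show ?thesis
    unfolding sobolev_def using jet by (intro conjI exI[of _ "\<lambda>k x. h x * \<phi> k x"]) auto
qed

text \<open>The divergence theorem for h u^2 in direction \<open>e\<close>, extended by density. It
  is used twice: h = x . e - a gives the pairing -1 with the commutator field, and h = x . b summed
  over the basis relates int u (x . grad u) to int |x|^2 u^2.\<close>

lemma weight_identity:
  assumes h: "\<And>k. C_k k h" and F: "sobolev F"
  shows "l2_inner M (\<lambda>x. (e \<bullet> grad h x) *\<^sub>R fst (F x)) (\<lambda>x. fst (F x))
    + 2 * l2_inner M (\<lambda>x. h x *\<^sub>R fst (F x)) (\<lambda>x. e \<bullet> snd (F x))
    = l2_inner M (\<lambda>x. (h x * (e \<bullet> d\<eta> x)) *\<^sub>R fst (F x)) (\<lambda>x. fst (F x))"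
proof (rule sobolev_induct_eq[OF F, where
      P="\<lambda>F. l2_inner M (\<lambda>x. (e \<bullet> grad h x) *\<^sub>R fst (F x)) (\<lambda>x. fst (F x))
        + 2 * l2_inner M (\<lambda>x. h x *\<^sub>R fst (F x)) (\<lambda>x. e \<bullet> snd (F x))"
      and Q="\<lambda>F. l2_inner M (\<lambda>x. (h x * (e \<bullet> d\<eta> x)) *\<^sub>R fst (F x)) (\<lambda>x. fst (F x))"])
  have ch: "continuous_on UNIV h" by (rule C_k_continuous[OF h])
  have cg: "continuous_on UNIV (\<lambda>x. e \<bullet> grad h x)"
    by (intro continuous_on_inner continuous_on_const C_k_grad_continuous h)
  have ce: "continuous_on UNIV (\<lambda>x. h x * (e \<bullet> d\<eta> x))"
    by (intro continuous_on_mult ch continuous_on_inner continuous_on_const d\<eta>_cont)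
  {
    fix \<phi> assume \<phi>: "test_function \<Omega> \<phi>"
    note cont = test_function_continuous[OF \<phi>] test_function_grad_continuous[OF \<phi>]
    note supp = test_function_support[OF \<phi>]
    let ?g = "\<lambda>x. (\<phi> x * \<phi> x) *\<^sub>R grad h x + (2 * h x * \<phi> x) *\<^sub>R grad \<phi> x"
    have d: "((\<lambda>x. h x * (\<phi> x * \<phi> x)) has_derivative (\<lambda>v. v \<bullet> ?g x)) (at x)" for x
    proof -
      have "(h has_derivative (\<lambda>v. v \<bullet> grad h x)) (at x)"
        using h[of 1] by (intro differentiable_has_derivative_grad) simp
      from has_derivative_mult[OF this has_derivative_mult[OF test_function_has_derivative[OF \<phi>]
            test_function_has_derivative[OF \<phi>]]]
      show ?thesis by (simp add: inner_add_right algebra_simps)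
    qed
    have cgg: "continuous_on UNIV ?g"
      by (intro continuous_on_add continuous_on_scaleR continuous_on_mult continuous_on_const
          cont ch C_k_grad_continuous h)
    have "(\<integral>x. e \<bullet> ?g x - h x * (\<phi> x * \<phi> x) * (e \<bullet> d\<eta> x) \<partial>M) = 0"
      by (rule drifted_integration_by_parts[OF d cgg supp(1,2)]) (drule supp(3), simp)
    moreover have "(\<integral>x. e \<bullet> ?g x - h x * (\<phi> x * \<phi> x) * (e \<bullet> d\<eta> x) \<partial>M)
        = (\<integral>x. ((e \<bullet> grad h x) *\<^sub>R \<phi> x) \<bullet> \<phi> x + 2 * ((h x *\<^sub>R \<phi> x) \<bullet> (e \<bullet> grad \<phi> x))
          - ((h x * (e \<bullet> d\<eta> x)) *\<^sub>R \<phi> x) \<bullet> \<phi> x \<partial>M)"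
      by (intro Bochner_Integration.integral_cong refl) (simp add: inner_add_right algebra_simps)
    moreover have "integrable M (\<lambda>x. ((e \<bullet> grad h x) *\<^sub>R \<phi> x) \<bullet> \<phi> x)"
      by (rule integrable_M_compact_support[OF _ supp(1,2)])
        (intro continuous_on_inner continuous_on_scaleR cont cg, drule supp(3), simp)
    moreover have "integrable M (\<lambda>x. (h x *\<^sub>R \<phi> x) \<bullet> (e \<bullet> grad \<phi> x))"
      by (rule integrable_M_compact_support[OF _ supp(1,2)])
        (intro continuous_on_inner continuous_on_scaleR continuous_on_const cont ch, drule supp(3), simp)
    moreover have "integrable M (\<lambda>x. ((h x * (e \<bullet> d\<eta> x)) *\<^sub>R \<phi> x) \<bullet> \<phi> x)"
      by (rule integrable_M_compact_support[OF _ supp(1,2)])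
        (intro continuous_on_inner continuous_on_scaleR cont ce, drule supp(3), simp)
    ultimately show "l2_inner M (\<lambda>x. (e \<bullet> grad h x) *\<^sub>R fst (jet \<phi> x)) (\<lambda>x. fst (jet \<phi> x))
        + 2 * l2_inner M (\<lambda>x. h x *\<^sub>R fst (jet \<phi> x)) (\<lambda>x. e \<bullet> snd (jet \<phi> x))
        = l2_inner M (\<lambda>x. (h x * (e \<bullet> d\<eta> x)) *\<^sub>R fst (jet \<phi> x)) (\<lambda>x. fst (jet \<phi> x))"
      unfolding l2_inner_def jet_def fst_conv snd_conv by simp
  }
  fix G assume G: "\<And>k. square_integrable M (G k)" "l2_tendsto M G F"
  note sqF = sobolev_square_integrable[OF F]
  note fst = l2_tendsto_fst[OF G(2,1) sqF] square_integrable_fst[OF G(1)] square_integrable_fst[OF sqF]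
  note snd = l2_tendsto_snd[OF G(2,1) sqF] square_integrable_snd[OF G(1)] square_integrable_snd[OF sqF]
  have lime: "l2_tendsto M (\<lambda>k x. e \<bullet> snd (G k x)) (\<lambda>x. e \<bullet> snd (F x))"
  proof (rule l2_tendsto_dominated[OF snd])
    show "norm (e \<bullet> snd (G k x) - e \<bullet> snd (F x)) \<le> norm e * norm (snd (G k x) - snd (F x))" for k x
      unfolding inner_diff_right[symmetric] real_norm_def by (rule Cauchy_Schwarz_ineq2)
  qed (intro square_integrable_measurable square_integrable_inner_const snd)+
  show "(\<lambda>k. l2_inner M (\<lambda>x. (e \<bullet> grad h x) *\<^sub>R fst (G k x)) (\<lambda>x. fst (G k x))
        + 2 * l2_inner M (\<lambda>x. h x *\<^sub>R fst (G k x)) (\<lambda>x. e \<bullet> snd (G k x)))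
    \<longlonglongrightarrow> l2_inner M (\<lambda>x. (e \<bullet> grad h x) *\<^sub>R fst (F x)) (\<lambda>x. fst (F x))
        + 2 * l2_inner M (\<lambda>x. h x *\<^sub>R fst (F x)) (\<lambda>x. e \<bullet> snd (F x))"
    by (intro tendsto_add tendsto_mult_left l2_tendsto_inner l2_tendsto_mult square_integrable_mult
        fst lime square_integrable_inner_const snd cg ch)
  show "(\<lambda>k. l2_inner M (\<lambda>x. (h x * (e \<bullet> d\<eta> x)) *\<^sub>R fst (G k x)) (\<lambda>x. fst (G k x)))
    \<longlonglongrightarrow> l2_inner M (\<lambda>x. (h x * (e \<bullet> d\<eta> x)) *\<^sub>R fst (F x)) (\<lambda>x. fst (F x))"
    by (intro l2_tendsto_inner l2_tendsto_mult square_integrable_mult fst ce)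
qed

end

context drifted_domain
begin

lemma C_k_affine: "C_k k (\<lambda>x. x \<bullet> e - a)"
  using C_k_add[OF C_k_inner C_k_const, of k e "- a"] by simp

lemma grad_affine: "grad (\<lambda>x. x \<bullet> e - a) x = e"
  by (rule has_derivative_imp_grad) (rule derivative_eq_intros refl | simp)+

text \<open>For h = x . e - a there is the pointwise identity |grad(h u)|^2 - grad u . grad(h^2 u) =
  |e|^2 u^2. Testing the eigenvalue equation with h^2 u, which is \<open>w (w F)\<close>, evaluates
  the second term without further integration by parts.\<close>

lemma energy_trial_function:
  fixes e :: 'a and a :: real
  defines "w \<equiv> jet_mult (\<lambda>x. x \<bullet> e - a)"
  assumes F: "eigenjet F s"
  shows "l2_energy M (w F) (w F) = s * l2_value M (w F) (w F) + (e \<bullet> e) * l2_value M F F"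
proof -
  have sF: "sobolev F" using F by (simp add: eigenjet_def)
  have sw: "sobolev (w F)" "sobolev (w (w F))"
    unfolding w_def by (intro sobolev_jet_mult C_k_affine sF)+
  note sq = sobolev_square_integrable[OF sF] sobolev_square_integrable[OF sw(1)] sobolev_square_integrable[OF sw(2)]
  have "l2_energy M (w F) (w F) - l2_energy M F (w (w F)) = (e \<bullet> e) * l2_value M F F"
  proof -
    have "l2_energy M (w F) (w F) - l2_energy M F (w (w F))
        = (\<integral>x. snd (w F x) \<bullet> snd (w F x) - snd (F x) \<bullet> snd (w (w F) x) \<partial>M)"
      unfolding l2_energy_def l2_inner_def
      by (intro Bochner_Integration.integral_diff[symmetric] integrable_inner_square_integrable
          square_integrable_snd sq)
    also have "\<dots> = (\<integral>x. (e \<bullet> e) * (fst (F x) \<bullet> fst (F x)) \<partial>M)"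
      by (intro Bochner_Integration.integral_cong refl)
         (simp add: w_def jet_mult_def grad_affine inner_add_left inner_add_right inner_commute algebra_simps)
    finally show ?thesis by (simp add: l2_value_def l2_inner_def)
  qed
  moreover have "l2_energy M F (w (w F)) = s * l2_value M F (w (w F))"
    using F sw unfolding eigenjet_def by blast
  moreover have "l2_value M F (w (w F)) = l2_value M (w F) (w F)"
    unfolding l2_value_def l2_inner_def
    by (intro Bochner_Integration.integral_cong refl) (simp add: w_def jet_mult_def algebra_simps)
  ultimately show ?thesis by simp
qed

text \<open>The upper bound for (\<mu> - s) int w^2 and the lower bound from Cauchy-Schwarz are
  combined by multiplication rather than division, so the trial function need not be shown to be
  nonzero first.\<close>

lemma trial_function_inequality:
  fixes e :: 'a and a :: real
  defines "w \<equiv> jet_mult (\<lambda>x. x \<bullet> e - a)"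
  assumes F: "eigenjet F s" "l2_value M F F = 1" and e: "norm e = 1" and "s \<le> \<mu>"
    and rayleigh: "\<mu> * l2_value M (w F) (w F) \<le> l2_energy M (w F) (w F)"
  shows "\<mu> - s \<le> (\<integral>x. (e \<bullet> (2 *\<^sub>R snd (F x) - fst (F x) *\<^sub>R d\<eta> x))\<^sup>2 \<partial>M)"
proof -
  have sF: "sobolev F" using F by (simp add: eigenjet_def)
  note sqF = sobolev_square_integrable[OF sF]
  have ee: "e \<bullet> e = 1" using e by (simp add: norm_eq_1)
  let ?h = "\<lambda>x. x \<bullet> e - a" and ?Y = "\<lambda>x. 2 *\<^sub>R snd (F x) - fst (F x) *\<^sub>R d\<eta> x"
  have ch: "continuous_on UNIV ?h" by (rule C_k_continuous) (rule C_k_affine)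
  have sqY: "square_integrable M (\<lambda>x. e \<bullet> ?Y x)"
    by (intro square_integrable_inner_const square_integrable_diff square_integrable_scaleR
        square_integrable_mult_vector d\<eta>_cont square_integrable_fst square_integrable_snd sqF)
  have sqh: "square_integrable M (\<lambda>x. ?h x *\<^sub>R fst (F x))"
    by (intro square_integrable_mult ch square_integrable_fst sqF)
  have sqd: "square_integrable M (\<lambda>x. e \<bullet> (fst (F x) *\<^sub>R d\<eta> x))"
    by (intro square_integrable_inner_const square_integrable_mult_vector d\<eta>_cont square_integrable_fst sqF)
  have sqG: "square_integrable M (\<lambda>x. e \<bullet> snd (F x))"
    by (intro square_integrable_inner_const square_integrable_snd sqF)
  have "l2_inner M (\<lambda>x. ?h x *\<^sub>R fst (F x)) (\<lambda>x. e \<bullet> ?Y x) = - 1"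
  proof -
    have "1 + 2 * l2_inner M (\<lambda>x. ?h x *\<^sub>R fst (F x)) (\<lambda>x. e \<bullet> snd (F x))
      = l2_inner M (\<lambda>x. (?h x * (e \<bullet> d\<eta> x)) *\<^sub>R fst (F x)) (\<lambda>x. fst (F x))"
      using weight_identity[of "\<lambda>x. x \<bullet> e - a" F e, OF C_k_affine sF] F(2)
      by (simp add: grad_affine ee l2_value_def)
    also have "\<dots> = l2_inner M (\<lambda>x. ?h x *\<^sub>R fst (F x)) (\<lambda>x. e \<bullet> (fst (F x) *\<^sub>R d\<eta> x))"
      unfolding l2_inner_def
      by (intro Bochner_Integration.integral_cong refl) (simp add: algebra_simps)
    finally have "1 + 2 * l2_inner M (\<lambda>x. ?h x *\<^sub>R fst (F x)) (\<lambda>x. e \<bullet> snd (F x))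
      = l2_inner M (\<lambda>x. ?h x *\<^sub>R fst (F x)) (\<lambda>x. e \<bullet> (fst (F x) *\<^sub>R d\<eta> x))" .
    moreover have "l2_inner M (\<lambda>x. ?h x *\<^sub>R fst (F x)) (\<lambda>x. e \<bullet> ?Y x)
      = 2 * l2_inner M (\<lambda>x. ?h x *\<^sub>R fst (F x)) (\<lambda>x. e \<bullet> snd (F x))
        - l2_inner M (\<lambda>x. ?h x *\<^sub>R fst (F x)) (\<lambda>x. e \<bullet> (fst (F x) *\<^sub>R d\<eta> x))"
    proof -
      have "l2_inner M (\<lambda>x. 2 *\<^sub>R (e \<bullet> snd (F x)) - e \<bullet> (fst (F x) *\<^sub>R d\<eta> x)) (\<lambda>x. ?h x *\<^sub>R fst (F x))
        = l2_inner M (\<lambda>x. 2 *\<^sub>R (e \<bullet> snd (F x))) (\<lambda>x. ?h x *\<^sub>R fst (F x))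
          - l2_inner M (\<lambda>x. e \<bullet> (fst (F x) *\<^sub>R d\<eta> x)) (\<lambda>x. ?h x *\<^sub>R fst (F x))"
        by (intro l2_inner_diff_left square_integrable_scaleR sqG sqd sqh)
      then show ?thesis
        unfolding l2_inner_scaleR_left
          l2_inner_commute[of M "\<lambda>x. ?h x *\<^sub>R fst (F x)" "\<lambda>x. e \<bullet> ?Y x"]
          l2_inner_commute[of M "\<lambda>x. ?h x *\<^sub>R fst (F x)" "\<lambda>x. e \<bullet> snd (F x)"]
          l2_inner_commute[of M "\<lambda>x. ?h x *\<^sub>R fst (F x)" "\<lambda>x. e \<bullet> (fst (F x) *\<^sub>R d\<eta> x)"]
        by (simp add: inner_diff_right)
    qed
    ultimately show ?thesis by simp
  qed
  with l2_Cauchy_Schwarz_square[OF sqh sqY]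
  have cs: "1 \<le> l2_value M (w F) (w F) * (\<integral>x. (e \<bullet> ?Y x)\<^sup>2 \<partial>M)"
    by (simp add: l2_value_def w_def jet_mult_def l2_inner_self[of M "\<lambda>x. e \<bullet> ?Y x"])
  have "(\<mu> - s) * l2_value M (w F) (w F) \<le> 1"
    using rayleigh energy_trial_function[OF F(1), of e a] F(2) ee by (simp add: w_def algebra_simps)
  then have "(\<mu> - s) * l2_value M (w F) (w F) * (\<integral>x. (e \<bullet> ?Y x)\<^sup>2 \<partial>M) \<le> 1 * (\<integral>x. (e \<bullet> ?Y x)\<^sup>2 \<partial>M)"
    by (rule mult_right_mono) simp
  \<comment> \<open>Here \<open>s \<le> \<mu>\<close> is needed to keep the direction of
    \<open>cs\<close>.\<close>
  moreover have "(\<mu> - s) * 1 \<le> (\<mu> - s) * (l2_value M (w F) (w F) * (\<integral>x. (e \<bullet> ?Y x)\<^sup>2 \<partial>M))"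
    using \<open>s \<le> \<mu>\<close> by (intro mult_left_mono cs) simp
  ultimately show ?thesis by (simp add: mult.assoc)
qed

text \<open>The pairing is linear in the direction \<open>e\<close> and the shift \<open>a\<close>;
  the sum over \<open>Basis\<close> is the vector int x u v. Orthogonality thus becomes a linear
  condition on \<open>e\<close> and \<open>a\<close>.\<close>

lemma value_trial_function:
  assumes F: "square_integrable M F" and G: "square_integrable M G"
  shows "l2_value M (jet_mult (\<lambda>x. x \<bullet> e - a) F) G
    = e \<bullet> (\<Sum>b\<in>Basis. l2_inner M (\<lambda>x. (x \<bullet> b) *\<^sub>R fst (F x)) (\<lambda>x. fst (G x)) *\<^sub>R b) - a * l2_value M F G"
proof -
  have sq: "square_integrable M (\<lambda>x. (x \<bullet> b) *\<^sub>R fst (F x))" for b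
    by (intro square_integrable_mult continuous_on_inner continuous_on_id continuous_on_const square_integrable_fst F)
  have int: "integrable M (\<lambda>x. (e \<bullet> b) * (((x \<bullet> b) *\<^sub>R fst (F x)) \<bullet> fst (G x)))" for b
    by (intro integrable_mult_right integrable_inner_square_integrable sq square_integrable_fst G)
  have int0: "integrable M (\<lambda>x. a * (fst (F x) \<bullet> fst (G x)))"
    by (intro integrable_mult_right integrable_inner_square_integrable square_integrable_fst F G)
  have "l2_value M (jet_mult (\<lambda>x. x \<bullet> e - a) F) G
    = (\<integral>x. (\<Sum>b\<in>Basis. (e \<bullet> b) * (((x \<bullet> b) *\<^sub>R fst (F x)) \<bullet> fst (G x))) - a * (fst (F x) \<bullet> fst (G x)) \<partial>M)"
    unfolding l2_value_def l2_inner_def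
  proof (intro Bochner_Integration.integral_cong refl)
    fix x
    have "x \<bullet> e = (\<Sum>b\<in>Basis. (e \<bullet> b) * (x \<bullet> b))"
      by (subst euclidean_inner) (simp add: mult.commute)
    then show "fst (jet_mult (\<lambda>x. x \<bullet> e - a) F x) \<bullet> fst (G x)
      = (\<Sum>b\<in>Basis. (e \<bullet> b) * (((x \<bullet> b) *\<^sub>R fst (F x)) \<bullet> fst (G x))) - a * (fst (F x) \<bullet> fst (G x))"
      by (simp add: jet_mult_def left_diff_distrib sum_distrib_right mult.assoc)
  qed
  also have "\<dots> = (\<integral>x. (\<Sum>b\<in>Basis. (e \<bullet> b) * (((x \<bullet> b) *\<^sub>R fst (F x)) \<bullet> fst (G x))) \<partial>M)
      - (\<integral>x. a * (fst (F x) \<bullet> fst (G x)) \<partial>M)"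
    by (intro Bochner_Integration.integral_diff Bochner_Integration.integrable_sum int int0)
  also have "(\<integral>x. (\<Sum>b\<in>Basis. (e \<bullet> b) * (((x \<bullet> b) *\<^sub>R fst (F x)) \<bullet> fst (G x))) \<partial>M)
      = (\<Sum>b\<in>Basis. \<integral>x. (e \<bullet> b) * (((x \<bullet> b) *\<^sub>R fst (F x)) \<bullet> fst (G x)) \<partial>M)"
    by (rule Bochner_Integration.integral_sum) (rule int)
  finally show ?thesis
    by (simp add: l2_value_def l2_inner_def inner_sum_right mult.commute)
qed

text \<open>Holds for every drift of the locale. Basis vector number j is paired with minimiser
  number j, starting at 1, because \<open>U 0\<close> serves as the base function.\<close>

theorem trial_functions_inequality:
  assumes U: "\<And>j. eigenjet (U j) (\<mu> j)"
    and ortho: "\<And>i j. l2_value M (U i) (U j) = (if i = j then 1 else 0)"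
    and rayleigh: "\<And>j G. sobolev G \<Longrightarrow> (\<And>i. i < j \<Longrightarrow> l2_value M (U i) G = 0) \<Longrightarrow>
      \<mu> j * l2_value M G G \<le> l2_energy M G G"
    and mono: "\<And>i j. i \<le> j \<Longrightarrow> \<mu> i \<le> \<mu> j"
  shows "(\<Sum>j=1..DIM('a). \<mu> j - \<mu> 0)
    \<le> (\<integral>x. (norm (2 *\<^sub>R snd (U 0 x) - fst (U 0 x) *\<^sub>R d\<eta> x))\<^sup>2 \<partial>M)"
proof -
  let ?Y = "\<lambda>x. 2 *\<^sub>R snd (U 0 x) - fst (U 0 x) *\<^sub>R d\<eta> x"
  have sob: "sobolev (U j)" for j using U by (simp add: eigenjet_def)
  note sq = sobolev_square_integrable[OF sob]
  define A where "A i = (\<Sum>b\<in>Basis. l2_inner M (\<lambda>x. (x \<bullet> b) *\<^sub>R fst (U 0 x)) (\<lambda>x. fst (U i x)) *\<^sub>R b)" for i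
  obtain e :: "nat \<Rightarrow> 'a" where
    e: "\<And>i j. i \<in> {1..DIM('a)} \<Longrightarrow> j \<in> {1..DIM('a)} \<Longrightarrow> e i \<bullet> e j = (if i = j then 1 else 0)"
    and eA: "\<And>i j. 1 \<le> i \<Longrightarrow> i < j \<Longrightarrow> j \<le> DIM('a) \<Longrightarrow> e j \<bullet> A i = 0"
    using orthonormal_basis_triangular by blast
  have sqY: "square_integrable M (\<lambda>x. e j \<bullet> ?Y x)" for j
    by (intro square_integrable_inner_const square_integrable_diff square_integrable_scaleR
        square_integrable_mult_vector d\<eta>_cont square_integrable_fst square_integrable_snd sq)
  have "\<mu> j - \<mu> 0 \<le> (\<integral>x. (e j \<bullet> ?Y x)\<^sup>2 \<partial>M)" if j: "j \<in> {1..DIM('a)}" for j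
  proof (rule trial_function_inequality[OF U, where a="e j \<bullet> A 0"])
    let ?w = "jet_mult (\<lambda>x. x \<bullet> e j - e j \<bullet> A 0) (U 0)"
    \<comment> \<open>For i = 0 the shift cancels \<open>e j \<bullet> A 0\<close>, as
      \<open>U 0\<close> is normalised. For 1 \<le> i < j the shift contributes nothing, as
      \<open>U 0\<close> is orthogonal to \<open>U i\<close>, and triangularity does the
      rest.\<close>
    have "l2_value M ?w (U i) = 0" if "i < j" for i
      using value_trial_function[OF sq sq, of "e j" "e j \<bullet> A 0" 0 i, folded A_def] ortho[of 0 i] eA[of i j] j that
      by (cases "i = 0") auto
    then show "\<mu> j * l2_value M ?w ?w \<le> l2_energy M ?w ?w"
      by (intro rayleigh sobolev_jet_mult C_k_affine sob) (simp add: l2_value_commute[of M "U _" ?w])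
    show "norm (e j) = 1" using e[OF j j] by (simp add: norm_eq_1)
  qed (use ortho mono in auto)
  then have "(\<Sum>j=1..DIM('a). \<mu> j - \<mu> 0) \<le> (\<Sum>j=1..DIM('a). \<integral>x. (e j \<bullet> ?Y x)\<^sup>2 \<partial>M)"
    by (rule sum_mono)
  also have "\<dots> = (\<integral>x. (\<Sum>j=1..DIM('a). (e j \<bullet> ?Y x)\<^sup>2) \<partial>M)"
    using sqY by (intro Bochner_Integration.integral_sum[symmetric]) (simp add: square_integrable_def)
  also have "\<dots> = (\<integral>x. (norm (?Y x))\<^sup>2 \<partial>M)"
    using sum_inner_orthonormal_basis[OF e] by simp
  finally show ?thesis .
qed

text \<open>Expanding the square leaves 4 s - 4 lam Z + lam^2 X. The mixed term Z is eliminated by a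
  virial identity, which is where the Gaussian form of the drift enters.\<close>

lemma gaussian_trial_energy:
  fixes lam :: real
  assumes gauss: "d\<eta> = (\<lambda>x. lam *\<^sub>R x)" and F: "eigenjet F s" "l2_value M F F = 1"
  shows "(\<integral>x. (norm (2 *\<^sub>R snd (F x) - fst (F x) *\<^sub>R d\<eta> x))\<^sup>2 \<partial>M)
    = 4 * s + 2 * lam * DIM('a) - lam\<^sup>2 * (\<integral>x. (norm x)\<^sup>2 * (fst (F x))\<^sup>2 \<partial>M)"
proof -
  have sF: "sobolev F" using F by (simp add: eigenjet_def)
  note sqF = sobolev_square_integrable[OF sF]
  let ?u = "\<lambda>x. fst (F x)" and ?G = "\<lambda>x. snd (F x)"
  define X where "X = (\<integral>x. (norm x)\<^sup>2 * (?u x)\<^sup>2 \<partial>M)"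
  define Z where "Z = (\<integral>x. ?u x * (x \<bullet> ?G x) \<partial>M)"
  have sqx: "square_integrable M (\<lambda>x. (x \<bullet> b) *\<^sub>R ?u x)" for b
    by (intro square_integrable_mult continuous_on_inner continuous_on_id continuous_on_const square_integrable_fst sqF)
  have squx: "square_integrable M (\<lambda>x. ?u x *\<^sub>R x)"
    by (intro square_integrable_mult_vector continuous_on_id square_integrable_fst sqF)
  have b: "1 + 2 * l2_inner M (\<lambda>x. (x \<bullet> b) *\<^sub>R ?u x) (\<lambda>x. b \<bullet> ?G x)
      = lam * l2_inner M (\<lambda>x. (x \<bullet> b) *\<^sub>R ?u x) (\<lambda>x. (x \<bullet> b) *\<^sub>R ?u x)" if "b \<in> Basis" for b
  proof -
    have "1 + 2 * l2_inner M (\<lambda>x. (x \<bullet> b) *\<^sub>R ?u x) (\<lambda>x. b \<bullet> ?G x)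
      = l2_inner M (\<lambda>x. ((x \<bullet> b) * (b \<bullet> d\<eta> x)) *\<^sub>R ?u x) ?u"
      using weight_identity[of "\<lambda>x. x \<bullet> b" F b, OF C_k_inner sF] F(2) that
      by (simp add: grad_inner inner_Basis l2_value_def)
    also have "\<dots> = (\<integral>x. lam * (((x \<bullet> b) *\<^sub>R ?u x) \<bullet> ((x \<bullet> b) *\<^sub>R ?u x)) \<partial>M)"
      unfolding l2_inner_def gauss
      by (intro Bochner_Integration.integral_cong refl) (simp add: inner_commute[of b] algebra_simps)
    finally show ?thesis by (simp add: l2_inner_def)
  qed
  have sumZ: "(\<Sum>b\<in>Basis. l2_inner M (\<lambda>x. (x \<bullet> b) *\<^sub>R ?u x) (\<lambda>x. b \<bullet> ?G x)) = Z"
  proof -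
    have "(\<Sum>b\<in>Basis. l2_inner M (\<lambda>x. (x \<bullet> b) *\<^sub>R ?u x) (\<lambda>x. b \<bullet> ?G x))
        = (\<integral>x. (\<Sum>b\<in>Basis. ((x \<bullet> b) *\<^sub>R ?u x) \<bullet> (b \<bullet> ?G x)) \<partial>M)"
      unfolding l2_inner_def
      by (intro Bochner_Integration.integral_sum[symmetric] integrable_inner_square_integrable sqx
          square_integrable_inner_const square_integrable_snd sqF)
    also have "\<dots> = Z"
      unfolding Z_def
    proof (intro Bochner_Integration.integral_cong refl)
      fix x
      show "(\<Sum>b\<in>Basis. ((x \<bullet> b) *\<^sub>R ?u x) \<bullet> (b \<bullet> ?G x)) = ?u x * (x \<bullet> ?G x)"
        by (subst euclidean_inner[of x]) (simp add: sum_distrib_left inner_commute[of _ "?G x"] mult_ac)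
    qed
    finally show ?thesis .
  qed
  have sumX: "(\<Sum>b\<in>Basis. l2_inner M (\<lambda>x. (x \<bullet> b) *\<^sub>R ?u x) (\<lambda>x. (x \<bullet> b) *\<^sub>R ?u x)) = X"
  proof -
    have "(\<Sum>b\<in>Basis. l2_inner M (\<lambda>x. (x \<bullet> b) *\<^sub>R ?u x) (\<lambda>x. (x \<bullet> b) *\<^sub>R ?u x))
        = (\<integral>x. (\<Sum>b\<in>Basis. ((x \<bullet> b) *\<^sub>R ?u x) \<bullet> ((x \<bullet> b) *\<^sub>R ?u x)) \<partial>M)"
      unfolding l2_inner_def
      by (intro Bochner_Integration.integral_sum[symmetric] integrable_inner_square_integrable sqx)
    also have "\<dots> = X"
      unfolding X_def
    proof (intro Bochner_Integration.integral_cong refl)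
      fix x
      show "(\<Sum>b\<in>Basis. ((x \<bullet> b) *\<^sub>R ?u x) \<bullet> ((x \<bullet> b) *\<^sub>R ?u x)) = (norm x)\<^sup>2 * (?u x)\<^sup>2"
        unfolding power2_norm_eq_inner euclidean_inner[of x x]
        by (simp add: sum_distrib_left sum_distrib_right power2_eq_square mult_ac)
    qed
    finally show ?thesis .
  qed
  have "(\<Sum>b\<in>(Basis::'a set). 1 + 2 * l2_inner M (\<lambda>x. (x \<bullet> b) *\<^sub>R ?u x) (\<lambda>x. b \<bullet> ?G x))
      = (\<Sum>b\<in>Basis. lam * l2_inner M (\<lambda>x. (x \<bullet> b) *\<^sub>R ?u x) (\<lambda>x. (x \<bullet> b) *\<^sub>R ?u x))"
    by (intro sum.cong refl b)
  \<comment> \<open>Virial identity: \<open>weight_identity\<close> for the coordinate functions,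
    summed; each basis vector contributes 1, hence the dimension.\<close>
  then have XZ: "DIM('a) + 2 * Z = lam * X"
    unfolding sum.distrib sum_distrib_left[symmetric] sumZ sumX by simp
  have "l2_energy M F F = s" using F sF by (simp add: eigenjet_def)
  then have energy: "(\<integral>x. ?G x \<bullet> ?G x \<partial>M) = s" by (simp add: l2_energy_def l2_inner_def)
  have i1: "integrable M (\<lambda>x. ?G x \<bullet> ?G x)"
    by (intro integrable_inner_square_integrable square_integrable_snd sqF)
  have i2: "integrable M (\<lambda>x. ?u x * (x \<bullet> ?G x))"
    using integrable_inner_square_integrable[OF squx square_integrable_snd[OF sqF]] by simp
  have i3: "integrable M (\<lambda>x. (norm x)\<^sup>2 * (?u x)\<^sup>2)"
    using integrable_inner_square_integrable[OF squx squx]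
    by (simp add: power2_norm_eq_inner) (simp add: power2_eq_square mult_ac)
  have "(\<integral>x. (norm (2 *\<^sub>R ?G x - ?u x *\<^sub>R d\<eta> x))\<^sup>2 \<partial>M)
      = (\<integral>x. 4 * (?G x \<bullet> ?G x) - 4 * lam * (?u x * (x \<bullet> ?G x)) + lam\<^sup>2 * ((norm x)\<^sup>2 * (?u x)\<^sup>2) \<partial>M)"
    unfolding gauss power2_norm_eq_inner
    by (intro Bochner_Integration.integral_cong refl)
       (simp add: inner_diff_left inner_diff_right inner_commute power2_eq_square algebra_simps)
  also have "\<dots> = 4 * s - 4 * lam * Z + lam\<^sup>2 * X"
    using i1 i2 i3 energy by (simp add: Z_def X_def)
  also have "4 * lam * Z = 2 * lam * (lam * X - DIM('a))"
    using XZ by (simp flip: XZ)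
  also have "4 * s - 2 * lam * (lam * X - DIM('a)) + lam\<^sup>2 * X = 4 * s + 2 * lam * DIM('a) - lam\<^sup>2 * X"
    by (simp add: power2_eq_square algebra_simps)
  finally show ?thesis unfolding X_def .
qed

text \<open>As \<open>U 0\<close> is normalised, the pointwise lower bound on |x|^2 passes to int
  |x|^2 u^2. The comparisons of \<mu> with \<sigma> are then applied on both sides.\<close>

theorem gaussian_eigenvalue_inequality:
  fixes lam :: real and \<sigma> :: "nat \<Rightarrow> real"
  assumes gauss: "d\<eta> = (\<lambda>x. lam *\<^sub>R x)" and lam: "lam < 0"
    and large: "\<And>x. x \<in> \<Omega> \<Longrightarrow> 2 * DIM('a) / \<bar>lam\<bar> \<le> (norm x)\<^sup>2"
    and \<sigma>: "dirichlet_eigenvalues \<eta> \<Omega> \<sigma>"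
  shows "(\<Sum>i=1..DIM('a). \<sigma> (i + 1) - \<sigma> 1) \<le> 4 * (\<sigma> 1 + lam * DIM('a))"
proof -
  obtain U :: "nat \<Rightarrow> 'a \<Rightarrow> real \<times> 'a" and \<mu> :: "nat \<Rightarrow> real"
    where U: "\<And>j. eigenjet (U j) (\<mu> j)"
      and ortho: "\<And>i j. l2_value M (U i) (U j) = (if i = j then 1 else 0)"
      and rayleigh: "\<And>j G. sobolev G \<Longrightarrow> (\<And>i. i < j \<Longrightarrow> l2_value M (U i) G = 0) \<Longrightarrow>
        \<mu> j * l2_value M G G \<le> l2_energy M G G"
    using minimiser_sequence[OF dirichlet_eigenvalues_unbounded[OF \<sigma>]] by blast
  have sob: "sobolev (U j)" for j using U by (simp add: eigenjet_def)
  \<comment> \<open>\<open>U j\<close> is itself a competitor at every stage i \<le> j.\<close>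
  have mono: "\<mu> i \<le> \<mu> j" if "i \<le> j" for i j
  proof -
    have "\<mu> i * l2_value M (U j) (U j) \<le> l2_energy M (U j) (U j)"
      using that by (intro rayleigh sob) (simp add: ortho)
    also have "\<dots> = \<mu> j * l2_value M (U j) (U j)"
      using U[of j] sob[of j] unfolding eigenjet_def by blast
    finally show ?thesis by (simp add: ortho)
  qed
  have le: "\<sigma> (Suc j) \<le> \<mu> j" for j
    by (rule dirichlet_eigenvalue_le[OF \<sigma> U ortho mono])
  have first: "\<mu> 0 \<le> \<sigma> 1"
  proof -
    obtain F where F: "eigenjet F (\<sigma> 1)" "0 < l2_value M F F"
      using dirichlet_eigenvalue_eigenjet[OF \<sigma>, of 1] by auto
    then have "\<mu> 0 * l2_value M F F \<le> \<sigma> 1 * l2_value M F F"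
      using rayleigh[of F 0] by (simp add: eigenjet_def)
    then show ?thesis using F(2) by simp
  qed
  let ?X = "\<integral>x. (norm x)\<^sup>2 * (fst (U 0 x))\<^sup>2 \<partial>M"
  have sq: "square_integrable M (U 0)" by (rule sobolev_square_integrable[OF sob])
  have "2 * DIM('a) / \<bar>lam\<bar> \<le> ?X"
  proof -
    have sqx: "square_integrable M (\<lambda>x. fst (U 0 x) *\<^sub>R x)"
      by (intro square_integrable_mult_vector continuous_on_id square_integrable_fst sq)
    have "(\<integral>x. 2 * DIM('a) / \<bar>lam\<bar> * (fst (U 0 x))\<^sup>2 \<partial>M) \<le> ?X"
    proof (rule integral_mono)
      show "integrable M (\<lambda>x. (norm x)\<^sup>2 * (fst (U 0 x))\<^sup>2)"
        using sqx by (simp add: square_integrable_def power_mult_distrib mult.commute)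
      show "integrable M (\<lambda>x. 2 * DIM('a) / \<bar>lam\<bar> * (fst (U 0 x))\<^sup>2)"
        using square_integrable_fst[OF sq] by (simp add: square_integrable_def)
      show "2 * DIM('a) / \<bar>lam\<bar> * (fst (U 0 x))\<^sup>2 \<le> (norm x)\<^sup>2 * (fst (U 0 x))\<^sup>2" if "x \<in> space M" for x
        using large[of x] that by (intro mult_right_mono) (auto simp: space_M)
    qed
    moreover have "(\<integral>x. (fst (U 0 x))\<^sup>2 \<partial>M) = 1"
      using ortho[of 0 0] by (simp add: l2_value_def l2_inner_self)
    ultimately show ?thesis by simp
  qed
  then have "lam\<^sup>2 * (2 * DIM('a) / \<bar>lam\<bar>) \<le> lam\<^sup>2 * ?X" by (intro mult_left_mono) auto
  \<comment> \<open>The sign of \<open>lam\<close> resolves the absolute value.\<close>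
  moreover have "lam\<^sup>2 * (2 * DIM('a) / \<bar>lam\<bar>) = - 2 * lam * DIM('a)"
    using lam by (simp add: power2_eq_square field_simps)
  ultimately have X: "- 2 * lam * DIM('a) \<le> lam\<^sup>2 * ?X" by simp
  have "(\<Sum>i=1..DIM('a). \<sigma> (i + 1) - \<sigma> 1) \<le> (\<Sum>i=1..DIM('a). \<mu> i - \<mu> 0)"
    using le first by (intro sum_mono diff_mono) auto
  also have "\<dots> \<le> (\<integral>x. (norm (2 *\<^sub>R snd (U 0 x) - fst (U 0 x) *\<^sub>R d\<eta> x))\<^sup>2 \<partial>M)"
  proof (rule trial_functions_inequality[OF U ortho])
    show "\<mu> j * l2_value M G G \<le> l2_energy M G G"
      if "sobolev G" "\<And>i. i < j \<Longrightarrow> l2_value M (U i) G = 0" for j G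
      using that by (rule rayleigh)
  qed (rule mono)
  also have "\<dots> = 4 * \<mu> 0 + 2 * lam * DIM('a) - lam\<^sup>2 * ?X"
    by (rule gaussian_trial_energy[OF gauss U]) (simp add: ortho)
  also have "\<dots> \<le> 4 * (\<sigma> 1 + lam * DIM('a))"
    using X first by (simp add: algebra_simps)
  finally show ?thesis .
qed

end

text \<open>Each domain is treated separately: the outer radius makes it bounded, the inner radius
  is the lower bound on |x|^2, and the gradient of \<eta> is lam x.\<close>

theorem corollary2p7:
  fixes lam :: real
    and \<eta> :: "real ^ 'n \<Rightarrow> real"
    and r :: "nat \<Rightarrow> real"
    and \<Omega> :: "nat \<Rightarrow> (real ^ 'n) set"
    and \<sigma> :: "nat \<Rightarrow> nat \<Rightarrow> real"
  assumes "lam < 0"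
    and "\<And>x. \<eta> x = lam / 2 * (norm x)\<^sup>2"
    and "\<And>l. l \<ge> 1 \<Longrightarrow> r l \<in> \<rat> \<and> r l > sqrt (2 * real CARD('n) / \<bar>lam\<bar>)"
    and "\<And>l. l \<ge> 1 \<Longrightarrow>
           \<Omega> l = {x. 2 * real CARD('n) / \<bar>lam\<bar> < (norm x)\<^sup>2 \<and> (norm x)\<^sup>2 < (r l)\<^sup>2}"
    and "\<And>l. l \<ge> 1 \<Longrightarrow> dirichlet_eigenvalues \<eta> (\<Omega> l) (\<sigma> l)"
  shows "\<forall>l\<ge>1. (\<Sum>i=1..CARD('n). \<sigma> l (i + 1) - \<sigma> l 1)
           \<le> 4 * (\<sigma> l 1 + lam * real CARD('n))"
proof (intro allI impI)
  fix l :: nat assume l: "1 \<le> l"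
  have \<Omega>: "\<Omega> l = {x. 2 * real CARD('n) / \<bar>lam\<bar> < (norm x)\<^sup>2} \<inter> {x. (norm x)\<^sup>2 < (r l)\<^sup>2}"
    using assms(4)[OF l] by auto
  interpret drifted_domain \<eta> "\<lambda>x. lam *\<^sub>R x" "\<Omega> l"
  proof
    show "(\<eta> has_derivative (\<lambda>v. v \<bullet> (lam *\<^sub>R x))) (at x)" for x
    proof -
      have "((\<lambda>x. lam / 2 * (x \<bullet> x)) has_derivative (\<lambda>v. v \<bullet> (lam *\<^sub>R x))) (at x)"
        by (rule derivative_eq_intros refl)+ (simp add: inner_commute)
      moreover have "\<eta> = (\<lambda>x. lam / 2 * (x \<bullet> x))"
        using assms(2) by (simp add: fun_eq_iff power2_norm_eq_inner)
      ultimately show ?thesis by simp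
    qed
    show "continuous_on UNIV (\<lambda>x::real^'n. lam *\<^sub>R x)" by (intro continuous_intros)
    show "open (\<Omega> l)"
      unfolding \<Omega> by (intro open_Int open_Collect_less continuous_intros)
    have "norm x \<le> \<bar>r l\<bar>" if "x \<in> \<Omega> l" for x
      using that abs_le_square_iff[of "norm x" "r l"] unfolding \<Omega> by simp
    then show "bounded (\<Omega> l)" unfolding bounded_iff by blast
  qed
  have "(\<Sum>i=1..DIM(real^'n). \<sigma> l (i + 1) - \<sigma> l 1) \<le> 4 * (\<sigma> l 1 + lam * DIM(real^'n))"
    by (rule gaussian_eigenvalue_inequality[OF refl assms(1) _ assms(5)[OF l]]) (simp add: \<Omega>)
  then show "(\<Sum>i=1..CARD('n). \<sigma> l (i + 1) - \<sigma> l 1) \<le> 4 * (\<sigma> l 1 + lam * real CARD('n))"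
    by simp
qed

end
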